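(* For every real $h \ge 2$, \[R_3(h) \ll h(\log h)^4(\log\log h)^2,\] where $R_3(h)$ is defined in the context below.
   Context: For a finite set $\mathcal D$ of $k$ integers, let $\nu_p(\mathcal D)$ be the number of distinct residue classes modulo the prime $p$ occupied by elements of $\mathcal D$, and define the singular series $\mathfrak S(\mathcal D)=\prod_p (1-1/p)^{-k}(1-\nu_p(\mathcal D)/p)$ (with $\mathfrak S(\emptyset)=1$). Define $\mathfrak S_0(\mathcal D)=\sum_{\mathcal J\subseteq \mathcal D}(-1)^{|\mathcal D\setminus\mathcal J|}\mathfrak S(\mathcal J)$. Define \[R_3(h)=\sum_{\substack{d_1,d_2,d_3\in\mathbb Z\\ 1\le d_i\le h\\ d_1,d_2,d_3 \text{ distinct}}}\mathfrak S_0(\{d_1,d_2,d_3\}),\] the sum being over ordered triples. The implied constant in $\ll$ is absolute. *)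

theory Defs
  imports "HOL-Analysis.Infinite_Products" "HOL-Computational_Algebra.Primes"
begin

definition nu :: "nat \<Rightarrow> int set \<Rightarrow> nat" where
  "nu p D = card ((\<lambda>d. d mod int p) ` D)"

text \<open>
  The Euler product is written as an infinite product over all natural numbers, with factor 1 at
  the non-primes. The notion of convergence behind \<^const>\<open>prodinf\<close> permits finitely many zero
  factors (and then gives the value 0), so inadmissible sets \<open>D\<close> get \<open>singular_series D = 0\<close>.
  For finite \<open>D\<close> all but finitely many factors are \<open>1 + O(1/p\<^sup>2)\<close>, so the product converges.
\<close>

definition singular_series :: "int set \<Rightarrow> real" where
  "singular_series D =
     (\<Prod>p. if prime p
           then (1 - 1 / real p) powi (- int (card D)) * (1 - real (nu p D) / real p)
           else 1)"

lemma singular_series_empty: "singular_series {} = 1"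
  by (simp add: singular_series_def nu_def cong: if_cong)

definition singular_series0 :: "int set \<Rightarrow> real" where
  "singular_series0 D = (\<Sum>J\<in>Pow D. (-1) ^ card (D - J) * singular_series J)"

definition R3 :: "real \<Rightarrow> real" where
  "R3 h = (\<Sum>(d1, d2, d3) \<in> {(d1, d2, d3).
              1 \<le> d1 \<and> real_of_int d1 \<le> h \<and>
              1 \<le> d2 \<and> real_of_int d2 \<le> h \<and>
              1 \<le> d3 \<and> real_of_int d3 \<le> h \<and>
              d1 \<noteq> d2 \<and> d1 \<noteq> d3 \<and> d2 \<noteq> d3}.
            singular_series0 {d1, d2, d3})"

end

theory Submission
  imports Defs "HOL-Analysis.Analysis"
begin

text \<open>
  Put \<open>H = \<lfloor>h\<rfloor>\<close> and let \<open>P\<close> be the product of the primes up to \<open>H\<^sup>3\<close>. Dropping the Euler factors at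
  larger primes costs \<open>O(log\<^sup>3 H)\<close> in total, and by the Chinese remainder theorem the truncated
  refined series of \<open>D\<close> is the mean over \<open>n mod P\<close> of \<open>\<Prod>d\<in>D. X (d - n)\<close>, where \<open>X\<close> is the
  normalised indicator of coprimality to \<open>P\<close> minus 1. Thus \<open>R3 h\<close> is a third moment of short sums of
  \<open>X\<close>, up to a second moment coming from coinciding \<open>d\<close>'s.

  Parseval bounds the third moment by a sum over fractions \<open>r1 / P\<close>, \<open>r2 / P\<close>, \<open>r3 / P\<close> with integral sum,
  weighted by \<open>F / \<phi>(q)\<close>, with \<open>q\<close> the denominator and \<open>F = min H (P / \<bar>r\<bar>)\<close>. Two of the three are comparable
  and at least as large as the third in absolute value, so \<open>F1 F2 F3 \<le> 2 (F1 F3)\<^bsup>3/2\<^esup>\<close> when 3 is the smallest, and one may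
  assume \<open>q1 \<le> q2\<close>. Every prime divides none or at least two of the denominators, so
  \<open>q1 = g y z\<close>, \<open>q2 = g x z\<close>, \<open>q3 = g x y\<close> with \<open>y \<le> x\<close>. Fix the first fraction and \<open>g, y, z\<close>. Two admissible
  third fractions with parameters \<open>x, x'\<close> differ by at least \<open>1 / (g x x')\<close>, because the \<open>y\<close>-part of the
  third fraction is determined by the first; and \<open>y \<le> x\<close> forces the third fraction to be at least
  \<open>1 / (g x\<^sup>2)\<close>. Hence for \<open>x\<close> in a dyadic range \<open>[M, 2M]\<close> at most \<open>O(\<delta> g M\<^sup>2)\<close> of them are below \<open>\<delta>\<close>, so the
  sum over \<open>x\<close> contributes \<open>log H\<close>, times \<open>(x / \<phi>(x))\<^sup>2 = O((log log H)\<^sup>2)\<close>; the sums over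
  \<open>g, y, z\<close> contribute \<open>log\<^sup>3 H\<close>.
\<close>

section \<open>A Mertens bound for prime products\<close>

definition primes_upto :: "nat \<Rightarrow> nat set" where
  "primes_upto N = {p. prime p \<and> p \<le> N}"

lemma finite_primes_upto [simp]: "finite (primes_upto N)"
  unfolding primes_upto_def by (rule finite_subset[of _ "{..N}"]) auto

lemma prime_dvd_prod_primes_iff:
  fixes T :: "nat set"
  assumes "finite T" "\<And>p. p \<in> T \<Longrightarrow> prime p" "prime q"
  shows "q dvd \<Prod>T \<longleftrightarrow> q \<in> T"
  using assms by (metis dvd_prodI prime_dvd_prod_iff primes_dvd_imp_eq)

lemma inj_on_prod_primes:
  fixes S :: "nat set"
  assumes "finite S" "\<And>p. p \<in> S \<Longrightarrow> prime p"
  shows "inj_on (\<lambda>T. \<Prod>T) (Pow S)"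
proof (rule inj_onI)
  fix T U assume TU: "T \<in> Pow S" "U \<in> Pow S" "\<Prod>T = \<Prod>U"
  have fin: "finite T" "finite U" using TU assms(1) by (auto intro: finite_subset)
  have "q \<in> T \<longleftrightarrow> q \<in> U" if "q \<in> S" for q
    using prime_dvd_prod_primes_iff[of T q] prime_dvd_prod_primes_iff[of U q] TU fin assms that
    by (metis Pow_iff subsetD)
  then show "T = U" using TU by blast
qed

lemma prod_primes_dvd:
  fixes T :: "nat set"
  assumes "finite T" "\<And>p. p \<in> T \<Longrightarrow> prime p" "\<And>p. p \<in> T \<Longrightarrow> int p dvd m"
  shows "int (\<Prod>T) dvd m"
  using assms
proof (induction T rule: finite_induct)
  case (insert p T)
  have "coprime p (\<Prod>T)"
    using insert by (metis insertCI prime_dvd_prod_primes_iff prime_imp_coprime)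
  then have "coprime (int p) (int (\<Prod>T))" using coprime_int_iff by blast
  then show ?case using insert by (simp add: divides_mult)
qed simp

text \<open>Double counting of the pairs \<open>p dvd m\<close> with \<open>m \<le> N\<close>,
  weighted by \<open>ln p\<close>. For fixed \<open>m\<close> the primes dividing \<open>m\<close>
  have product at most \<open>N\<close>, so they contribute at most \<open>ln N\<close>; for fixed
  \<open>p\<close> there are at least \<open>N div p\<close> multiples.\<close>

lemma sum_ln_prime_over_prime_le:
  assumes "N \<ge> 1"
  shows "(\<Sum>p\<in>primes_upto N. ln (real p) / real p) \<le> 2 * ln (real N)"
proof -
  have pr: "prime p" "p \<ge> 2" "p \<le> N" if "p \<in> primes_upto N" for p
    using that by (auto simp: primes_upto_def prime_ge_2_nat)
  have one: "(\<Sum>p\<in>{p\<in>primes_upto N. p dvd m}. ln (real p)) \<le> ln (real N)" if "m \<in> {1..N}" for m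
  proof -
    let ?A = "{p\<in>primes_upto N. p dvd m}"
    have "int (\<Prod>?A) dvd int m" by (rule prod_primes_dvd) (use pr in auto)
    then have "\<Prod>?A dvd m" by (simp only: int_dvd_int_iff)
    then have "\<Prod>?A \<le> m" by (rule dvd_imp_le) (use that in simp)
    moreover have "m \<le> N" using that by simp
    ultimately have le: "\<Prod>?A \<le> N" by (rule le_trans)
    have pos: "p > 0" if "p \<in> ?A" for p using that pr(2)[of p] by simp
    have "(\<Sum>p\<in>?A. ln (real p)) = ln (\<Prod>p\<in>?A. real p)"
      by (rule ln_prod[symmetric]) (use pos in auto)
    also have "(\<Prod>p\<in>?A. real p) = real (\<Prod>?A)" by (rule of_nat_prod[symmetric])
    also have "ln (real (\<Prod>?A)) \<le> ln (real N)"
    proof (rule ln_mono)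
      show "real (\<Prod>?A) \<le> real N" using le by (simp only: of_nat_le_iff)
      have "\<Prod>?A > 0" using pos by (intro prod_pos) blast
      then show "0 < real (\<Prod>?A)" by (simp only: of_nat_0_less_iff)
    qed
    finally show ?thesis .
  qed
  have "real N * (\<Sum>p\<in>primes_upto N. ln (real p) / real p) = (\<Sum>p\<in>primes_upto N. real N / real p * ln (real p))"
    by (simp add: sum_distrib_left)
  also have "\<dots> \<le> (\<Sum>p\<in>primes_upto N. 2 * (\<Sum>m\<in>{m\<in>{1..N}. p dvd m}. ln (real p)))"
  proof (rule sum_mono)
    fix p assume p: "p \<in> primes_upto N"
    have inj: "inj_on (\<lambda>k. p * k) {1..N div p}" using pr[OF p] by (intro inj_onI) auto
    have img: "(\<lambda>k. p * k) ` {1..N div p} \<subseteq> {m\<in>{1..N}. p dvd m}"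
    proof
      fix m assume "m \<in> (\<lambda>k. p * k) ` {1..N div p}"
      then obtain k where k: "m = p * k" "1 \<le> k" "k \<le> N div p" by (metis atLeastAtMost_iff imageE)
      have "p * k \<le> p * (N div p)" using k by simp
      also have "\<dots> \<le> N" by simp
      finally show "m \<in> {m\<in>{1..N}. p dvd m}" using k pr[OF p] by simp
    qed
    have "N div p \<le> card {m\<in>{1..N}. p dvd m}"
      using card_mono[OF _ img] card_image[OF inj] by simp
    moreover have "N div p \<ge> 1" using pr[OF p] by (simp add: Suc_leI div_greater_zero_iff)
    \<comment> \<open>As \<open>N div p\<close> is at least 1, the rounding loss of 1 costs a factor
      of 2; this is the 2 in the bound.\<close>
    moreover have "real N / real p \<le> real (N div p) + 1"
    proof -
      have "N < p + p * (N div p)" by (rule dividend_less_times_div) (use pr[OF p] in simp)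
      then have "real N < real p * (real (N div p) + 1)"
        by (metis add.commute distrib_left mult.right_neutral of_nat_1 of_nat_add of_nat_less_iff of_nat_mult)
      then show ?thesis using pr[OF p] by (simp add: divide_simps mult.commute)
    qed
    ultimately have "real N / real p \<le> 2 * real (card {m\<in>{1..N}. p dvd m})" by linarith
    moreover have "ln (real p) \<ge> 0" using pr[OF p] by simp
    ultimately have "real N / real p * ln (real p) \<le> 2 * real (card {m\<in>{1..N}. p dvd m}) * ln (real p)"
      by (intro mult_right_mono)
    then show "real N / real p * ln (real p) \<le> 2 * (\<Sum>m\<in>{m\<in>{1..N}. p dvd m}. ln (real p))"
      by simp
  qed
  also have "\<dots> = 2 * (\<Sum>p\<in>primes_upto N. \<Sum>m\<in>{m\<in>{1..N}. p dvd m}. ln (real p))"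
    by (simp add: sum_distrib_left)
  also have "(\<Sum>p\<in>primes_upto N. \<Sum>m\<in>{m\<in>{1..N}. p dvd m}. ln (real p))
      = (\<Sum>m\<in>{1..N}. \<Sum>p\<in>{p\<in>primes_upto N. p dvd m}. ln (real p))"
    by (rule sum.swap_restrict) auto
  also have "\<dots> \<le> (\<Sum>m\<in>{1..N}. ln (real N))" by (intro sum_mono one)
  finally show ?thesis using assms by simp
qed

text \<open>A discrete integral test: \<open>s * n powr (-1 - s)\<close> is at most the telescoping
  difference \<open>(n - 1) powr (-s) - n powr (-s)\<close>, which follows from
  \<open>1 + s / n \<le> (1 - 1 / n) powr (-s)\<close>. The term \<open>n = 1\<close> gives the
  summand 1.\<close>

lemma sum_powr_le:
  fixes s :: real
  assumes "s > 0"
  shows "(\<Sum>n\<in>{1..M}. real n powr (-1 - s)) \<le> 1 + 1 / s"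
proof -
  have step: "s * real n powr (-1 - s) \<le> real (n - 1) powr (-s) - real n powr (-s)" if "n \<ge> 2" for n
  proof -
    have n: "real n > 1" using that by simp
    have "1 + s / real n \<le> 1 - s * ln (1 - 1 / real n)"
    proof -
      have "ln (1 - 1 / real n) \<le> - (1 / real n)"
        using ln_add_one_self_le_self2[of "- (1 / real n)"] n by simp
      then show ?thesis using mult_left_mono[of "ln (1 - 1 / real n)" "- (1 / real n)" s] assms by simp
    qed
    also have "\<dots> \<le> exp (- s * ln (1 - 1 / real n))"
      using exp_ge_add_one_self[of "- s * ln (1 - 1 / real n)"] by simp
    also have "\<dots> = (1 - 1 / real n) powr (-s)" using n by (simp add: powr_def)
    finally have "real n powr (-s) * (1 + s / real n) \<le> real n powr (-s) * (1 - 1 / real n) powr (-s)"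
      by (intro mult_left_mono) auto
    also have "\<dots> = (real n * (1 - 1 / real n)) powr (-s)"
      using n by (subst powr_mult) auto
    also have "real n * (1 - 1 / real n) = real (n - 1)" using that by (simp add: field_simps of_nat_diff)
    finally have "real n powr (-s) + s * (real n powr (-s) / real n) \<le> real (n - 1) powr (-s)"
      by (simp add: algebra_simps)
    moreover have "real n powr (-1 - s) = real n powr (-s) / real n"
      using n by (simp add: powr_diff powr_minus divide_simps)
    ultimately show ?thesis by simp
  qed
  have "s * (\<Sum>n\<in>{1..M}. real n powr (-1 - s)) \<le> s + 1 - real M powr (-s)" if "M \<ge> 1" for M
    using that
  proof (induction M rule: dec_induct)
    case (step k)
    then have "s * (\<Sum>n\<in>{1..Suc k}. real n powr (-1 - s))
        \<le> (s + 1 - real k powr (-s)) + s * real (Suc k) powr (-1 - s)"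
      by (simp add: distrib_left)
    also have "\<dots> \<le> s + 1 - real (Suc k) powr (-s)" using \<open>\<And>n. 2 \<le> n \<Longrightarrow> _\<close>[of "Suc k"] step by simp
    finally show ?case .
  qed simp
  then have "s * (\<Sum>n\<in>{1..M}. real n powr (-1 - s)) \<le> s + 1"
  proof (cases "M \<ge> 1")
    case True
    then show ?thesis using \<open>\<And>M. 1 \<le> M \<Longrightarrow> _\<close>[of M] powr_ge_zero[of "real M" "-s"] by linarith
  qed (use assms in auto)
  then show ?thesis using assms by (simp add: field_simps)
qed

text \<open>
  Rankin's trick: the product of \<open>1 + p powr (-1 - s)\<close> is bounded by \<open>\<Sum>n powr (-1 - s)\<close>, and with
  \<open>s = 1 / ln N\<close> the two products differ by at most the factor
  \<open>exp (s * (\<Sum>p\<le>N. ln p / p)) \<le> exp 2\<close>.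
\<close>

lemma prod_primes_upto_le:
  assumes "N \<ge> 2"
  shows "(\<Prod>p\<in>primes_upto N. 1 + 1 / real p) \<le> exp 2 * (1 + ln (real N))"
proof -
  define s where "s = 1 / ln (real N)"
  have lnN: "ln (real N) > 0" using assms by simp
  have s: "s > 0" using lnN by (simp add: s_def)
  have pr: "prime p" "p \<ge> 2" "p \<le> N" if "p \<in> primes_upto N" for p
    using that by (auto simp: primes_upto_def prime_ge_2_nat)
  have "(\<Prod>p\<in>primes_upto N. 1 + 1 / real p)
      \<le> (\<Prod>p\<in>primes_upto N. (1 + real p powr (-1 - s)) * exp (s * (ln (real p) / real p)))"
  proof (rule prod_mono, safe)
    fix p assume p: "p \<in> primes_upto N"
    have p0: "real p > 0" using pr[OF p] by simp
    let ?b = "real p powr (-1 - s)"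
    have b: "?b = real p powr (-s) / real p"
      using p0 by (simp add: powr_diff powr_minus divide_simps)
    have "1 - s * ln (real p) \<le> real p powr (-s)"
      using p0 exp_ge_add_one_self[of "-s * ln (real p)"] by (simp add: powr_def)
    then have "1 / real p - ?b \<le> s * (ln (real p) / real p)"
      using p0 by (simp add: b divide_simps)
    then have "1 + (1 / real p - ?b) \<le> exp (s * (ln (real p) / real p))"
      using exp_ge_add_one_self[of "s * (ln (real p) / real p)"] by linarith
    then have "(1 + ?b) * (1 + (1 / real p - ?b)) \<le> (1 + ?b) * exp (s * (ln (real p) / real p))"
      by (intro mult_left_mono) auto
    \<comment> \<open>With \<open>a = 1 / p\<close> and \<open>0 \<le> b \<le> a\<close>, the
      product \<open>(1 + b) * (1 + (a - b))\<close> exceeds \<open>1 + a\<close> by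
      \<open>b * (a - b)\<close>.\<close>
    moreover have "?b \<le> 1 / real p"
    proof -
      have "real p powr (-s) \<le> 1" using pr[OF p] s by (simp add: powr_minus ge_one_powr_ge_zero inverse_le_1_iff)
      then show ?thesis using p0 by (simp add: b divide_simps)
    qed
    then have "0 \<le> ?b * (1 / real p - ?b)" by simp
    then have "1 + 1 / real p \<le> (1 + ?b) * (1 + (1 / real p - ?b))" by (simp add: algebra_simps)
    ultimately show "1 + 1 / real p \<le> (1 + ?b) * exp (s * (ln (real p) / real p))" by linarith
  qed auto
  also have "\<dots> = (\<Prod>p\<in>primes_upto N. 1 + real p powr (-1 - s)) * exp (s * (\<Sum>p\<in>primes_upto N. ln (real p) / real p))"
    by (simp add: prod.distrib exp_sum sum_distrib_left)
  also have "\<dots> \<le> (1 + ln (real N)) * exp 2"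
  proof (intro mult_mono)
    have "(\<Prod>p\<in>primes_upto N. 1 + real p powr (-1 - s)) = (\<Sum>T\<in>Pow (primes_upto N). \<Prod>p\<in>T. real p powr (-1 - s))"
      by (subst add.commute, subst prod_add) auto
    also have "\<dots> = (\<Sum>T\<in>Pow (primes_upto N). real (\<Prod>T) powr (-1 - s))"
      by (intro sum.cong refl) (simp add: prod_powr_distrib)
    \<comment> \<open>By unique factorisation different sets of primes have different products, so
      the expanded product is part of the sum over all positive integers.\<close>
    also have "\<dots> = (\<Sum>n\<in>Prod ` Pow (primes_upto N). real n powr (-1 - s))"
      by (subst sum.reindex) (auto intro!: inj_on_prod_primes pr simp: o_def)
    also have "\<dots> \<le> (\<Sum>n\<in>{1..Max (Prod ` Pow (primes_upto N))}. real n powr (-1 - s))"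
    proof (intro sum_mono2)
      show "Prod ` Pow (primes_upto N) \<subseteq> {1..Max (Prod ` Pow (primes_upto N))}"
      proof
        fix x assume x: "x \<in> Prod ` Pow (primes_upto N)"
        then obtain T where T: "T \<subseteq> primes_upto N" "x = \<Prod>T" by blast
        have "\<Prod>T \<ge> 1" using T pr(2) by (intro prod_ge_1) (metis One_nat_def Suc_leD numeral_2_eq_2 subsetD)
        moreover have "x \<le> Max (Prod ` Pow (primes_upto N))" using x by (intro Max_ge) auto
        ultimately show "x \<in> {1..Max (Prod ` Pow (primes_upto N))}" using T by simp
      qed
    qed auto
    also have "\<dots> \<le> 1 + 1 / s" by (rule sum_powr_le[OF s])
    finally show "(\<Prod>p\<in>primes_upto N. 1 + real p powr (-1 - s)) \<le> 1 + ln (real N)" by (simp add: s_def)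
    have "s * (\<Sum>p\<in>primes_upto N. ln (real p) / real p) \<le> s * (2 * ln (real N))"
      using s assms by (intro mult_left_mono sum_ln_prime_over_prime_le) auto
    then show "exp (s * (\<Sum>p\<in>primes_upto N. ln (real p) / real p)) \<le> exp 2"
      using lnN by (simp add: s_def)
  qed (use lnN in auto)
  finally show ?thesis by (simp add: mult.commute)
qed

section \<open>Truncating the singular series\<close>

definition euler_factor :: "int set \<Rightarrow> nat \<Rightarrow> real" where
  "euler_factor D p = (1 - 1 / real p) powi (- int (card D)) * (1 - real (nu p D) / real p)"

definition truncated_series :: "nat \<Rightarrow> int set \<Rightarrow> real" where
  "truncated_series N D = (\<Prod>p\<in>primes_upto N. euler_factor D p)"

lemma nu_le:
  assumes "p > 0"
  shows "nu p D \<le> p"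
proof -
  have "(\<lambda>d. d mod int p) ` D \<subseteq> {0..<int p}" using assms by auto
  then have "card ((\<lambda>d. d mod int p) ` D) \<le> card {0..<int p}" by (intro card_mono) auto
  then show ?thesis by (simp add: nu_def)
qed

lemma nu_eq_card:
  assumes "D \<subseteq> {1..int N}" "p > N"
  shows "nu p D = card D"
proof -
  have "(\<lambda>d. d mod int p) ` D = (\<lambda>d. d) ` D"
    by (rule image_cong) (use assms in \<open>auto intro!: mod_pos_pos_trivial\<close>)
  then show ?thesis by (simp add: nu_def)
qed

lemma euler_factor_nonneg: "p > 0 \<Longrightarrow> euler_factor D p \<ge> 0"
  using nu_le[of p D] by (auto simp: euler_factor_def intro!: mult_nonneg_nonneg)

lemma truncated_series_nonneg: "truncated_series N D \<ge> 0"
  unfolding truncated_series_def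
  by (intro prod_nonneg ballI euler_factor_nonneg) (auto simp: primes_upto_def prime_gt_0_nat)

lemma truncated_series_le:
  assumes "card D \<le> 3"
  shows "truncated_series N D \<le> (\<Prod>p\<in>primes_upto N. real p / (real p - 1)) ^ 3"
proof -
  have "euler_factor D p \<le> (real p / (real p - 1)) ^ 3" if "p \<in> primes_upto N" for p
  proof -
    have p: "real p \<ge> 2" using that by (auto simp: primes_upto_def prime_ge_2_nat)
    have Z: "1 / (1 - 1 / real p) = real p / (real p - 1)" using p by (simp add: divide_simps)
    have "euler_factor D p \<le> (1 - 1 / real p) powi (- int (card D)) * 1"
      unfolding euler_factor_def using p by (intro mult_left_mono) auto
    also have "\<dots> = (real p / (real p - 1)) ^ card D"
      using Z by (simp add: power_int_minus inverse_eq_divide flip: power_one_over)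
    also have "\<dots> \<le> (real p / (real p - 1)) ^ 3"
      using p assms by (intro power_increasing) auto
    finally show ?thesis .
  qed
  then have "truncated_series N D \<le> (\<Prod>p\<in>primes_upto N. (real p / (real p - 1)) ^ 3)"
    unfolding truncated_series_def
    by (intro prod_mono) (auto simp: primes_upto_def prime_gt_0_nat intro!: euler_factor_nonneg)
  then show ?thesis by (simp add: prod_power_distrib)
qed

text \<open>For \<open>p > N\<close> the elements of \<open>D\<close> lie in distinct classes, so
  with \<open>t = 1 / p\<close> and \<open>k \<le> 3\<close> elements the factor is
  \<open>(1 - k * t) / (1 - t) ^ k\<close>. The numerator falls short of the denominator by at most
  \<open>3 * t^2\<close>, and the denominator is at least 1/8, whence 24.\<close>

lemma euler_factor_tail:
  assumes "D \<subseteq> {1..int N}" "card D \<le> 3" "p > N" "N \<ge> 3"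
  shows "1 - 24 / (real p)\<^sup>2 \<le> euler_factor D p" "euler_factor D p \<le> 1"
proof -
  define t where "t = 1 / real p"
  have t: "0 < t" "t \<le> 1 / 4" using assms by (auto simp: t_def divide_simps)
  let ?k = "card D"
  have pos: "(1 - t) ^ ?k > 0" using t by simp
  have E: "euler_factor D p = (1 - real ?k * t) / (1 - t) ^ ?k"
    using nu_eq_card[OF assms(1,3)]
    by (simp add: euler_factor_def t_def power_int_minus divide_simps)
  have "?k = 0 \<or> ?k = 1 \<or> ?k = 2 \<or> ?k = 3" using assms(2) by linarith
  then have ineq: "1 - real ?k * t \<le> (1 - t) ^ ?k \<and> (1 - 24 * t\<^sup>2) * (1 - t) ^ ?k \<le> 1 - real ?k * t"
  proof (elim disjE)
    assume k: "?k = 2"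
    have "(1 - 24 * t\<^sup>2) * (1 - t)^2 = 1 - 2 * t + t\<^sup>2 - 24 * t\<^sup>2 * (1 - t)^2" by algebra
    moreover have "(1 - t)^2 \<ge> 1/4" using power_mono[of "1/2" "1 - t" 2] t by (simp add: power_divide)
    then have "24 * t\<^sup>2 * (1 - t)^2 \<ge> 24 * t\<^sup>2 * (1/4)" by (intro mult_left_mono) auto
    moreover have "1 - 2 * t \<le> (1 - t)^2" by (simp add: power2_diff)
    ultimately show ?thesis using zero_le_power2[of t] unfolding k of_nat_numeral by (intro conjI; linarith)
  next
    assume k: "?k = 3"
    define b c d where "b = (3 - t) * t\<^sup>2" and "c = t\<^sup>2 * (1 - t)^3" and "d = t\<^sup>2"
    have cube: "(1 - t)^3 = 1 - 3 * t + b" unfolding b_def by algebra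
    have lhs: "(1 - 24 * t\<^sup>2) * (1 - t)^3 = 1 - 3 * t + b - 24 * c" unfolding b_def c_def by algebra
    have "(1 - t)^3 \<ge> 1/8" using power_mono[of "1/2" "1 - t" 3] t by (simp add: power_divide)
    then have c: "c \<ge> d * (1/8)" unfolding c_def d_def by (intro mult_left_mono) auto
    have b: "b \<le> 3 * d" unfolding b_def d_def using t by (intro mult_right_mono) auto
    have "0 \<le> b" using t by (simp add: b_def)
    then have "1 - 3 * t \<le> (1 - t)^3" unfolding cube by simp
    moreover have "(1 - 24 * t\<^sup>2) * (1 - t)^3 \<le> 1 - 3 * t" unfolding lhs using b c by simp
    ultimately show ?thesis unfolding k by simp
  next
    assume k: "?k = 1"
    have "0 \<le> 24 * t\<^sup>2 * (1 - t)" using t by simp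
    then show ?thesis using k by (simp add: algebra_simps)
  qed auto
  show "euler_factor D p \<le> 1" using ineq pos by (simp add: E)
  have "24 / (real p)\<^sup>2 = 24 * t\<^sup>2" by (simp add: t_def power_divide)
  then show "1 - 24 / (real p)\<^sup>2 \<le> euler_factor D p" using ineq pos by (simp add: E pos_le_divide_eq)
qed

lemma sum_inverse_squares_tail:
  assumes "N \<ge> 1"
  shows "(\<Sum>n\<in>{N<..M}. 1 / (real n)\<^sup>2) \<le> 1 / real N"
proof -
  have "(\<Sum>n\<in>{N<..M}. 1 / (real n)\<^sup>2) \<le> 1 / real N - 1 / real M" if "M \<ge> N" for M
    using that
  proof (induction M rule: dec_induct)
    case (step m)
    have m: "real m > 0" using step assms by simp
    have "{N<..Suc m} = insert (Suc m) {N<..m}" using step by auto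
    then have "(\<Sum>n\<in>{N<..Suc m}. 1 / (real n)\<^sup>2) \<le> 1 / (real (Suc m))\<^sup>2 + (1 / real N - 1 / real m)"
      using step by simp
    also have "1 / (real (Suc m))\<^sup>2 \<le> 1 / real m - 1 / real (Suc m)"
      using m by (simp add: divide_simps power2_eq_square)
    finally show ?case by simp
  qed simp
  from this[of M] show ?thesis
  proof (cases "M \<ge> N")
    case True
    then show ?thesis using \<open>M \<ge> N \<Longrightarrow> _\<close> by (smt (verit) of_nat_0_le_iff zero_le_divide_1_iff)
  qed auto
qed

text \<open>Every factor beyond \<open>N\<close> lies in \<open>[1 - 24 / p^2, 1]\<close>, so by the
  Weierstrass product inequality each finite tail product lies in \<open>[1 - 24 / N, 1]\<close>,
  and the bound survives the limit. The error is relative to the truncated product, which covers the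
  case where that product is 0.\<close>

lemma singular_series_truncation:
  assumes D: "D \<subseteq> {1..int N}" "card D \<le> 3" and N: "N \<ge> 3"
  shows "\<bar>singular_series D - truncated_series N D\<bar> \<le> 24 / real N * truncated_series N D"
proof -
  define f where "f = (\<lambda>p. if prime p then euler_factor D p else 1)"
  have sing: "singular_series D = prodinf f"
    by (simp add: singular_series_def f_def euler_factor_def cong: if_cong)
  have bnd: "1 - 24 / (real p)\<^sup>2 \<le> f p" "f p \<le> 1" if "p > N" for p
    using euler_factor_tail[OF D that N] by (auto simp: f_def)
  \<comment> \<open>Absolute summability of \<open>f - 1\<close> makes the product converge, so that
    \<open>prodinf\<close> is the limit of the partial products.\<close>
  have "summable (\<lambda>n. norm (f n - 1))"
  proof (rule summable_comparison_test)
    show "\<exists>N. \<forall>n\<ge>N. norm (norm (f n - 1)) \<le> 24 * (1 / (real n)\<^sup>2)"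
    proof (intro exI[of _ "Suc N"] allI impI)
      fix n assume "n \<ge> Suc N"
      then show "norm (norm (f n - 1)) \<le> 24 * (1 / (real n)\<^sup>2)" using bnd[of n] by simp
    qed
    show "summable (\<lambda>n. 24 * (1 / (real n)\<^sup>2))"
      using inverse_power_summable[of 2, where 'a = real]
      by (intro summable_mult) (simp add: inverse_eq_divide)
  qed
  then have "convergent_prod f"
    by (intro abs_convergent_prod_imp_convergent_prod summable_imp_abs_convergent_prod)
  then have lim: "(\<lambda>n. \<Prod>i\<le>n. f i) \<longlonglongrightarrow> singular_series D"
    unfolding sing by (rule convergent_prod_LIMSEQ)
  have part: "(\<Prod>i\<le>M. f i) = truncated_series M D" for M
  proof -
    have "truncated_series M D = (\<Prod>i\<in>{i\<in>{..M}. prime i}. euler_factor D i)"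
      unfolding truncated_series_def by (rule prod.cong) (auto simp: primes_upto_def)
    also have "\<dots> = (\<Prod>i\<le>M. f i)"
      unfolding f_def by (rule prod.inter_filter) simp
    finally show ?thesis by simp
  qed
  have close: "\<bar>truncated_series M D - truncated_series N D\<bar> \<le> 24 / real N * truncated_series N D" if M: "M \<ge> N" for M
  proof -
    have "{..M} = {..N} \<union> {N<..M}" using M by auto
    then have split: "truncated_series M D = truncated_series N D * (\<Prod>i\<in>{N<..M}. f i)"
      unfolding part[symmetric] by (simp only:) (subst prod.union_disjoint, auto)
    have f0: "f i \<ge> 0" if "i > N" for i using that by (auto simp: f_def intro!: euler_factor_nonneg)
    have le1: "(\<Prod>i\<in>{N<..M}. f i) \<le> 1" by (rule prod_le_1) (use bnd f0 in auto)
    have "(\<Sum>i\<in>{N<..M}. 1 - f i) \<le> (\<Sum>i\<in>{N<..M}. 24 * (1 / (real i)\<^sup>2))"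
      by (rule sum_mono) (use bnd in \<open>auto simp: algebra_simps\<close>)
    also have "\<dots> \<le> 24 * (1 / real N)"
      unfolding sum_distrib_left[symmetric] using N by (intro mult_left_mono sum_inverse_squares_tail) auto
    finally have s: "(\<Sum>i\<in>{N<..M}. 1 - f i) \<le> 24 / real N" by simp
    have "1 - (\<Sum>i\<in>{N<..M}. 1 - f i) \<le> (\<Prod>i\<in>{N<..M}. 1 - (1 - f i))"
      by (rule Weierstrass_prod_ineq) (use bnd f0 in auto)
    then have ge: "1 - 24 / real N \<le> (\<Prod>i\<in>{N<..M}. f i)" using s by simp
    have "truncated_series N D - truncated_series M D = truncated_series N D * (1 - (\<Prod>i\<in>{N<..M}. f i))"
      by (simp add: split algebra_simps)
    moreover have "\<dots> \<le> truncated_series N D * (24 / real N)"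
      using ge truncated_series_nonneg by (intro mult_left_mono) auto
    moreover have "\<dots> \<ge> 0" "truncated_series N D * (1 - (\<Prod>i\<in>{N<..M}. f i)) \<ge> 0"
      using le1 truncated_series_nonneg[of N D] by auto
    ultimately show ?thesis by (simp add: mult.commute)
  qed
  have "(\<lambda>M. \<bar>truncated_series M D - truncated_series N D\<bar>) \<longlonglongrightarrow> \<bar>singular_series D - truncated_series N D\<bar>"
    using lim unfolding part by (intro tendsto_intros)
  then show ?thesis
    by (rule Lim_bounded) (use close in auto)
qed

section \<open>The truncated series as a moment modulo the primorial\<close>

lemma sum_chinese_remainder:
  fixes g :: "int \<Rightarrow> int \<Rightarrow> 'a::comm_semiring_1" and p Q :: int
  assumes "coprime p Q" "p > 0" "Q > 0"
  shows "(\<Sum>n\<in>{0..<p * Q}. g (n mod p) (n mod Q)) = (\<Sum>a\<in>{0..<p}. \<Sum>b\<in>{0..<Q}. g a b)"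
proof -
  let ?h = "\<lambda>n. (n mod p, n mod Q)"
  have inj: "inj_on ?h {0..<p * Q}"
  proof (rule inj_onI)
    fix m n assume mn: "m \<in> {0..<p * Q}" "n \<in> {0..<p * Q}" "?h m = ?h n"
    then have "p dvd m - n" "Q dvd m - n" by (auto simp: mod_eq_dvd_iff)
    then have "p * Q dvd m - n" using assms by (intro divides_mult)
    then have "m mod (p * Q) = n mod (p * Q)" by (simp add: mod_eq_dvd_iff)
    then show "m = n" using mn by simp
  qed
  have "?h ` {0..<p * Q} = {0..<p} \<times> {0..<Q}"
  proof (rule card_subset_eq)
    show "?h ` {0..<p * Q} \<subseteq> {0..<p} \<times> {0..<Q}" using assms by auto
    show "card (?h ` {0..<p * Q}) = card ({0..<p} \<times> {0..<Q})"
      using assms by (simp add: card_image[OF inj] nat_mult_distrib)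
  qed simp
  then have "(\<Sum>(a, b)\<in>{0..<p} \<times> {0..<Q}. g a b) = (\<Sum>(a, b)\<in>?h ` {0..<p * Q}. g a b)" by simp
  also have "\<dots> = (\<Sum>n\<in>{0..<p * Q}. g (n mod p) (n mod Q))"
    by (subst sum.reindex[OF inj]) simp
  finally have "(\<Sum>(a, b)\<in>{0..<p} \<times> {0..<Q}. g a b) = \<dots>" .
  then show ?thesis by (simp add: sum.cartesian_product)
qed

text \<open>The Chinese remainder theorem, one prime at a time: the residues of \<open>n\<close>
  modulo the primes of \<open>S\<close> vary independently.\<close>

lemma sum_prod_mod_primes:
  fixes g :: "nat \<Rightarrow> int \<Rightarrow> 'a::comm_semiring_1"
  assumes "finite S" "\<And>p. p \<in> S \<Longrightarrow> prime p"
  shows "(\<Sum>n\<in>{0..<int (\<Prod>S)}. \<Prod>p\<in>S. g p (n mod int p)) = (\<Prod>p\<in>S. \<Sum>a\<in>{0..<int p}. g p a)"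
  using assms
proof (induction S rule: finite_induct)
  case (insert p S)
  have cop: "coprime (int p) (int (\<Prod>S))"
    using insert by (metis coprime_int_iff insertCI prime_dvd_prod_primes_iff prime_imp_coprime)
  have pos: "int p > 0" "int (\<Prod>S) > 0"
    using insert by (auto simp: prime_gt_0_nat intro!: prod_pos)
  have eq: "(\<Prod>q\<in>S. g q (n mod int (\<Prod>S) mod int q)) = (\<Prod>q\<in>S. g q (n mod int q))" for n
  proof (intro prod.cong refl)
    fix q assume "q \<in> S"
    then have "q dvd \<Prod>S" using insert.hyps by (intro dvd_prodI) auto
    then have "int q dvd int (\<Prod>S)" by (simp only: int_dvd_int_iff)
    then show "g q (n mod int (\<Prod>S) mod int q) = g q (n mod int q)" by (simp only: mod_mod_cancel)
  qed
  have "(\<Sum>n\<in>{0..<int (\<Prod>(insert p S))}. \<Prod>q\<in>insert p S. g q (n mod int q))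
     = (\<Sum>n\<in>{0..<int p * int (\<Prod>S)}. g p (n mod int p) * (\<Prod>q\<in>S. g q (n mod int (\<Prod>S) mod int q)))"
    unfolding eq using insert.hyps by simp
  also have "\<dots> = (\<Sum>a\<in>{0..<int p}. \<Sum>b\<in>{0..<int (\<Prod>S)}. g p a * (\<Prod>q\<in>S. g q (b mod int q)))"
    by (rule sum_chinese_remainder[OF cop pos])
  also have "\<dots> = (\<Sum>a\<in>{0..<int p}. g p a) * (\<Sum>b\<in>{0..<int (\<Prod>S)}. \<Prod>q\<in>S. g q (b mod int q))"
    by (simp add: sum_product)
  also have "(\<Sum>b\<in>{0..<int (\<Prod>S)}. \<Prod>q\<in>S. g q (b mod int q)) = (\<Prod>q\<in>S. \<Sum>a\<in>{0..<int q}. g q a)"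
    using insert by simp
  finally show ?case using insert.hyps by simp
qed simp

text \<open>Newton's identity \<open>6 e_3 = p_1^3 - 3 p_1 p_2 + 2 p_3\<close>, obtained by
  inclusion-exclusion over coincidences of indices.\<close>

lemma sum_distinct_triples:
  fixes f :: "'b \<Rightarrow> 'a::comm_ring_1"
  assumes "finite A"
  shows "(\<Sum>(a, b, c)\<in>{(a, b, c). a \<in> A \<and> b \<in> A \<and> c \<in> A \<and> a \<noteq> b \<and> a \<noteq> c \<and> b \<noteq> c}. f a * f b * f c)
      = (\<Sum>a\<in>A. f a) ^ 3 - 3 * (\<Sum>a\<in>A. f a) * (\<Sum>a\<in>A. (f a)\<^sup>2) + 2 * (\<Sum>a\<in>A. f a ^ 3)"
proof -
  let ?D = "{(a, b, c). a \<in> A \<and> b \<in> A \<and> c \<in> A \<and> a \<noteq> b \<and> a \<noteq> c \<and> b \<noteq> c}"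
  have "(\<Sum>(a, b, c)\<in>?D. f a * f b * f c)
     = (\<Sum>(a, b, c)\<in>A \<times> A \<times> A. if a \<noteq> b \<and> a \<noteq> c \<and> b \<noteq> c then f a * f b * f c else 0)"
    by (rule sum.mono_neutral_cong_left) (use assms in auto)
  also have "\<dots> = (\<Sum>a\<in>A. \<Sum>b\<in>A. \<Sum>c\<in>A. if a \<noteq> b \<and> a \<noteq> c \<and> b \<noteq> c then f a * f b * f c else 0)"
    by (simp add: sum.cartesian_product)
  \<comment> \<open>A triple with all three indices equal is removed three times by the pair
    corrections, so twice its value is added back.\<close>
  also have "\<dots> = (\<Sum>a\<in>A. \<Sum>b\<in>A. \<Sum>c\<in>A. f a * f b * f c
       - (if a = b then f a * f b * f c else 0) - (if a = c then f a * f b * f c else 0)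
       - (if b = c then f a * f b * f c else 0) + (if a = b then if a = c then 2 * (f a * f b * f c) else 0 else 0))"
    by (intro sum.cong refl) auto
  also have "\<dots> = (\<Sum>a\<in>A. \<Sum>b\<in>A. \<Sum>c\<in>A. f a * f b * f c)
      - (\<Sum>a\<in>A. \<Sum>c\<in>A. f a * f a * f c) - (\<Sum>a\<in>A. \<Sum>b\<in>A. f a * f b * f a)
      - (\<Sum>a\<in>A. \<Sum>b\<in>A. f a * f b * f b) + (\<Sum>a\<in>A. 2 * (f a * f a * f a))"
  proof -
    have "(\<Sum>b\<in>A. \<Sum>c\<in>A. if a = b then f a * f b * f c else 0) = (\<Sum>c\<in>A. f a * f a * f c)" if "a \<in> A" for a
      using assms that by (subst sum.swap) simp
    moreover have "(\<Sum>b\<in>A. \<Sum>c\<in>A. if a = b then if a = c then 2 * (f a * f b * f c) else 0 else 0) = 2 * (f a * f a * f a)" if "a \<in> A" for a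
      using assms that by (subst sum.swap) simp
    ultimately show ?thesis using assms by (simp add: sum.distrib sum_subtractf)
  qed
  also have "(\<Sum>a\<in>A. \<Sum>b\<in>A. \<Sum>c\<in>A. f a * f b * f c) = (\<Sum>a\<in>A. f a) ^ 3"
    by (simp add: power3_eq_cube sum_distrib_left sum_distrib_right mult_ac)
  also have "(\<Sum>a\<in>A. \<Sum>c\<in>A. f a * f a * f c) = (\<Sum>a\<in>A. (f a)\<^sup>2) * (\<Sum>a\<in>A. f a)"
    by (simp add: sum_product power2_eq_square)
  also have "(\<Sum>a\<in>A. \<Sum>b\<in>A. f a * f b * f a) = (\<Sum>a\<in>A. (f a)\<^sup>2) * (\<Sum>a\<in>A. f a)"
    by (simp only: sum_product power2_eq_square) (simp only: mult_ac)
  also have "(\<Sum>a\<in>A. \<Sum>b\<in>A. f a * f b * f b) = (\<Sum>a\<in>A. f a) * (\<Sum>a\<in>A. (f a)\<^sup>2)"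
    by (simp only: sum_product power2_eq_square) (simp only: mult_ac)
  also have "(\<Sum>a\<in>A. 2 * (f a * f a * f a)) = 2 * (\<Sum>a\<in>A. f a ^ 3)"
    by (simp add: sum_distrib_left power3_eq_cube mult_ac)
  finally show ?thesis by (simp add: algebra_simps)
qed

section \<open>Means of the normalised coprimality indicator\<close>

locale prime_set =
  fixes S :: "nat set"
  assumes finite_S [simp]: "finite S" and prime_S: "p \<in> S \<Longrightarrow> prime p"
begin

definition P :: nat where "P = \<Prod>S"

text \<open>This is \<open>P\<close> divided by its totient, the reciprocal density of the integers
  coprime to \<open>P\<close>; with it \<open>X\<close> below has mean 0.\<close>

definition Z :: real where "Z = (\<Prod>p\<in>S. real p / (real p - 1))"

definition X :: "int \<Rightarrow> real" where
  "X n = (if \<exists>p\<in>S. int p dvd n then - 1 else Z - 1)"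

definition mean :: "(int \<Rightarrow> real) \<Rightarrow> real" where
  "mean f = (\<Sum>n\<in>{0..<int P}. f n) / real P"

lemma S_ge_2: "p \<in> S \<Longrightarrow> p \<ge> 2"
  using prime_S prime_ge_2_nat by blast

lemma P_pos [simp]: "P > 0"
  unfolding P_def using S_ge_2 by (intro prod_pos) fastforce

lemma P_neq_0 [simp]: "P \<noteq> 0"
  using P_pos by (simp only: neq0_conv)

lemma Z_ge_1: "Z \<ge> 1"
  unfolding Z_def
proof (rule prod_ge_1)
  fix p assume "p \<in> S"
  then have "real p \<ge> 2" using S_ge_2 by fastforce
  then show "1 \<le> real p / (real p - 1)" by (simp add: divide_simps)
qed

lemma mean_add: "mean (\<lambda>n. f n + g n) = mean f + mean g"
  by (simp add: mean_def sum.distrib add_divide_distrib)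

lemma mean_diff: "mean (\<lambda>n. f n - g n) = mean f - mean g"
  by (simp add: mean_def sum_subtractf diff_divide_distrib)

lemma mean_cmult: "mean (\<lambda>n. c * f n) = c * mean f"
  by (simp add: mean_def flip: sum_distrib_left)

lemma mean_const: "mean (\<lambda>n. c) = c"
  by (simp add: mean_def)

lemma mean_sum: "mean (\<lambda>n. \<Sum>x\<in>A. f x n) = (\<Sum>x\<in>A. mean (f x))"
  unfolding mean_def by (subst sum.swap) (simp add: sum_divide_distrib)

text \<open>\<open>X\<close> takes only the values -1 and \<open>Z - 1\<close>, the roots of this
  quadratic. Powers of \<open>X\<close> thereby become linear in \<open>X\<close>.\<close>

lemma X_square: "(X n)\<^sup>2 = (Z - 2) * X n + (Z - 1)"
  by (simp add: X_def power2_eq_square algebra_simps)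

lemma card_residues:
  assumes "p \<in> S"
  shows "(\<Sum>a\<in>{0..<int p}. if \<exists>d\<in>D. int p dvd d - a then 0 else 1) = real p - real (nu p D)"
proof -
  have p: "int p > 0" using S_ge_2[OF assms] by simp
  let ?A = "{a\<in>{0..<int p}. \<exists>d\<in>D. int p dvd d - a}"
  have "?A = (\<lambda>d. d mod int p) ` D"
  proof (intro set_eqI iffI)
    fix a assume "a \<in> ?A"
    then obtain d where d: "0 \<le> a" "a < int p" "d \<in> D" "int p dvd d - a" by auto
    then have "d mod int p = a mod int p" by (simp only: mod_eq_dvd_iff)
    then have "d mod int p = a" using d by simp
    then show "a \<in> (\<lambda>d. d mod int p) ` D" using d by (auto simp: image_iff intro!: bexI[of _ d])
  next
    fix a assume "a \<in> (\<lambda>d. d mod int p) ` D"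
    then obtain d where d: "d \<in> D" "a = d mod int p" by auto
    have "\<exists>d\<in>D. int p dvd d - a" by (rule bexI[OF _ d(1)]) (simp add: d(2))
    then show "a \<in> ?A" using d(2) p by simp
  qed
  then have card: "card ?A = nu p D" by (simp add: nu_def)
  have "(\<Sum>a\<in>{0..<int p}. if \<exists>d\<in>D. int p dvd d - a then 0 else (1::real))
      = (\<Sum>a\<in>{0..<int p}. 1 - (if \<exists>d\<in>D. int p dvd d - a then 1 else 0))"
    by (intro sum.cong) auto
  also have "\<dots> = real p - (\<Sum>a\<in>{0..<int p}. if \<exists>d\<in>D. int p dvd d - a then 1 else 0)"
    by (simp add: sum_subtractf)
  also have "(\<Sum>a\<in>{0..<int p}. if \<exists>d\<in>D. int p dvd d - a then 1 else (0::real)) = real (card ?A)"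
    by (subst sum.inter_filter[symmetric]) auto
  finally show ?thesis using card by simp
qed

text \<open>\<open>X + 1\<close> is \<open>Z\<close> times the indicator of coprimality to
  \<open>P\<close>, so the product is \<open>Z ^ card D\<close> times the indicator that, for every
  \<open>p\<close> in \<open>S\<close>, \<open>n\<close> avoids the classes of \<open>D\<close>
  modulo \<open>p\<close>. That indicator is a product of local conditions, and its mean is the
  product of the densities \<open>1 - nu p D / p\<close>.\<close>

lemma mean_prod_X_plus_1:
  assumes "finite D"
  shows "mean (\<lambda>n. \<Prod>d\<in>D. X (d - n) + 1) = (\<Prod>p\<in>S. euler_factor D p)"
proof -
  let ?g = "\<lambda>p a. if \<exists>d\<in>D. int p dvd d - a then 0 else (1::real)"
  have eq: "(\<Prod>d\<in>D. X (d - n) + 1) = Z ^ card D * (\<Prod>p\<in>S. ?g p (n mod int p))" for n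
  proof (cases "\<exists>d\<in>D. \<exists>p\<in>S. int p dvd d - n")
    case True
    then obtain d p where dp: "d \<in> D" "p \<in> S" "int p dvd d - n" by blast
    have "int p dvd d - n mod int p" using dp(3) by (simp add: mod_eq_dvd_iff[symmetric] mod_simps)
    then have "(\<Prod>p\<in>S. ?g p (n mod int p)) = 0" using dp by (intro prod_zero) auto
    moreover have "(\<Prod>d\<in>D. X (d - n) + 1) = 0"
      using dp assms by (intro prod_zero) (auto simp: X_def)
    ultimately show ?thesis by simp
  next
    case False
    have "\<not> int p dvd d - n mod int p" if "d \<in> D" "p \<in> S" for d p
      using False that by (simp add: mod_eq_dvd_iff[symmetric] mod_simps)
    then have "(\<Prod>p\<in>S. ?g p (n mod int p)) = 1" by (intro prod.neutral) auto
    moreover have "(\<Prod>d\<in>D. X (d - n) + 1) = (\<Prod>d\<in>D. Z)"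
      using False by (intro prod.cong) (auto simp: X_def)
    ultimately show ?thesis by simp
  qed
  have "mean (\<lambda>n. \<Prod>d\<in>D. X (d - n) + 1) = Z ^ card D * (\<Prod>p\<in>S. real p - real (nu p D)) / real P"
    unfolding eq mean_def P_def
    by (subst sum_distrib_left[symmetric], subst sum_prod_mod_primes) (auto simp: prime_S card_residues)
  also have "\<dots> = (\<Prod>p\<in>S. (real p / (real p - 1)) ^ card D * (real p - real (nu p D)) / real p)"
    unfolding Z_def P_def of_nat_prod prod_power_distrib by (simp only: prod.distrib prod_dividef)
  also have "\<dots> = (\<Prod>p\<in>S. euler_factor D p)"
  proof (rule prod.cong[OF refl])
    fix p assume "p \<in> S"
    then have p: "real p \<ge> 2" using S_ge_2 by fastforce
    have Z: "1 / (1 - 1 / real p) = real p / (real p - 1)" using p by (simp add: divide_simps)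
    have "(1 - 1 / real p) powi (- int (card D)) = (real p / (real p - 1)) ^ card D"
      using Z by (simp add: power_int_minus inverse_eq_divide flip: power_one_over)
    moreover have "(real p - real (nu p D)) / real p = 1 - real (nu p D) / real p"
      using p by (simp add: diff_divide_distrib)
    ultimately show "(real p / (real p - 1)) ^ card D * (real p - real (nu p D)) / real p = euler_factor D p"
      by (simp only: euler_factor_def times_divide_eq_right[symmetric])
  qed
  finally show ?thesis .
qed

lemma mean_X: "mean (\<lambda>n. X (d - n)) = 0"
proof -
  have "mean (\<lambda>n. \<Prod>d\<in>{d}. X (d - n) + 1) = (\<Prod>p\<in>S. euler_factor {d} p)"
    by (rule mean_prod_X_plus_1) simp
  also have "\<dots> = 1"
  proof (intro prod.neutral ballI)
    fix p assume "p \<in> S"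
    then have p: "real p \<ge> 2" using S_ge_2 by fastforce
    then show "euler_factor {d} p = 1" by (simp add: euler_factor_def nu_def power_int_minus)
  qed
  finally show ?thesis by (simp add: mean_add mean_const)
qed

text \<open>Writing each \<open>X\<close> as \<open>(X + 1) - 1\<close> and expanding reproduces the
  alternating sum over subsets that defines \<open>singular_series0\<close>, with truncated products
  in place of the full series.\<close>

lemma mean_prod_X:
  assumes "finite D"
  shows "mean (\<lambda>n. \<Prod>d\<in>D. X (d - n)) = (\<Sum>J\<in>Pow D. (-1) ^ card (D - J) * (\<Prod>p\<in>S. euler_factor J p))"
proof -
  have eq: "(\<Prod>d\<in>D. X (d - n)) = (\<Sum>J\<in>Pow D. (-1) ^ card (D - J) * (\<Prod>d\<in>J. X (d - n) + 1))" for n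
  proof -
    have "(\<Prod>d\<in>D. X (d - n)) = (\<Prod>d\<in>D. (X (d - n) + 1) - 1)" by simp
    also have "\<dots> = (\<Sum>J\<in>Pow D. (-1) ^ (card D - card J) * (\<Prod>d\<in>J. X (d - n) + 1) * (\<Prod>d\<in>D - J. 1))"
      by (rule prod_diff_conv_sum'[OF assms])
    also have "\<dots> = (\<Sum>J\<in>Pow D. (-1) ^ card (D - J) * (\<Prod>d\<in>J. X (d - n) + 1))"
    proof (rule sum.cong[OF refl])
      fix J assume "J \<in> Pow D"
      then have "card (D - J) = card D - card J" using assms by (intro card_Diff_subset) (auto intro: finite_subset)
      then show "(-1) ^ (card D - card J) * (\<Prod>d\<in>J. X (d - n) + 1) * (\<Prod>d\<in>D - J. 1)
          = (-1) ^ card (D - J) * (\<Prod>d\<in>J. X (d - n) + 1)" by simp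
    qed
    finally show ?thesis .
  qed
  have "finite J" if "J \<in> Pow D" for J using that assms finite_subset by auto
  then show ?thesis unfolding eq mean_sum mean_cmult
    by (intro sum.cong refl) (simp add: mean_prod_X_plus_1)
qed

definition short_sum :: "int set \<Rightarrow> int \<Rightarrow> real" where
  "short_sum A n = (\<Sum>d\<in>A. X (d - n))"

text \<open>Newton's identity from \<open>sum_distinct_triples\<close>, with the power sums of order
  2 and 3 reduced by \<open>X_square\<close> to multiples of \<open>short_sum\<close> and constants.
  The terms linear in \<open>short_sum\<close> have mean 0, leaving the cube, the square and a
  constant.\<close>

lemma mean_sum_distinct_triples:
  assumes "finite A"
  shows "mean (\<lambda>n. \<Sum>(a, b, c)\<in>{(a, b, c). a \<in> A \<and> b \<in> A \<and> c \<in> A \<and> a \<noteq> b \<and> a \<noteq> c \<and> b \<noteq> c}.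
            X (a - n) * X (b - n) * X (c - n))
       = mean (\<lambda>n. short_sum A n ^ 3) - 3 * (Z - 2) * mean (\<lambda>n. (short_sum A n)\<^sup>2)
          + 2 * (Z - 2) * (Z - 1) * real (card A)"
proof -
  have s: "mean (short_sum A) = 0"
    unfolding short_sum_def mean_sum by (simp add: mean_X)
  have s2: "(\<Sum>a\<in>A. (X (a - n))\<^sup>2) = (Z - 2) * short_sum A n + (Z - 1) * real (card A)" for n
    by (simp add: X_square sum.distrib short_sum_def sum_distrib_left)
  have s3: "(\<Sum>a\<in>A. X (a - n) ^ 3) = (Z - 2) * ((Z - 2) * short_sum A n + (Z - 1) * real (card A)) + (Z - 1) * short_sum A n" for n
  proof -
    have "X m ^ 3 = (Z - 2) * (X m)\<^sup>2 + (Z - 1) * X m" for m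
    proof -
      have "X m ^ 3 = X m * (X m)\<^sup>2" by (simp add: power3_eq_cube power2_eq_square)
      also have "\<dots> = X m * ((Z - 2) * X m + (Z - 1))" by (simp add: X_square)
      finally show ?thesis by (simp add: power2_eq_square algebra_simps)
    qed
    then show ?thesis by (simp add: sum.distrib s2 short_sum_def flip: sum_distrib_left)
  qed
  have "(\<Sum>(a, b, c)\<in>{(a, b, c). a \<in> A \<and> b \<in> A \<and> c \<in> A \<and> a \<noteq> b \<and> a \<noteq> c \<and> b \<noteq> c}.
            X (a - n) * X (b - n) * X (c - n))
    = short_sum A n ^ 3 - 3 * (Z - 2) * (short_sum A n)\<^sup>2
       + (2 * ((Z - 2)\<^sup>2 + (Z - 1)) - 3 * (Z - 1) * real (card A)) * short_sum A n
       + 2 * (Z - 2) * (Z - 1) * real (card A)" for n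
    unfolding sum_distinct_triples[OF assms] s2 s3 short_sum_def[symmetric] by (simp add: power2_eq_square algebra_simps)
  then show ?thesis by (simp add: mean_add mean_diff mean_cmult mean_const s)
qed

end

section \<open>Fourier expansion\<close>

definition unit_root :: "nat \<Rightarrow> int \<Rightarrow> complex" where
  "unit_root n k = cis (2 * pi * real_of_int k / real n)"

lemma unit_root_add: "unit_root n (j + k) = unit_root n j * unit_root n k"
  by (simp add: unit_root_def cis_mult distrib_left add_divide_distrib)

lemma norm_unit_root [simp]: "norm (unit_root n k) = 1"
  by (simp add: unit_root_def)

lemma unit_root_0 [simp]: "unit_root n 0 = 1"
  by (simp add: unit_root_def)

lemma unit_root_eq_1_iff:
  assumes "n > 0"
  shows "unit_root n k = 1 \<longleftrightarrow> int n dvd k"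
proof
  assume "int n dvd k"
  then obtain j where "k = int n * j" by auto
  then have "2 * pi * real_of_int k / real n = 2 * pi * real_of_int j" using assms by simp
  then show "unit_root n k = 1" unfolding unit_root_def by (simp only: cis_multiple_2pi Ints_of_int)
next
  assume "unit_root n k = 1"
  then have "exp (\<i> * complex_of_real (2 * pi * real_of_int k / real n)) = 1"
    by (simp add: unit_root_def cis_conv_exp)
  then obtain m :: int where "2 * pi * real_of_int k / real n = real_of_int (2 * m) * pi"
    unfolding exp_eq_1 by auto
  then have "real_of_int k = real_of_int (m * int n)" using assms by (simp add: field_simps)
  then have "k = m * int n" by (simp only: of_int_eq_iff)
  then show "int n dvd k" by simp
qed

lemma unit_root_power: "unit_root n (k * int j) = unit_root n k ^ j"
  by (induction j) (simp_all add: distrib_left unit_root_add mult.commute)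

text \<open>Orthogonality of additive characters, a geometric series. The start \<open>a\<close> is
  free because both \<open>{0..<P}\<close> and the symmetric range \<open>res\<close> occur; the
  former is written \<open>{0..<0 + int P}\<close> where the lemma is applied.\<close>

lemma sum_unit_root:
  assumes "n > 0"
  shows "(\<Sum>r\<in>{a..<a + int n}. unit_root n (k * r)) = (if int n dvd k then of_nat n else 0)"
proof -
  have "(\<Sum>r\<in>{a..<a + int n}. unit_root n (k * r)) = (\<Sum>j<n. unit_root n (k * (a + int j)))"
    by (rule sum.reindex_bij_witness[of _ "\<lambda>j. a + int j" "\<lambda>r. nat (r - a)"]) auto
  also have "\<dots> = unit_root n (k * a) * (\<Sum>j<n. unit_root n k ^ j)"
    by (simp add: distrib_left unit_root_add unit_root_power sum_distrib_left)
  also have "(\<Sum>j<n. unit_root n k ^ j) = (if int n dvd k then of_nat n else 0)"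
  proof (cases "int n dvd k")
    case True
    then show ?thesis using assms by (simp add: unit_root_eq_1_iff[THEN iffD2])
  next
    case False
    then have "unit_root n k \<noteq> 1" using assms by (simp add: unit_root_eq_1_iff)
    moreover have "unit_root n k ^ n = 1"
      using assms unit_root_eq_1_iff[of n "k * int n"] by (simp flip: unit_root_power)
    ultimately show ?thesis using False by (simp add: geometric_sum)
  qed
  finally show ?thesis using assms unit_root_eq_1_iff[of n "k * a"] by auto
qed

text \<open>A weak form of Jordan's inequality. Up to \<open>pi / 3\<close> the cosine is at least
  1/2, so the mean value theorem gives \<open>sin x \<ge> x / 2\<close>; beyond that
  \<open>sin x \<ge> 1 / 2\<close> by monotonicity.\<close>

lemma sin_ge_div_pi:
  fixes x :: real
  assumes "0 \<le> x" "x \<le> pi / 2"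
  shows "x / pi \<le> sin x"
proof (cases "x \<le> pi / 3")
  case True
  show ?thesis
  proof (cases "x = 0")
    case False
    then have "0 < x" using assms by simp
    then obtain z where z: "0 < z" "z < x" "sin x - sin 0 = (x - 0) * cos z"
      using MVT2[of 0 x sin cos] DERIV_sin by auto
    have "cos z \<ge> cos (pi / 3)" using z True by (intro cos_monotone_0_pi_le) auto
    then have "x * (1 / 2) \<le> sin x" using z \<open>0 < x\<close> by (simp add: cos_60)
    moreover have "x / pi \<le> x * (1 / 2)" using \<open>0 < x\<close> pi_gt3 by (simp add: divide_simps)
    ultimately show ?thesis by linarith
  qed simp
next
  case False
  have "sin (pi / 6) \<le> sin x" using False assms by (intro sin_monotone_2pi_le) auto
  then have "1 / 2 \<le> sin x" by (simp add: sin_30)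
  moreover have "x / pi \<le> 1 / 2" using assms by (simp add: divide_simps)
  ultimately show ?thesis by linarith
qed

lemma norm_one_minus_cis: "norm (1 - cis t) = 2 * \<bar>sin (t / 2)\<bar>"
proof -
  have "(norm (1 - cis t))\<^sup>2 = (1 - cos t)\<^sup>2 + (sin t)\<^sup>2"
    by (simp add: cmod_power2)
  also have "\<dots> = 2 - 2 * cos t" using sin_cos_squared_add[of t] by (simp add: power2_diff)
  also have "cos t = 1 - 2 * (sin (t / 2))\<^sup>2" using cos_double_sin[of "t / 2"] by simp
  finally have "(norm (1 - cis t))\<^sup>2 = (2 * \<bar>sin (t / 2)\<bar>)\<^sup>2" by (simp add: power_mult_distrib)
  then show ?thesis by (rule power2_eq_imp_eq) auto
qed

text \<open>Multiplied by \<open>1 - unit_root n r\<close> the sum telescopes to a difference of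
  norm at most 2, and that multiplier has norm
  \<open>2 * \<bar>sin (pi * r / n)\<bar> \<ge> 2 * \<bar>r\<bar> / n\<close>. The condition
  \<open>2 * \<bar>r\<bar> \<le> int n\<close> keeps the angle in the range of
  \<open>sin_ge_div_pi\<close>.\<close>

lemma norm_sum_unit_root_le:
  assumes "n > 0" "r \<noteq> 0" "2 * \<bar>r\<bar> \<le> int n"
  shows "norm (\<Sum>d\<in>{1..int H}. unit_root n (r * d)) \<le> min (real H) (real n / real_of_int \<bar>r\<bar>)"
proof -
  let ?E = "\<Sum>d\<in>{1..int H}. unit_root n (r * d)"
  have "norm ?E \<le> (\<Sum>d\<in>{1..int H}. norm (unit_root n (r * d)))" by (rule norm_sum)
  then have 1: "norm ?E \<le> real H" by simp
  have "(1 - unit_root n r) * ?E = unit_root n r - unit_root n (r * (int H + 1))"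
  proof (induction H)
    case (Suc H)
    have "{1..int (Suc H)} = insert (int H + 1) {1..int H}" by auto
    then have "(1 - unit_root n r) * (\<Sum>d\<in>{1..int (Suc H)}. unit_root n (r * d))
       = (1 - unit_root n r) * unit_root n (r * (int H + 1)) + (unit_root n r - unit_root n (r * (int H + 1)))"
      using Suc by (simp add: distrib_left)
    also have "\<dots> = unit_root n r - unit_root n r * unit_root n (r * (int H + 1))" by (simp add: algebra_simps)
    also have "unit_root n r * unit_root n (r * (int H + 1)) = unit_root n (r * (int (Suc H) + 1))"
      by (simp add: algebra_simps flip: unit_root_add)
    finally show ?case .
  qed simp
  then have "norm (1 - unit_root n r) * norm ?E = norm (unit_root n r - unit_root n (r * (int H + 1)))"
    by (metis norm_mult)
  also have "\<dots> \<le> 2" using norm_triangle_ineq4[of "unit_root n r" "unit_root n (r * (int H + 1))"] by simp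
  finally have le: "norm (1 - unit_root n r) * norm ?E \<le> 2" .
  have "2 * (real_of_int \<bar>r\<bar> / real n) \<le> norm (1 - unit_root n r)"
  proof -
    let ?x = "pi * (real_of_int \<bar>r\<bar> / real n)"
    have "2 * real_of_int \<bar>r\<bar> \<le> real n" using assms(3) by linarith
    then have "real_of_int \<bar>r\<bar> / real n \<le> 1 / 2" using assms by (simp add: divide_simps)
    then have "pi * (real_of_int \<bar>r\<bar> / real n) \<le> pi * (1 / 2)" by (intro mult_left_mono) auto
    then have "?x / pi \<le> sin ?x" by (intro sin_ge_div_pi) auto
    moreover have "\<bar>sin (pi * real_of_int r / real n)\<bar> = \<bar>sin ?x\<bar>" by (cases "r \<ge> 0") auto
    moreover have "norm (1 - unit_root n r) = 2 * \<bar>sin (pi * real_of_int r / real n)\<bar>"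
      unfolding unit_root_def norm_one_minus_cis by simp
    moreover have "?x / pi = real_of_int \<bar>r\<bar> / real n" by simp
    ultimately show ?thesis using abs_ge_self[of "sin ?x"] by linarith
  qed
  then have "2 * (real_of_int \<bar>r\<bar> / real n) * norm ?E \<le> 2"
    using mult_right_mono[of _ _ "norm ?E"] le by (meson norm_ge_zero order_trans)
  then have "norm ?E \<le> real n / real_of_int \<bar>r\<bar>"
    using assms by (simp add: field_simps)
  then show ?thesis using 1 by simp
qed

text \<open>For a set of primes this is Euler's totient of the squarefree number
  \<open>\<Prod>T\<close>.\<close>

definition phi :: "nat set \<Rightarrow> real" where
  "phi T = (\<Prod>p\<in>T. real p - 1)"

section \<open>Fourier coefficients of the indicator and of its short sums\<close>

context prime_set
begin

text \<open>Since \<open>P\<close> is squarefree, these are the primes of the denominator of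
  \<open>r / P\<close> in lowest terms.\<close>

definition supp :: "int \<Rightarrow> nat set" where
  "supp r = {p\<in>S. \<not> int p dvd r}"

text \<open>Representatives centred at 0, so that \<open>\<bar>r\<bar> / P\<close> is the distance
  from \<open>r / P\<close> to the nearest integer.\<close>

definition res :: "int set" where
  "res = {r. - int P < 2 * r \<and> 2 * r \<le> int P}"

definition X_hat :: "int \<Rightarrow> complex" where
  "X_hat r = (\<Sum>m\<in>{0..<int P}. of_real (X m) * unit_root P (- r * m)) / of_nat P"

lemma prime_dvd_P: "p \<in> S \<Longrightarrow> int p dvd int P"
  unfolding P_def int_dvd_int_iff using dvd_prodI[of S p "\<lambda>x. x"] by simp

lemma phi_pos: "T \<subseteq> S \<Longrightarrow> phi T > 0"
  unfolding phi_def by (intro prod_pos) (use S_ge_2 in fastforce)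

lemma res_eq: "res = {- int P div 2 + 1..<(- int P div 2 + 1) + int P}"
  unfolding res_def by (auto simp: zdiv_zminus1_eq_if split: if_splits) presburger+

lemma finite_res [simp]: "finite res"
  by (simp add: res_eq)

text \<open>Putting \<open>m = \<Prod>U * j\<close> leaves a complete character sum modulo
  \<open>P / \<Prod>U\<close>. The result is stated as a product over \<open>S - U\<close> so that
  it can be folded back by \<open>prod_diff_conv_sum\<close>.\<close>

lemma sum_multiples_unit_root:
  assumes "U \<subseteq> S"
  shows "(\<Sum>m\<in>{m\<in>{0..<int P}. int (\<Prod>U) dvd m}. unit_root P (k * m))
     = (\<Prod>p\<in>S - U. if int p dvd k then of_nat p else 0)"
proof -
  have finU: "finite U" using assms finite_S finite_subset by blast
  define Q where "Q = \<Prod>(S - U)"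
  have PQ: "P = \<Prod>U * Q" unfolding P_def Q_def using assms finite_S by (simp add: prod.subset_diff mult.commute)
  have pos: "\<Prod>U > 0" "Q > 0" using P_pos unfolding PQ by auto
  let ?u = "int (\<Prod>U)"
  have "(\<Sum>m\<in>{m\<in>{0..<int P}. ?u dvd m}. unit_root P (k * m)) = (\<Sum>j\<in>{0..<0 + int Q}. unit_root P (k * (?u * j)))"
  proof (rule sum.reindex_bij_witness[of _ "\<lambda>j. ?u * j" "\<lambda>m. m div ?u"])
    fix m assume m: "m \<in> {m\<in>{0..<int P}. ?u dvd m}"
    then obtain j where j: "m = ?u * j" by auto
    have "?u > 0" using pos by (simp only: of_nat_0_less_iff)
    then show "?u * (m div ?u) = m" "m div ?u \<in> {0..<0 + int Q}" 
      using m unfolding j PQ of_nat_mult by (auto simp: zero_le_mult_iff simp del: of_nat_prod)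
  next
    fix j assume j: "j \<in> {0..<0 + int Q}"
    have "?u > 0" using pos by (simp only: of_nat_0_less_iff)
    then show "?u * j div ?u = j" "?u * j \<in> {m\<in>{0..<int P}. ?u dvd m}"
      using j unfolding PQ of_nat_mult by (auto simp del: of_nat_prod)
  qed auto
  also have "\<dots> = (\<Sum>j\<in>{0..<0 + int Q}. unit_root Q (k * j))"
  proof (intro sum.cong refl)
    fix j
    have "real_of_int (k * (?u * j)) / real P = real_of_int (k * j) / real Q"
      using pos unfolding PQ by (simp add: divide_simps del: of_nat_prod)
    then show "unit_root P (k * (?u * j)) = unit_root Q (k * j)"
      unfolding unit_root_def by (metis times_divide_eq_right)
  qed
  also have "\<dots> = (if int Q dvd k then of_nat Q else 0)" by (rule sum_unit_root[OF pos(2)])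
  also have "\<dots> = (\<Prod>p\<in>S - U. if int p dvd k then of_nat p else 0)"
  proof (cases "\<forall>p\<in>S - U. int p dvd k")
    case True
    then have "int Q dvd k" unfolding Q_def using prime_S by (intro prod_primes_dvd) auto
    then show ?thesis using True by (simp add: Q_def)
  next
    case False
    then obtain p where p: "p \<in> S - U" "\<not> int p dvd k" by blast
    have "p dvd Q" unfolding Q_def using p finite_S by (intro dvd_prodI) auto
    then have "\<not> int Q dvd k" using p by (metis dvd_trans int_dvd_int_iff)
    moreover have "(\<Prod>p\<in>S - U. if int p dvd k then of_nat p else 0) = (0::complex)"
      using p finite_S by (intro prod_zero) auto
    ultimately show ?thesis by simp
  qed
  finally show ?thesis .
qed

lemma sum_coprime_unit_root:
  "(\<Sum>m\<in>{0..<int P}. (\<Prod>p\<in>S. 1 - (if int p dvd m then 1 else 0)) * unit_root P (k * m))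
     = (\<Prod>p\<in>S. (if int p dvd k then of_nat p else 0) - 1)"
proof -
  have ind: "(\<Prod>p\<in>U. if int p dvd m then 1 else (0::complex)) = (if int (\<Prod>U) dvd m then 1 else 0)"
    if "U \<subseteq> S" for U m
  proof (cases "\<forall>p\<in>U. int p dvd m")
    case True
    then have "int (\<Prod>U) dvd m" using prime_S that finite_S finite_subset by (intro prod_primes_dvd) blast+
    then show ?thesis using True by simp
  next
    case False
    have fin: "finite U" using that finite_S finite_subset by blast
    obtain p where p: "p \<in> U" "\<not> int p dvd m" using False by blast
    have "p dvd \<Prod>U" using p fin by (intro dvd_prodI) auto
    then have "\<not> int (\<Prod>U) dvd m" using p by (metis dvd_trans int_dvd_int_iff)
    moreover have "(\<Prod>p\<in>U. if int p dvd m then 1 else (0::complex)) = 0" using p fin by (intro prod_zero) auto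
    ultimately show ?thesis by simp
  qed
  have "(\<Sum>m\<in>{0..<int P}. (\<Prod>p\<in>S. 1 - (if int p dvd m then 1 else 0)) * unit_root P (k * m))
     = (\<Sum>m\<in>{0..<int P}. \<Sum>U\<in>Pow S. (-1) ^ card U * ((if int (\<Prod>U) dvd m then 1 else 0) * unit_root P (k * m)))"
    unfolding prod_diff_conv_sum[OF finite_S] sum_distrib_right
    by (intro sum.cong refl) (simp add: ind del: of_nat_prod)
  also have "\<dots> = (\<Sum>U\<in>Pow S. (-1) ^ card U * (\<Sum>m\<in>{0..<int P}. (if int (\<Prod>U) dvd m then 1 else 0) * unit_root P (k * m)))"
    by (subst sum.swap) (simp add: sum_distrib_left del: of_nat_prod)
  also have "\<dots> = (\<Sum>U\<in>Pow S. (-1) ^ card U * (\<Prod>p\<in>S - U. if int p dvd k then of_nat p else 0))"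
  proof (intro sum.cong refl, goal_cases)
    case (1 U)
    have "(\<Sum>m\<in>{0..<int P}. (if int (\<Prod>U) dvd m then 1 else 0) * unit_root P (k * m))
       = (\<Sum>m\<in>{m\<in>{0..<int P}. int (\<Prod>U) dvd m}. unit_root P (k * m))"
      by (subst sum.inter_filter) (auto intro!: sum.cong simp del: of_nat_prod)
    then show ?case using 1 sum_multiples_unit_root[of U k] by (simp del: of_nat_prod)
  qed
  also have "\<dots> = (\<Prod>p\<in>S. (if int p dvd k then of_nat p else 0) - 1)"
    by (subst prod_diff_conv_sum[OF finite_S]) simp
  finally show ?thesis .
qed

lemma X_eq: "X m = Z * (\<Prod>p\<in>S. 1 - (if int p dvd m then 1 else 0)) - 1"
proof (cases "\<exists>p\<in>S. int p dvd m")
  case True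
  then have "(\<Prod>p\<in>S. 1 - (if int p dvd m then 1 else 0)) = (0::real)" by (intro prod_zero) auto
  then show ?thesis using True by (simp add: X_def)
next
  case False
  then have "(\<Prod>p\<in>S. 1 - (if int p dvd m then 1 else 0)) = (1::real)" by (intro prod.neutral) auto
  then show ?thesis using False by (simp add: X_def)
qed

lemma X_hat_eq:
  "X_hat r = of_real Z / of_nat P * (\<Prod>p\<in>S. (if int p dvd r then of_nat p else 0) - 1)
      - (if int P dvd r then 1 else 0)"
proof -
  have "(\<Sum>m\<in>{0..<int P}. of_real (X m) * unit_root P (- r * m))
    = of_real Z * (\<Sum>m\<in>{0..<int P}. (\<Prod>p\<in>S. 1 - (if int p dvd m then 1 else 0)) * unit_root P (- r * m))
      - (\<Sum>m\<in>{0..<0 + int P}. unit_root P (- r * m))"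
    unfolding sum_distrib_left sum_subtractf[symmetric] add_0
  proof (intro sum.cong refl)
    fix m
    have "complex_of_real (X m) = of_real Z * (\<Prod>p\<in>S. 1 - (if int p dvd m then 1 else 0)) - 1"
      unfolding X_eq by (simp add: if_distrib[of complex_of_real] cong: if_cong)
    then show "of_real (X m) * unit_root P (- r * m) = of_real Z *
         ((\<Prod>p\<in>S. 1 - (if int p dvd m then 1 else 0)) * unit_root P (- r * m)) - unit_root P (- r * m)"
      by (simp only: left_diff_distrib mult.assoc mult_1_left)
  qed
  then show ?thesis
    unfolding X_hat_def sum_unit_root[OF P_pos] sum_coprime_unit_root using P_pos by (simp add: diff_divide_distrib)
qed

lemma Z_eq: "Z = real P / phi S"
  by (simp add: Z_def P_def phi_def prod_dividef)

lemma X_hat_0: "X_hat 0 = 0"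
proof -
  have "(\<Prod>p\<in>S. of_nat p - (1::complex)) = of_real (phi S)" by (simp add: phi_def)
  then show ?thesis unfolding X_hat_eq using phi_pos[of S] P_pos by (simp add: Z_eq)
qed

text \<open>In Ramanujan's sum a prime not dividing \<open>r\<close> gives a factor of modulus 1, a
  prime dividing \<open>r\<close> gives \<open>p - 1\<close>. Together they make
  \<open>phi (S - supp r)\<close>, and \<open>Z / P\<close> is \<open>1 / phi S\<close>.\<close>

lemma norm_X_hat:
  assumes "\<not> int P dvd r"
  shows "norm (X_hat r) = 1 / phi (supp r)"
proof -
  have "(\<Prod>p\<in>S. norm ((if int p dvd r then of_nat p else 0) - (1::complex))) = (\<Prod>p\<in>S. if int p dvd r then real p - 1 else 1)"
  proof (intro prod.cong refl)
    fix p assume "p \<in> S"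
    then have "real p \<ge> 2" using S_ge_2 by fastforce
    moreover have "norm (of_nat p - (1::complex)) = \<bar>real p - 1\<bar>"
      by (metis norm_of_real of_real_1 of_real_diff of_real_of_nat_eq)
    ultimately show "norm ((if int p dvd r then of_nat p else 0) - (1::complex)) = (if int p dvd r then real p - 1 else 1)"
      by simp
  qed
  also have "\<dots> = phi (S - supp r)"
    unfolding phi_def by (subst prod.inter_filter[symmetric]) (auto simp: supp_def intro!: prod.cong)
  finally have "norm (X_hat r) = Z / real P * phi (S - supp r)"
    using assms Z_ge_1 by (simp add: X_hat_eq norm_mult norm_divide flip: prod_norm)
  moreover have "phi S = phi (S - supp r) * phi (supp r)"
    unfolding phi_def by (rule prod.subset_diff) (auto simp: supp_def)
  moreover have "phi (S - supp r) > 0" "phi (supp r) > 0" by (intro phi_pos; auto simp: supp_def)+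
  ultimately show ?thesis using P_pos by (simp add: Z_eq)
qed

lemma X_fourier: "complex_of_real (X n) = (\<Sum>r\<in>res. X_hat r * unit_root P (r * n))"
proof -
  have "(\<Sum>r\<in>res. X_hat r * unit_root P (r * n))
     = (\<Sum>r\<in>res. \<Sum>m\<in>{0..<int P}. of_real (X m) / of_nat P * unit_root P ((n - m) * r))"
  proof (intro sum.cong refl)
    fix r
    have "unit_root P (- r * m) * unit_root P (r * n) = unit_root P ((n - m) * r)" for m
      by (simp add: algebra_simps flip: unit_root_add)
    then show "X_hat r * unit_root P (r * n) = (\<Sum>m\<in>{0..<int P}. of_real (X m) / of_nat P * unit_root P ((n - m) * r))"
      unfolding X_hat_def sum_divide_distrib sum_distrib_right
      by (intro sum.cong refl) (simp add: mult.assoc)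
  qed
  also have "\<dots> = (\<Sum>m\<in>{0..<int P}. of_real (X m) / of_nat P * (\<Sum>r\<in>res. unit_root P ((n - m) * r)))"
    by (subst sum.swap) (simp add: sum_distrib_left)
  also have "\<dots> = (\<Sum>m\<in>{0..<int P}. of_real (X m) / of_nat P * (if int P dvd n - m then of_nat P else 0))"
    unfolding res_eq by (simp only: sum_unit_root[OF P_pos])
  also have "\<dots> = (\<Sum>m\<in>{0..<int P}. if m = n mod int P then of_real (X m) else 0)"
  proof (intro sum.cong refl)
    fix m assume m: "m \<in> {0..<int P}"
    have "int P dvd n - m \<longleftrightarrow> n mod int P = m mod int P" by (simp add: mod_eq_dvd_iff)
    also have "\<dots> \<longleftrightarrow> m = n mod int P" using m by auto
    finally show "of_real (X m) / of_nat P * (if int P dvd n - m then of_nat P else 0)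
        = (if m = n mod int P then of_real (X m) else (0::complex))" using P_pos by simp
  qed
  also have "\<dots> = of_real (X (n mod int P))" using P_pos by simp
  also have "X (n mod int P) = X n"
  proof -
    have "int p dvd n mod int P \<longleftrightarrow> int p dvd n" if "p \<in> S" for p
      using prime_dvd_P[OF that] by (simp add: dvd_mod_iff)
    then show ?thesis by (simp add: X_def)
  qed
  finally show ?thesis ..
qed

definition s_hat :: "int set \<Rightarrow> int \<Rightarrow> complex" where
  "s_hat A r = X_hat r * (\<Sum>d\<in>A. unit_root P (r * d))"

lemma short_sum_fourier:
  "complex_of_real (short_sum A n) = (\<Sum>r\<in>res. s_hat A r * unit_root P (- r * n))"
proof -
  have "complex_of_real (short_sum A n) = (\<Sum>r\<in>res. \<Sum>d\<in>A. X_hat r * unit_root P (r * (d - n)))"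
    unfolding short_sum_def of_real_sum X_fourier by (rule sum.swap)
  also have "\<dots> = (\<Sum>r\<in>res. s_hat A r * unit_root P (- r * n))"
  proof (intro sum.cong refl)
    fix r
    have "unit_root P (r * (d - n)) = unit_root P (r * d) * unit_root P (- r * n)" for d
      by (simp add: algebra_simps flip: unit_root_add)
    then show "(\<Sum>d\<in>A. X_hat r * unit_root P (r * (d - n))) = s_hat A r * unit_root P (- r * n)"
      by (simp add: s_hat_def sum_distrib_left sum_distrib_right mult.assoc)
  qed
  finally show ?thesis .
qed

text \<open>Averaging the expanded square over \<open>n\<close> modulo \<open>P\<close> kills every
  pair of frequencies whose sum is not divisible by \<open>P\<close>.
  \<open>abs_mean_cube_le\<close> does the same with three frequencies.\<close>

lemma abs_mean_square_le:
  "\<bar>mean (\<lambda>n. (short_sum A n)\<^sup>2)\<bar> \<le> (\<Sum>(r1, r2)\<in>{(r1, r2)\<in>res \<times> res. int P dvd r1 + r2}. norm (s_hat A r1) * norm (s_hat A r2))"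
proof -
  let ?u = "s_hat A"
  have "complex_of_real (mean (\<lambda>n. (short_sum A n)\<^sup>2))
     = (\<Sum>n\<in>{0..<int P}. (\<Sum>r\<in>res. ?u r * unit_root P (- r * n)) * (\<Sum>r\<in>res. ?u r * unit_root P (- r * n))) / of_nat P"
    by (simp add: mean_def power2_eq_square short_sum_fourier)
  also have "\<dots> = (\<Sum>n\<in>{0..<int P}. \<Sum>(r1, r2)\<in>res \<times> res. ?u r1 * ?u r2 * unit_root P (- (r1 + r2) * n)) / of_nat P"
  proof -
    have "unit_root P (- (r1 + r2) * n) = unit_root P (- r1 * n) * unit_root P (- r2 * n)" for r1 r2 n
      by (simp add: algebra_simps flip: unit_root_add)
    then show ?thesis by (simp add: sum_product sum.cartesian_product mult_ac)
  qed
  also have "\<dots> = (\<Sum>(r1, r2)\<in>res \<times> res. ?u r1 * ?u r2 * (\<Sum>n\<in>{0..<0 + int P}. unit_root P (- (r1 + r2) * n))) / of_nat P"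
    by (subst sum.swap) (simp add: sum_distrib_left case_prod_unfold)
  also have "\<dots> = (\<Sum>(r1, r2)\<in>res \<times> res. if int P dvd r1 + r2 then ?u r1 * ?u r2 else 0)"
    unfolding sum_unit_root[OF P_pos] sum_divide_distrib dvd_minus_iff case_prod_unfold
    using P_pos by (intro sum.cong refl) simp
  also have "\<dots> = (\<Sum>(r1, r2)\<in>{(r1, r2)\<in>res \<times> res. int P dvd r1 + r2}. ?u r1 * ?u r2)"
    by (rule sum.mono_neutral_cong_right) (auto simp: case_prod_unfold)
  finally have "\<bar>mean (\<lambda>n. (short_sum A n)\<^sup>2)\<bar> = norm \<dots>" by (metis norm_of_real real_norm_def)
  also have "\<dots> \<le> (\<Sum>(r1, r2)\<in>{(r1, r2)\<in>res \<times> res. int P dvd r1 + r2}. norm (?u r1) * norm (?u r2))"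
    unfolding case_prod_unfold norm_mult[symmetric] by (rule norm_sum)
  finally show ?thesis .
qed

lemma abs_mean_cube_le:
  "\<bar>mean (\<lambda>n. short_sum A n ^ 3)\<bar> \<le> (\<Sum>(r1, r2, r3)\<in>{(r1, r2, r3)\<in>res \<times> res \<times> res. int P dvd r1 + r2 + r3}.
     norm (s_hat A r1) * norm (s_hat A r2) * norm (s_hat A r3))"
proof -
  let ?u = "s_hat A"
  have "complex_of_real (mean (\<lambda>n. short_sum A n ^ 3))
     = (\<Sum>n\<in>{0..<int P}. (\<Sum>r\<in>res. ?u r * unit_root P (- r * n)) * ((\<Sum>r\<in>res. ?u r * unit_root P (- r * n)) * (\<Sum>r\<in>res. ?u r * unit_root P (- r * n)))) / of_nat P"
    by (simp add: mean_def power3_eq_cube short_sum_fourier mult.assoc)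
  also have "\<dots> = (\<Sum>n\<in>{0..<int P}. \<Sum>(r1, r2, r3)\<in>res \<times> res \<times> res. ?u r1 * ?u r2 * ?u r3 * unit_root P (- (r1 + r2 + r3) * n)) / of_nat P"
  proof -
    have "unit_root P (- (r1 + r2 + r3) * n) = unit_root P (- r1 * n) * unit_root P (- r2 * n) * unit_root P (- r3 * n)" for r1 r2 r3 n
      by (simp add: algebra_simps flip: unit_root_add)
    then show ?thesis by (simp add: sum_product sum.cartesian_product case_prod_unfold mult_ac)
  qed
  also have "\<dots> = (\<Sum>(r1, r2, r3)\<in>res \<times> res \<times> res. ?u r1 * ?u r2 * ?u r3 * (\<Sum>n\<in>{0..<0 + int P}. unit_root P (- (r1 + r2 + r3) * n))) / of_nat P"
    by (subst sum.swap) (simp add: sum_distrib_left case_prod_unfold)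
  also have "\<dots> = (\<Sum>(r1, r2, r3)\<in>res \<times> res \<times> res. if int P dvd r1 + r2 + r3 then ?u r1 * ?u r2 * ?u r3 else 0)"
    unfolding sum_unit_root[OF P_pos] sum_divide_distrib dvd_minus_iff case_prod_unfold
    using P_pos by (intro sum.cong refl) simp
  also have "\<dots> = (\<Sum>(r1, r2, r3)\<in>{(r1, r2, r3)\<in>res \<times> res \<times> res. int P dvd r1 + r2 + r3}. ?u r1 * ?u r2 * ?u r3)"
    by (rule sum.mono_neutral_cong_right) (auto simp: case_prod_unfold)
  finally have "\<bar>mean (\<lambda>n. short_sum A n ^ 3)\<bar> = norm \<dots>" by (metis norm_of_real real_norm_def)
  also have "\<dots> \<le> (\<Sum>(r1, r2, r3)\<in>{(r1, r2, r3)\<in>res \<times> res \<times> res. int P dvd r1 + r2 + r3}. norm (?u r1) * norm (?u r2) * norm (?u r3))"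
    unfolding case_prod_unfold norm_mult[symmetric] by (rule norm_sum)
  finally show ?thesis .
qed

lemma norm_s_hat_le:
  assumes "r \<in> res" "r \<noteq> 0"
  shows "norm (s_hat {1..int H} r) \<le> 1 / phi (supp r) * min (real H) (real P / real_of_int \<bar>r\<bar>)"
proof -
  have r: "2 * \<bar>r\<bar> \<le> int P" using assms by (auto simp: res_def)
  have "\<not> int P dvd r"
  proof
    assume "int P dvd r"
    then have "int P \<le> \<bar>r\<bar>" using dvd_imp_le_int[OF assms(2)] by fastforce
    then show False using r assms(2) by linarith
  qed
  then show ?thesis
    unfolding s_hat_def norm_mult norm_X_hat[OF \<open>\<not> int P dvd r\<close>]
    using norm_sum_unit_root_le[OF P_pos assms(2) r, of H] phi_pos[of "supp r"]
    by (intro mult_left_mono) (auto simp: supp_def)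
qed

lemma s_hat_0 [simp]: "s_hat A 0 = 0"
  by (simp add: s_hat_def X_hat_0)

end

section \<open>Spaced fractions\<close>

text \<open>Pigeonhole: cut \<open>[-R, R]\<close> into cells of length \<open>s\<close>; the
  spacing leaves at most one element per cell.\<close>

lemma card_spaced_le:
  fixes A :: "int set" and R s :: real
  assumes "s > 0" "R \<ge> 0" and bound: "\<And>a. a \<in> A \<Longrightarrow> \<bar>real_of_int a\<bar> \<le> R"
    and spaced: "\<And>a b. a \<in> A \<Longrightarrow> b \<in> A \<Longrightarrow> a \<noteq> b \<Longrightarrow> s \<le> \<bar>real_of_int (a - b)\<bar>"
  shows "real (card A) \<le> 1 + 2 * R / s"
proof -
  let ?f = "\<lambda>a. \<lfloor>(real_of_int a + R) / s\<rfloor>"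
  have inj: "inj_on ?f A"
  proof (rule inj_onI, rule ccontr)
    fix a b assume ab: "a \<in> A" "b \<in> A" "?f a = ?f b" "a \<noteq> b"
    have "s \<le> \<bar>real_of_int a - real_of_int b\<bar>" using spaced[of a b] ab by simp
    moreover have "(real_of_int a + R) / s - (real_of_int b + R) / s = (real_of_int a - real_of_int b) / s"
      by (simp add: field_simps flip: diff_divide_distrib)
    ultimately have "\<bar>(real_of_int a + R) / s - (real_of_int b + R) / s\<bar> \<ge> 1"
      using \<open>s > 0\<close> by (simp add: abs_divide)
    then show False using ab(3) by linarith
  qed
  have "?f ` A \<subseteq> {0..\<lfloor>2 * R / s\<rfloor>}"
  proof
    fix k assume "k \<in> ?f ` A"
    then obtain a where a: "a \<in> A" "k = ?f a" by blast
    have "0 \<le> (real_of_int a + R) / s" "(real_of_int a + R) / s \<le> 2 * R / s"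
      using bound[OF a(1)] \<open>s > 0\<close> by (auto intro!: divide_right_mono)
    then show "k \<in> {0..\<lfloor>2 * R / s\<rfloor>}" using a(2) by (auto intro: floor_mono)
  qed
  then have "card (?f ` A) \<le> card {0..\<lfloor>2 * R / s\<rfloor>}" by (intro card_mono) auto
  then have "card A \<le> nat (\<lfloor>2 * R / s\<rfloor> + 1)" by (simp add: card_image[OF inj])
  moreover have "0 \<le> 2 * R / s" using assms by simp
  ultimately show ?thesis by linarith
qed

lemma sum_indicator_swap:
  fixes v :: "'a \<Rightarrow> real"
  assumes "finite R" "finite J"
  shows "(\<Sum>r\<in>R. (\<Sum>j\<in>J. if Q j r then c j else 0) * v r) = (\<Sum>j\<in>J. c j * (\<Sum>r\<in>{r\<in>R. Q j r}. v r))"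
proof -
  have "(\<Sum>r\<in>R. (\<Sum>j\<in>J. if Q j r then c j else 0) * v r) = (\<Sum>j\<in>J. \<Sum>r\<in>R. if Q j r then c j * v r else 0)"
    unfolding sum_distrib_right by (subst sum.swap) (auto intro!: sum.cong)
  also have "\<dots> = (\<Sum>j\<in>J. c j * (\<Sum>r\<in>{r\<in>R. Q j r}. v r))"
    using assms by (simp add: sum.inter_filter[symmetric] sum_distrib_left)
  finally show ?thesis .
qed

lemma sum_sqrt_2_powers: "(\<Sum>j\<le>J. sqrt 2 ^ j) \<le> 4 * sqrt 2 ^ J"
proof (induction J)
  case (Suc J)
  have "4 / 3 \<le> sqrt 2" by (rule real_le_rsqrt) (simp add: power2_eq_square)
  then have "4 * sqrt 2 ^ J \<le> (3 * sqrt 2) * sqrt 2 ^ J" by (intro mult_right_mono) auto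
  then show ?case using Suc unfolding sum.atMost_Suc power_Suc by linarith
qed simp

text \<open>The \<open>F\<close> of the sketch, which is the bound of
  \<open>norm_sum_unit_root_le\<close>. At \<open>r = 0\<close> division by zero makes it 0.\<close>

definition exp_sum_bound :: "nat \<Rightarrow> nat \<Rightarrow> int \<Rightarrow> real" where
  "exp_sum_bound H P r = min (real H) (real P / real_of_int \<bar>r\<bar>)"

lemma exp_sum_bound_nonneg [simp]: "exp_sum_bound H P r \<ge> 0"
  by (simp add: exp_sum_bound_def)

text \<open>Take the largest \<open>j \<le> J\<close> with
  \<open>2 ^ j * \<bar>r\<bar> \<le> int P\<close>. Either \<open>j = J\<close> and
  \<open>F \<le> H \<le> 2 ^ J\<close>, or \<open>P / \<bar>r\<bar> < 2 ^ (j + 1)\<close>; in both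
  cases \<open>F \<le> 2 ^ (j + 1)\<close>, and the single term \<open>j\<close> of the sum is
  already \<open>2 ^ (j + 1)\<close> to the power 3/2. Integral powers of \<open>sqrt 2\<close>
  stand for half-integral powers of 2.\<close>

lemma dyadic_weight_le:
  assumes "H \<le> 2 ^ J" "r \<noteq> 0" "\<bar>r\<bar> \<le> int P"
  shows "exp_sum_bound H P r * sqrt (exp_sum_bound H P r) \<le> (\<Sum>j\<le>J. if 2 ^ j * \<bar>r\<bar> \<le> int P then sqrt 2 ^ (3 * j + 3) else 0)"
proof -
  define j where "j = Max {j. j \<le> J \<and> 2 ^ j * \<bar>r\<bar> \<le> int P}"
  have ne: "{j. j \<le> J \<and> 2 ^ j * \<bar>r\<bar> \<le> int P} \<noteq> {}" using assms by (auto intro!: exI[of _ 0])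
  have fin: "finite {j. j \<le> J \<and> 2 ^ j * \<bar>r\<bar> \<le> int P}" by simp
  have j: "j \<le> J" "2 ^ j * \<bar>r\<bar> \<le> int P" using Max_in[OF fin ne] by (auto simp: j_def)
  have F: "exp_sum_bound H P r \<le> 2 ^ (j + 1)"
  proof (cases "j = J")
    case True
    have "real H \<le> 2 ^ J" using assms(1) by (metis of_nat_le_iff of_nat_numeral of_nat_power)
    moreover have "exp_sum_bound H P r \<le> real H" by (simp add: exp_sum_bound_def)
    moreover have "(2::real) ^ J \<le> 2 ^ (j + 1)" using True by simp
    ultimately show ?thesis by linarith
  next
    case False
    then have "\<not> 2 ^ (j + 1) * \<bar>r\<bar> \<le> int P"
      using Max_ge[OF fin, of "j + 1"] j by (auto simp: j_def[symmetric])
    then have "int P \<le> 2 ^ (j + 1) * \<bar>r\<bar>" by simp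
    then have "real_of_int (int P) \<le> real_of_int (2 ^ (j + 1) * \<bar>r\<bar>)" by (simp only: of_int_le_iff)
    then have "real P / real_of_int \<bar>r\<bar> \<le> 2 ^ (j + 1)" using assms(2) by (simp add: divide_simps)
    then show ?thesis by (simp add: exp_sum_bound_def min_def)
  qed
  have "exp_sum_bound H P r * sqrt (exp_sum_bound H P r) \<le> 2 ^ (j + 1) * sqrt (2 ^ (j + 1))"
    using F by (intro mult_mono) auto
  also have "\<dots> = sqrt 2 ^ (3 * j + 3)"
  proof -
    have "(2::real) ^ (j + 1) = sqrt 2 ^ (2 * (j + 1))" by (simp add: power_mult)
    moreover have "sqrt (2 ^ (j + 1)) = sqrt 2 ^ (j + 1)" by (simp add: real_sqrt_mult real_sqrt_power)
    ultimately have "2 ^ (j + 1) * sqrt (2 ^ (j + 1)) = sqrt 2 ^ (2 * (j + 1) + (j + 1))" by (simp only: power_add)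
    moreover have "2 * (j + 1) + (j + 1) = 3 * j + 3" by simp
    ultimately show ?thesis by (simp only:)
  qed
  also have "\<dots> = (if 2 ^ j * \<bar>r\<bar> \<le> int P then sqrt 2 ^ (3 * j + 3) else 0)" using j by simp
  also have "\<dots> \<le> (\<Sum>j\<le>J. if 2 ^ j * \<bar>r\<bar> \<le> int P then sqrt 2 ^ (3 * j + 3) else 0)"
    using j by (intro member_le_sum) auto
  finally show ?thesis .
qed

text \<open>If the fractions of size at most \<open>1 / 2 ^ j\<close> carry mass at most
  \<open>\<kappa> / 2 ^ j\<close>, then the weight \<open>F\<close> to the power 3/2 contributes a
  multiple of \<open>sqrt 2 ^ j * \<kappa>\<close> at scale \<open>j\<close>. The geometric series
  is dominated by its top term.\<close>

lemma dyadic_sum_le: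
  fixes v :: "int \<Rightarrow> real"
  assumes "finite R" "\<And>r. r \<in> R \<Longrightarrow> r \<noteq> 0 \<and> \<bar>r\<bar> \<le> int P" "\<And>r. r \<in> R \<Longrightarrow> v r \<ge> 0" "H \<le> 2 ^ J"
    and density: "\<And>j. j \<le> J \<Longrightarrow> (\<Sum>r\<in>{r\<in>R. 2 ^ j * \<bar>r\<bar> \<le> int P}. v r) \<le> \<kappa> / 2 ^ j"
    and "\<kappa> \<ge> 0"
  shows "(\<Sum>r\<in>R. exp_sum_bound H P r * sqrt (exp_sum_bound H P r) * v r) \<le> 12 * sqrt 2 ^ J * \<kappa>"
proof -
  have "(\<Sum>r\<in>R. exp_sum_bound H P r * sqrt (exp_sum_bound H P r) * v r)
     \<le> (\<Sum>r\<in>R. (\<Sum>j\<le>J. if 2 ^ j * \<bar>r\<bar> \<le> int P then sqrt 2 ^ (3 * j + 3) else 0) * v r)"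
    using assms by (intro sum_mono mult_right_mono dyadic_weight_le) auto
  also have "\<dots> = (\<Sum>j\<le>J. sqrt 2 ^ (3 * j + 3) * (\<Sum>r\<in>{r\<in>R. 2 ^ j * \<bar>r\<bar> \<le> int P}. v r))"
    using assms(1) by (rule sum_indicator_swap) simp
  also have "\<dots> \<le> (\<Sum>j\<le>J. sqrt 2 ^ (3 * j + 3) * (\<kappa> / 2 ^ j))"
    using density by (intro sum_mono mult_left_mono) auto
  also have "\<dots> = (\<Sum>j\<le>J. 2 * sqrt 2 * \<kappa> * sqrt 2 ^ j)"
  proof (intro sum.cong refl)
    fix j
    have "(2::real) ^ j = sqrt 2 ^ (2 * j)" by (simp add: power_mult)
    moreover have "sqrt 2 ^ (3 * j + 3) = sqrt 2 ^ (2 * j) * sqrt 2 ^ j * sqrt 2 ^ 3"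
      by (simp flip: power_add)
    moreover have "sqrt 2 ^ 3 = 2 * sqrt 2" by (simp add: power3_eq_cube)
    ultimately show "sqrt 2 ^ (3 * j + 3) * (\<kappa> / 2 ^ j) = 2 * sqrt 2 * \<kappa> * sqrt 2 ^ j" by simp
  qed
  also have "\<dots> = 2 * sqrt 2 * \<kappa> * (\<Sum>j\<le>J. sqrt 2 ^ j)" by (simp add: sum_distrib_left)
  also have "\<dots> \<le> 2 * sqrt 2 * \<kappa> * (4 * sqrt 2 ^ J)"
    using \<open>\<kappa> \<ge> 0\<close> by (intro mult_left_mono sum_sqrt_2_powers) auto
  \<comment> \<open>The factor \<open>2 * sqrt 2\<close> comes from the shift \<open>j + 1\<close>,
    the 4 from the geometric series.\<close>
  also have "\<dots> = 8 * sqrt 2 * (\<kappa> * sqrt 2 ^ J)" by simp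
  also have "\<dots> \<le> 12 * (\<kappa> * sqrt 2 ^ J)"
  proof (intro mult_right_mono)
    have "sqrt 2 \<le> 3 / 2" by (rule real_le_lsqrt) (auto simp: power2_eq_square)
    then show "8 * sqrt 2 \<le> 12" by simp
  qed (use \<open>\<kappa> \<ge> 0\<close> in auto)
  finally show ?thesis by (simp add: mult_ac)
qed

lemma sum_Pow_quotient:
  assumes "finite S"
  shows "(\<Sum>T\<in>Pow S. real (\<Prod>T) / (phi T)\<^sup>2) = (\<Prod>p\<in>S. 1 + real p / (real p - 1)\<^sup>2)"
proof -
  have "(\<Prod>p\<in>S. real p / (real p - 1)\<^sup>2 + 1) = (\<Sum>T\<in>Pow S. (\<Prod>p\<in>T. real p / (real p - 1)\<^sup>2) * (\<Prod>p\<in>S - T. 1))"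
    by (rule prod_add[OF assms])
  then show ?thesis by (simp add: add.commute phi_def prod_power_distrib prod_dividef)
qed

lemma sum_Pow_quotient_cube:
  assumes "finite S"
  shows "(\<Sum>T\<in>Pow S. (real (\<Prod>T))\<^sup>2 / phi T ^ 3) = (\<Prod>p\<in>S. 1 + (real p)\<^sup>2 / (real p - 1) ^ 3)"
proof -
  have "(\<Prod>p\<in>S. (real p)\<^sup>2 / (real p - 1) ^ 3 + 1) = (\<Sum>T\<in>Pow S. (\<Prod>p\<in>T. (real p)\<^sup>2 / (real p - 1) ^ 3) * (\<Prod>p\<in>S - T. 1))"
    by (rule prod_add[OF assms])
  then show ?thesis by (simp add: add.commute phi_def prod_power_distrib prod_dividef)
qed

lemma sum_by_label:
  fixes f :: "'a \<Rightarrow> real"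
  assumes "finite R" "finite B" "\<And>r. r \<in> R \<Longrightarrow> l r \<in> B"
  shows "(\<Sum>r\<in>R. f r) = (\<Sum>b\<in>B. \<Sum>r\<in>{r\<in>R. l r = b}. f r)"
  using assms by (intro sum.group[symmetric]) auto

section \<open>Weighted counting of spaced fractions\<close>

context prime_set
begin

lemma prod_pos_nat: "T \<subseteq> S \<Longrightarrow> \<Prod>T > 0"
  using S_ge_2 by (intro prod_pos) fastforce

text \<open>
  The sum runs over a set \<open>R\<close> of fractions \<open>r / P\<close> in which \<open>r\<close> carries the set \<open>V r\<close> of primes
  that occur in its denominator only. Fractions with a large \<open>V r\<close> are counted separately for each
  value of \<open>V r\<close>; the remaining ones are counted together when their \<open>\<Prod>(V r)\<close> is of the same
  dyadic size, where the lower bound for \<open>\<bar>r\<bar>\<close> absorbs the additive constant 1 of the spacing bound.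
\<close>

lemma spaced_sum_le:
  fixes V :: "int \<Rightarrow> nat set" and \<delta> C :: real and g n :: nat
  assumes fin: "finite R" and V: "\<And>r. r \<in> R \<Longrightarrow> V r \<subseteq> S"
    and low: "\<And>r. r \<in> R \<Longrightarrow> real P \<le> real_of_int \<bar>r\<bar> * real g * (real (\<Prod>(V r)))\<^sup>2"
    and spaced: "\<And>r r'. r \<in> R \<Longrightarrow> r' \<in> R \<Longrightarrow> r \<noteq> r' \<Longrightarrow>
        real P \<le> real_of_int \<bar>r - r'\<bar> * real g * real (\<Prod>(V r \<union> V r'))"
    and g: "g \<ge> 1" and \<delta>: "\<delta> > 0" "1 \<le> \<delta> * 2 ^ n"
    and C: "C \<ge> 0" "\<And>T. T \<subseteq> S \<Longrightarrow> real (\<Prod>T) \<le> 2 ^ n \<Longrightarrow> real (\<Prod>T) \<le> C * phi T"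
    and bound: "\<And>r. r \<in> R \<Longrightarrow> real_of_int \<bar>r\<bar> \<le> \<delta> * real P"
  shows "(\<Sum>r\<in>R. 1 / (phi (V r))\<^sup>2)
     \<le> \<delta> * real g * (12 * real n * C\<^sup>2 + 3 * (\<Prod>p\<in>S. 1 + real p / (real p - 1)\<^sup>2))"
proof -
  define x where "x = (\<lambda>r. real (\<Prod>(V r)))"
  have x1: "x r \<ge> 1" if "r \<in> R" for r
    using prod_pos_nat[OF V[OF that]] unfolding x_def by (metis One_nat_def Suc_leI of_nat_1 of_nat_mono)
  have four: "((2::real) ^ i)\<^sup>2 = 4 ^ i" for i by (simp add: power2_eq_square flip: power_mult_distrib)
  have Pp: "real P > 0" using P_pos by simp
  have gp: "real g \<ge> 1" using g by simp
  \<comment> \<open>The threshold is where the additive 1 of \<open>card_spaced_le\<close> is at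
    most \<open>\<delta> * g * x\<close>: on \<open>R1\<close> the count
    \<open>1 + 2 * \<delta> * g * x\<close> becomes \<open>3 * \<delta> * g * x\<close>.\<close>
  define R1 where "R1 = {r\<in>R. 1 \<le> \<delta> * real g * x r}"
  define R2 where "R2 = {r\<in>R. \<delta> * real g * x r < 1}"
  have split: "(\<Sum>r\<in>R. 1 / (phi (V r))\<^sup>2) = (\<Sum>r\<in>R1. 1 / (phi (V r))\<^sup>2) + (\<Sum>r\<in>R2. 1 / (phi (V r))\<^sup>2)"
    using fin by (subst sum.union_disjoint[symmetric]) (auto simp: R1_def R2_def intro!: sum.cong)
  have "(\<Sum>r\<in>R1. 1 / (phi (V r))\<^sup>2) = (\<Sum>T\<in>Pow S. \<Sum>r\<in>{r\<in>R1. V r = T}. 1 / (phi (V r))\<^sup>2)"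
    using fin V finite_S by (intro sum_by_label) (auto simp: R1_def)
  also have "\<dots> \<le> (\<Sum>T\<in>Pow S. 3 * \<delta> * real g * (real (\<Prod>T) / (phi T)\<^sup>2))"
  proof (intro sum_mono)
    fix T assume T: "T \<in> Pow S"
    let ?A = "{r\<in>R1. V r = T}"
    have ph: "phi T > 0" using T by (intro phi_pos) auto
    have Tp: "real (\<Prod>T) > 0" using prod_pos_nat[of T] T by (simp del: of_nat_prod)
    have "real (card ?A) \<le> 3 * \<delta> * real g * real (\<Prod>T)"
    proof (cases "?A = {}")
      case False
      then have one: "1 \<le> \<delta> * real g * real (\<Prod>T)" by (auto simp: R1_def x_def simp del: of_nat_prod)
      have "real (card ?A) \<le> 1 + 2 * (\<delta> * real P) / (real P / (real g * real (\<Prod>T)))"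
      proof (rule card_spaced_le)
        show "0 < real P / (real g * real (\<Prod>T))" using Pp gp Tp by (simp del: of_nat_prod)
        fix a b assume ab: "a \<in> ?A" "b \<in> ?A" "a \<noteq> b"
        then have "real P \<le> real_of_int \<bar>a - b\<bar> * real g * real (\<Prod>(V a \<union> V b))"
          by (intro spaced) (auto simp: R1_def)
        also have "V a \<union> V b = T" using ab by auto
        finally show "real P / (real g * real (\<Prod>T)) \<le> \<bar>real_of_int (a - b)\<bar>"
          using gp Tp by (simp add: pos_divide_le_eq mult.assoc del: of_nat_prod)
      qed (use bound \<delta> in \<open>auto simp: R1_def\<close>)
      also have "\<dots> = 1 + 2 * \<delta> * real g * real (\<Prod>T)" using Pp by (simp del: of_nat_prod)
      also have "\<dots> \<le> 3 * \<delta> * real g * real (\<Prod>T)" using one by (simp del: of_nat_prod)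
      finally show ?thesis .
    next
      case True
      then have "card ?A = 0" by (simp only: card.empty)
      moreover have "0 \<le> 3 * \<delta> * real g * real (\<Prod>T)" using \<delta> by (simp del: of_nat_prod)
      ultimately show ?thesis by (simp only: of_nat_0)
    qed
    then have "real (card ?A) / (phi T)\<^sup>2 \<le> 3 * \<delta> * real g * real (\<Prod>T) / (phi T)\<^sup>2"
      by (intro divide_right_mono) auto
    then show "(\<Sum>r\<in>?A. 1 / (phi (V r))\<^sup>2) \<le> 3 * \<delta> * real g * (real (\<Prod>T) / (phi T)\<^sup>2)"
      by (simp del: of_nat_prod)
  qed
  also have "\<dots> = 3 * \<delta> * real g * (\<Prod>p\<in>S. 1 + real p / (real p - 1)\<^sup>2)"
    by (simp only: sum_distrib_left[symmetric] sum_Pow_quotient[OF finite_S])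
  finally have large: "(\<Sum>r\<in>R1. 1 / (phi (V r))\<^sup>2) \<le> 3 * \<delta> * real g * (\<Prod>p\<in>S. 1 + real p / (real p - 1)\<^sup>2)" .
  \<comment> \<open>Below the threshold \<open>x\<close> is less than
    \<open>1 / (\<delta> * g)\<close>, hence less than \<open>2 ^ n\<close>. This both limits the
    dyadic classes to \<open>n\<close> and makes the hypothesis on \<open>C\<close>
    applicable.\<close>
  have xlt: "x r < 2 ^ n" if "r \<in> R2" for r
  proof -
    have "\<delta> * 1 * x r \<le> \<delta> * real g * x r"
      using \<delta> gp x1[of r] that by (intro mult_right_mono mult_left_mono) (auto simp: R2_def)
    also have "\<dots> < 1" using that by (simp add: R2_def)
    also have "1 \<le> \<delta> * 2 ^ n" by (rule \<delta>(2))
    finally have "\<delta> * x r < \<delta> * 2 ^ n" by (simp only: mult_1_right)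
    then show ?thesis using \<delta> by simp
  qed
  define l where "l = (\<lambda>r. nat \<lfloor>log 2 (x r)\<rfloor>)"
  have l: "2 ^ l r \<le> x r" "x r < 2 ^ (l r + 1)" if "r \<in> R" for r
  proof -
    have "0 \<le> log 2 (x r)" using x1[OF that] by simp
    then have "real (l r) = real_of_int \<lfloor>log 2 (x r)\<rfloor>" by (simp add: l_def)
    then have "real (l r) \<le> log 2 (x r)" "log 2 (x r) < real (l r + 1)" by linarith+
    then have "2 powr real (l r) \<le> x r" "x r < 2 powr real (l r + 1)"
      using x1[OF that] by (simp_all add: le_log_iff log_less_iff)
    then show "2 ^ l r \<le> x r" "x r < 2 ^ (l r + 1)"
      by (simp_all only: powr_realpow zero_less_numeral)
  qed
  have ln: "l r < n" if "r \<in> R2" for r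
  proof -
    have "r \<in> R" using that by (simp add: R2_def)
    from l(1)[OF this] have "(2::real) ^ l r < 2 ^ n" using xlt[OF that] by (rule le_less_trans)
    then show ?thesis by simp
  qed
  have "(\<Sum>r\<in>R2. 1 / (phi (V r))\<^sup>2) = (\<Sum>i\<in>{..<n}. \<Sum>r\<in>{r\<in>R2. l r = i}. 1 / (phi (V r))\<^sup>2)"
    using fin ln by (intro sum_by_label) (auto simp: R2_def)
  also have "\<dots> \<le> (\<Sum>i\<in>{..<n}. 12 * \<delta> * real g * C\<^sup>2)"
  proof (intro sum_mono)
    fix i
    let ?A = "{r\<in>R2. l r = i}"
    have card: "real (card ?A) \<le> 12 * \<delta> * real g * 4 ^ i"
    proof (cases "?A = {}")
      case False
      then obtain r where r: "r \<in> R" "l r = i" by (auto simp: R2_def)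
      have "(x r)\<^sup>2 \<le> (2 ^ (i + 1))\<^sup>2" using l[OF r(1)] x1[OF r(1)] r(2) by (intro power_mono) auto
      also have "\<dots> = 4 * 4 ^ i" by (simp add: power_mult_distrib four)
      finally have xr: "(x r)\<^sup>2 \<le> 4 * 4 ^ i" .
      \<comment> \<open>One element of the class suffices: its lower bound \<open>low\<close>
        against its upper bound \<open>\<delta> * P\<close> gives
        \<open>1 \<le> 4 * \<delta> * g * 4 ^ i\<close>, which absorbs the additive 1 and turns the
        coefficient 8 of the count into 12.\<close>
      have "real P \<le> real_of_int \<bar>r\<bar> * real g * (x r)\<^sup>2" using low[OF r(1)] by (simp only: x_def)
      also have "\<dots> \<le> (\<delta> * real P) * real g * (4 * 4 ^ i)"
        using bound[OF r(1)] xr \<delta> by (intro mult_mono) auto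
      also have "\<dots> = real P * (4 * \<delta> * real g * 4 ^ i)" by simp
      finally have one: "1 \<le> 4 * \<delta> * real g * 4 ^ i" using Pp by simp
      have "real (card ?A) \<le> 1 + 2 * (\<delta> * real P) / (real P / (real g * (4 * 4 ^ i)))"
      proof (rule card_spaced_le)
        show "0 < real P / (real g * (4 * 4 ^ i))" using Pp gp by simp
        fix a b assume ab: "a \<in> ?A" "b \<in> ?A" "a \<noteq> b"
        have "real P \<le> real_of_int \<bar>a - b\<bar> * real g * real (\<Prod>(V a \<union> V b))"
          using ab by (intro spaced) (auto simp: R2_def)
        also have "\<dots> \<le> real_of_int \<bar>a - b\<bar> * real g * (4 * 4 ^ i)"
        proof (intro mult_left_mono)
          have sub: "V a \<subseteq> S" "V b \<subseteq> S" using ab V by (auto simp: R2_def)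
          then have fin: "finite (V a)" "finite (V b)" using finite_S finite_subset by blast+
          have "\<Prod>(V a \<union> V b) * \<Prod>(V a \<inter> V b) = \<Prod>(V a) * \<Prod>(V b)"
            using fin by (rule prod.union_inter)
          moreover have "\<Prod>(V a \<inter> V b) \<ge> 1" using prod_pos_nat[of "V a \<inter> V b"] sub by (simp add: Suc_leI le_infI1)
          ultimately have "\<Prod>(V a \<union> V b) \<le> \<Prod>(V a) * \<Prod>(V b)" by (metis le_square mult.right_neutral mult_le_mono2)
          then have "real (\<Prod>(V a \<union> V b)) \<le> x a * x b"
            unfolding x_def by (simp only: of_nat_le_iff of_nat_mult[symmetric])
          also have "\<dots> \<le> 2 ^ (i + 1) * 2 ^ (i + 1)"
            using l(2)[of a] l(2)[of b] x1[of a] x1[of b] ab by (intro mult_mono) (auto simp: R2_def)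
          also have "\<dots> = 4 * 4 ^ i" by (simp add: power_mult_distrib[symmetric])
          finally show "real (\<Prod>(V a \<union> V b)) \<le> 4 * 4 ^ i" .
        qed auto
        finally show "real P / (real g * (4 * 4 ^ i)) \<le> \<bar>real_of_int (a - b)\<bar>"
          using gp by (simp add: pos_divide_le_eq mult.assoc)
      qed (use bound \<delta> in \<open>auto simp: R2_def\<close>)
      also have "\<dots> = 1 + 8 * \<delta> * real g * 4 ^ i" using Pp by simp
      also have "\<dots> \<le> 12 * \<delta> * real g * 4 ^ i" using one by simp
      finally show ?thesis .
    next
      case True
      then have "card ?A = 0" by (simp only: card.empty)
      moreover have "0 \<le> 12 * \<delta> * real g * 4 ^ i" using \<delta> by simp
      ultimately show ?thesis by (simp only: of_nat_0)
    qed
    \<comment> \<open>The square of \<open>phi\<close> cancels the \<open>4 ^ i\<close> of the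
      count, so every dyadic class gets the same bound.\<close>
    have "(\<Sum>r\<in>?A. 1 / (phi (V r))\<^sup>2) \<le> (\<Sum>r\<in>?A. C\<^sup>2 / 4 ^ i)"
    proof (intro sum_mono)
      fix r assume r: "r \<in> ?A"
      then have r': "r \<in> R" "V r \<subseteq> S" "phi (V r) > 0" using V phi_pos by (auto simp: R2_def)
      have "2 ^ i \<le> x r" using l(1)[OF r'(1)] r by simp
      also have "\<dots> \<le> C * phi (V r)" unfolding x_def using r r' xlt[of r] by (intro C(2)) (auto simp: x_def)
      finally have "(2 ^ i)\<^sup>2 \<le> (C * phi (V r))\<^sup>2" by (intro power_mono) auto
      then have "4 ^ i \<le> C\<^sup>2 * (phi (V r))\<^sup>2" by (simp add: power_mult_distrib four)
      then show "1 / (phi (V r))\<^sup>2 \<le> C\<^sup>2 / 4 ^ i" using r' by (simp add: divide_simps mult.commute)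
    qed
    also have "\<dots> = real (card ?A) * (C\<^sup>2 / 4 ^ i)" by simp
    also have "\<dots> \<le> 12 * \<delta> * real g * 4 ^ i * (C\<^sup>2 / 4 ^ i)" using card by (intro mult_right_mono) auto
    also have "\<dots> = 12 * \<delta> * real g * C\<^sup>2" by simp
    finally show "(\<Sum>r\<in>?A. 1 / (phi (V r))\<^sup>2) \<le> 12 * \<delta> * real g * C\<^sup>2" .
  qed
  also have "\<dots> = 12 * \<delta> * real g * real n * C\<^sup>2" by simp
  finally show ?thesis using large split by (simp add: algebra_simps)
qed

end

section \<open>Triples of fractions with integral sum\<close>

context prime_set
begin

definition den :: "int \<Rightarrow> nat" where
  "den r = \<Prod>(supp r)"

definition frac_weight :: "nat \<Rightarrow> int \<Rightarrow> real" where
  "frac_weight H r = 1 / phi (supp r) * exp_sum_bound H P r"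

definition frac_weight32 :: "nat \<Rightarrow> int \<Rightarrow> real" where
  "frac_weight32 H r = exp_sum_bound H P r * sqrt (exp_sum_bound H P r)"

definition triples :: "(int \<times> int \<times> int) set" where
  "triples = {(r1, r2, r3). r1 \<in> res - {0} \<and> r2 \<in> res - {0} \<and> r3 \<in> res - {0} \<and> int P dvd r1 + r2 + r3}"

text \<open>Position 3 is meant for the fraction of smallest absolute value, positions 1 and 2 for
  the other two with the smaller denominator first. Only the order of the denominators is recorded
  here, as the order of absolute values is spent in \<open>frac_weight_product_le\<close>.\<close>

definition ordered_term :: "nat \<Rightarrow> int \<times> int \<times> int \<Rightarrow> real" where
  "ordered_term H = (\<lambda>(r1, r2, r3). if den r1 \<le> den r2
     then 1 / phi (supp r1) * (1 / phi (supp r2)) * (1 / phi (supp r3)) * (frac_weight32 H r1 * frac_weight32 H r3) else 0)"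

lemma supp_subset: "supp r \<subseteq> S"
  by (auto simp: supp_def)

lemma finite_supp [simp]: "finite (supp r)"
  using finite_S supp_subset finite_subset by blast

lemma phi_supp_pos: "phi (supp r) > 0"
  by (rule phi_pos[OF supp_subset])

lemma ordered_term_nonneg: "ordered_term H t \<ge> 0"
  using phi_supp_pos by (auto simp: ordered_term_def frac_weight32_def less_imp_le split: prod.splits)

lemma finite_triples: "finite triples"
  by (rule finite_subset[of _ "res \<times> res \<times> res"]) (auto simp: triples_def)

text \<open>The triangle inequality for the distance to the nearest integer: if
  \<open>r1 + s\<close> is not 0 it is at least \<open>P\<close> in absolute value, while
  \<open>\<bar>r1\<bar> \<le> P / 2\<close>.\<close>

lemma res_triangle:
  assumes "r1 \<in> res" "int P dvd r1 + s"
  shows "\<bar>r1\<bar> \<le> \<bar>s\<bar>"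
proof (rule ccontr)
  assume a: "\<not> \<bar>r1\<bar> \<le> \<bar>s\<bar>"
  then have "r1 + s \<noteq> 0" by auto
  then have "int P \<le> \<bar>r1 + s\<bar>" using dvd_imp_le_int[of "r1 + s" "int P"] assms(2) by simp
  moreover have "2 * \<bar>r1\<bar> \<le> int P" using assms(1) by (auto simp: res_def)
  ultimately show False using a by linarith
qed

lemma weight_le_mult:
  assumes "r \<noteq> 0" "r' \<noteq> 0" "c \<ge> 1" "real_of_int \<bar>r\<bar> \<le> c * real_of_int \<bar>r'\<bar>"
  shows "exp_sum_bound H P r' \<le> c * exp_sum_bound H P r"
proof -
  have "real H \<le> c * real H" using assms mult_right_mono[of 1 c "real H"] by simp
  moreover have "real P / real_of_int \<bar>r'\<bar> \<le> c * (real P / real_of_int \<bar>r\<bar>)"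
    using mult_left_mono[OF assms(4), of "real P"] assms by (simp add: field_simps)
  ultimately show ?thesis using assms(3) by (auto simp: exp_sum_bound_def min_def)
qed

text \<open>Replace \<open>y\<close> by \<open>2 * x\<close>, then trade one factor
  \<open>x = sqrt x * sqrt x\<close> for \<open>sqrt x * sqrt z\<close>. The variable
  \<open>y\<close> disappears, and the other two carry the exponent 3/2.\<close>

lemma weight_product_le:
  fixes x y z :: real
  assumes "0 \<le> x" "x \<le> z" "y \<le> 2 * x" "0 \<le> z"
  shows "x * y * z \<le> 2 * ((x * sqrt x) * (z * sqrt z))"
proof -
  have "x * y * z \<le> x * (2 * x) * z" using assms by (intro mult_right_mono mult_left_mono) auto
  also have "\<dots> = 2 * (x * z) * (sqrt x * sqrt x)" using assms by simp
  also have "\<dots> \<le> 2 * (x * z) * (sqrt x * sqrt z)"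
    using assms by (intro mult_left_mono) auto
  finally show ?thesis by (simp add: mult_ac)
qed

text \<open>As \<open>b\<close> is smallest, \<open>res_triangle\<close> gives
  \<open>\<bar>a\<bar> \<le> 2 * \<bar>c\<bar>\<close> and conversely, so the values of
  \<open>F\<close> at \<open>a\<close> and \<open>c\<close> differ by a factor of at most 2 and
  neither exceeds that at \<open>b\<close>. Either of \<open>a\<close>, \<open>c\<close> may then
  play \<open>x\<close> in \<open>weight_product_le\<close>; the one with the smaller denominator is
  chosen.\<close>

lemma frac_weight_product_le:
  assumes "(a, c, b) \<in> triples" "\<bar>b\<bar> \<le> \<bar>a\<bar>" "\<bar>b\<bar> \<le> \<bar>c\<bar>"
  shows "frac_weight H a * frac_weight H c * frac_weight H b \<le> 2 * (ordered_term H (a, c, b) + ordered_term H (c, a, b))"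
proof -
  have r: "a \<in> res" "c \<in> res" "a \<noteq> 0" "b \<noteq> 0" "c \<noteq> 0" "int P dvd a + (c + b)" "int P dvd c + (a + b)"
    using assms(1) by (auto simp: triples_def ac_simps)
  have "\<bar>a\<bar> \<le> 2 * \<bar>c\<bar>" "\<bar>c\<bar> \<le> 2 * \<bar>a\<bar>"
    using res_triangle[OF r(1,6)] res_triangle[OF r(2,7)] assms(2,3) by linarith+
  then have "real_of_int \<bar>a\<bar> \<le> real_of_int (2 * \<bar>c\<bar>)" "real_of_int \<bar>c\<bar> \<le> real_of_int (2 * \<bar>a\<bar>)"
    by (simp_all only: of_int_le_iff)
  then have ac: "exp_sum_bound H P c \<le> 2 * exp_sum_bound H P a" "exp_sum_bound H P a \<le> 2 * exp_sum_bound H P c"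
    using r by (auto intro!: weight_le_mult)
  have b: "exp_sum_bound H P a \<le> exp_sum_bound H P b" "exp_sum_bound H P c \<le> exp_sum_bound H P b"
    using weight_le_mult[of b a 1 H] weight_le_mult[of b c 1 H] assms r by auto
  have ph: "0 < phi (supp a)" "0 < phi (supp b)" "0 < phi (supp c)" by (rule phi_supp_pos)+
  let ?w = "1 / phi (supp a) * (1 / phi (supp c)) * (1 / phi (supp b))"
  have w: "?w \<ge> 0" using ph by simp
  have eq: "frac_weight H a * frac_weight H c * frac_weight H b = ?w * (exp_sum_bound H P a * exp_sum_bound H P c * exp_sum_bound H P b)"
    by (simp add: frac_weight_def)
  show ?thesis
  proof (cases "den a \<le> den c")
    case True
    have "exp_sum_bound H P a * exp_sum_bound H P c * exp_sum_bound H P b \<le> 2 * (frac_weight32 H a * frac_weight32 H b)"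
      unfolding frac_weight32_def using ac b by (intro weight_product_le) auto
    then have "?w * (exp_sum_bound H P a * exp_sum_bound H P c * exp_sum_bound H P b) \<le> ?w * (2 * (frac_weight32 H a * frac_weight32 H b))"
      using w by (intro mult_left_mono)
    also have "\<dots> = 2 * ordered_term H (a, c, b)" using True by (simp add: ordered_term_def)
    finally show ?thesis using eq ordered_term_nonneg[of H "(c, a, b)"] by simp
  next
    case False
    have "exp_sum_bound H P c * exp_sum_bound H P a * exp_sum_bound H P b \<le> 2 * (frac_weight32 H c * frac_weight32 H b)"
      unfolding frac_weight32_def using ac b by (intro weight_product_le) auto
    then have "?w * (exp_sum_bound H P c * exp_sum_bound H P a * exp_sum_bound H P b) \<le> ?w * (2 * (frac_weight32 H c * frac_weight32 H b))"
      using w by (intro mult_left_mono)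
    also have "\<dots> = 2 * ordered_term H (c, a, b)" using False by (simp add: ordered_term_def)
    finally show ?thesis using eq ordered_term_nonneg[of H "(a, c, b)"] by (simp add: mult_ac)
  qed
qed

text \<open>\<open>triples\<close> is invariant under permutations, so all six orderings of the
  variables have the same total. With the 2 of \<open>frac_weight_product_le\<close> this makes
  12.\<close>

lemma sum_triples_le:
  "(\<Sum>(r1, r2, r3)\<in>triples. frac_weight H r1 * frac_weight H r2 * frac_weight H r3)
     \<le> 12 * (\<Sum>t\<in>triples. ordered_term H t)"
proof -
  let ?G = "ordered_term H"
  let ?perms = "\<lambda>(r1, r2, r3). ?G (r1, r2, r3) + ?G (r2, r1, r3) + ?G (r1, r3, r2) + ?G (r3, r1, r2) + ?G (r2, r3, r1) + ?G (r3, r2, r1)"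
  have "(\<Sum>(r1, r2, r3)\<in>triples. frac_weight H r1 * frac_weight H r2 * frac_weight H r3) \<le> (\<Sum>t\<in>triples. 2 * ?perms t)"
  proof (rule sum_mono)
    fix t assume "t \<in> triples"
    then obtain r1 r2 r3 where tt: "t = (r1, r2, r3)" and t: "(r1, r2, r3) \<in> triples" by (cases t) auto
    then have t': "(r1, r3, r2) \<in> triples" "(r2, r3, r1) \<in> triples" by (auto simp: triples_def ac_simps)
    note nn = ordered_term_nonneg[of H "(r1, r2, r3)"] ordered_term_nonneg[of H "(r2, r1, r3)"]
      ordered_term_nonneg[of H "(r1, r3, r2)"] ordered_term_nonneg[of H "(r3, r1, r2)"]
      ordered_term_nonneg[of H "(r2, r3, r1)"] ordered_term_nonneg[of H "(r3, r2, r1)"]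
    consider "\<bar>r3\<bar> \<le> \<bar>r1\<bar>" "\<bar>r3\<bar> \<le> \<bar>r2\<bar>" | "\<bar>r2\<bar> \<le> \<bar>r1\<bar>" "\<bar>r2\<bar> \<le> \<bar>r3\<bar>" | "\<bar>r1\<bar> \<le> \<bar>r2\<bar>" "\<bar>r1\<bar> \<le> \<bar>r3\<bar>" by linarith
    then have "frac_weight H r1 * frac_weight H r2 * frac_weight H r3 \<le> 2 * ?perms (r1, r2, r3)"
    proof cases
      case 1
      then show ?thesis using frac_weight_product_le[OF t, of H] nn by simp
    next
      case 2
      then show ?thesis using frac_weight_product_le[OF t'(1), of H] nn by (simp add: mult_ac)
    next
      case 3
      then show ?thesis using frac_weight_product_le[OF t'(2), of H] nn by (simp add: mult_ac)
    qed
    then show "(case t of (r1, r2, r3) \<Rightarrow> frac_weight H r1 * frac_weight H r2 * frac_weight H r3) \<le> 2 * ?perms t"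
      by (simp only: tt prod.case)
  qed
  also have "\<dots> = 2 * ((\<Sum>(r1, r2, r3)\<in>triples. ?G (r1, r2, r3)) + (\<Sum>(r1, r2, r3)\<in>triples. ?G (r2, r1, r3))
      + (\<Sum>(r1, r2, r3)\<in>triples. ?G (r1, r3, r2)) + (\<Sum>(r1, r2, r3)\<in>triples. ?G (r3, r1, r2))
      + (\<Sum>(r1, r2, r3)\<in>triples. ?G (r2, r3, r1)) + (\<Sum>(r1, r2, r3)\<in>triples. ?G (r3, r2, r1)))"
    by (simp add: sum.distrib case_prod_unfold flip: sum_distrib_left)
  also have "(\<Sum>(r1, r2, r3)\<in>triples. ?G (r1, r2, r3)) = (\<Sum>t\<in>triples. ?G t)"
    by (simp add: case_prod_unfold)
  also have "(\<Sum>(r1, r2, r3)\<in>triples. ?G (r2, r1, r3)) = (\<Sum>t\<in>triples. ?G t)"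
    by (rule sum.reindex_bij_witness[of _ "\<lambda>(a, b, c). (b, a, c)" "\<lambda>(a, b, c). (b, a, c)"]) (auto simp: triples_def ac_simps)
  also have "(\<Sum>(r1, r2, r3)\<in>triples. ?G (r1, r3, r2)) = (\<Sum>t\<in>triples. ?G t)"
    by (rule sum.reindex_bij_witness[of _ "\<lambda>(a, b, c). (a, c, b)" "\<lambda>(a, b, c). (a, c, b)"]) (auto simp: triples_def ac_simps)
  also have "(\<Sum>(r1, r2, r3)\<in>triples. ?G (r3, r1, r2)) = (\<Sum>t\<in>triples. ?G t)"
    by (rule sum.reindex_bij_witness[of _ "\<lambda>(a, b, c). (b, c, a)" "\<lambda>(a, b, c). (c, a, b)"]) (auto simp: triples_def ac_simps)
  also have "(\<Sum>(r1, r2, r3)\<in>triples. ?G (r2, r3, r1)) = (\<Sum>t\<in>triples. ?G t)"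
    by (rule sum.reindex_bij_witness[of _ "\<lambda>(a, b, c). (c, a, b)" "\<lambda>(a, b, c). (b, c, a)"]) (auto simp: triples_def ac_simps)
  also have "(\<Sum>(r1, r2, r3)\<in>triples. ?G (r3, r2, r1)) = (\<Sum>t\<in>triples. ?G t)"
    by (rule sum.reindex_bij_witness[of _ "\<lambda>(a, b, c). (c, b, a)" "\<lambda>(a, b, c). (c, b, a)"]) (auto simp: triples_def ac_simps)
  finally show ?thesis by simp
qed

lemma prod_split: "T \<subseteq> S \<Longrightarrow> P = \<Prod>T * \<Prod>(S - T)"
  unfolding P_def using finite_S by (simp add: prod.subset_diff mult.commute)

text \<open>\<open>r\<close> is a nonzero multiple of \<open>P / \<Prod>T\<close>. In terms of
  fractions, a nonzero one whose denominator divides \<open>\<Prod>T\<close> is at least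
  \<open>1 / \<Prod>T\<close>; applied to differences, this is the spacing used below.\<close>

lemma P_le_of_dvd:
  assumes "T \<subseteq> S" "r \<noteq> 0" "\<And>p. p \<in> S - T \<Longrightarrow> int p dvd r"
  shows "int P \<le> \<bar>r\<bar> * int (\<Prod>T)"
proof -
  have "int (\<Prod>(S - T)) dvd r" using finite_S prime_S assms(3) by (intro prod_primes_dvd) auto
  then have "int (\<Prod>(S - T)) \<le> \<bar>r\<bar>" using dvd_imp_le_int[OF assms(2)] by fastforce
  then have "int (\<Prod>T) * int (\<Prod>(S - T)) \<le> int (\<Prod>T) * \<bar>r\<bar>" by (intro mult_left_mono) (simp_all del: of_nat_prod)
  then show ?thesis unfolding prod_split[OF assms(1)] of_nat_mult by (simp add: mult.commute del: of_nat_prod)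
qed

lemma P_le_of_dvd_real:
  assumes "T \<subseteq> S" "r \<noteq> 0" "\<And>p. p \<in> S - T \<Longrightarrow> int p dvd r"
  shows "real P \<le> real_of_int \<bar>r\<bar> * real (\<Prod>T)"
proof -
  have "real_of_int (int P) \<le> real_of_int (\<bar>r\<bar> * int (\<Prod>T))"
    using P_le_of_dvd[OF assms] by (simp only: of_int_le_iff)
  then show ?thesis by (simp only: of_int_mult of_int_of_nat_eq)
qed

text \<open>The fractions with denominator \<open>\<Prod>T\<close> are \<open>1 / \<Prod>T\<close>
  apart, so at most \<open>2 * \<Prod>T / 2 ^ j\<close> of them have absolute value at most
  \<open>1 / 2 ^ j\<close>, and \<open>dyadic_sum_le\<close> applies.\<close>

lemma sum_same_denominator_le:
  assumes "T \<subseteq> S" "H \<le> 2 ^ J"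
  shows "(\<Sum>r\<in>{r\<in>res - {0}. supp r = T}. frac_weight32 H r) \<le> 24 * sqrt 2 ^ J * real (\<Prod>T)"
proof -
  let ?R = "{r\<in>res - {0}. supp r = T}"
  have Tp: "real (\<Prod>T) > 0" using prod_pos_nat[OF assms(1)] by (simp only: of_nat_0_less_iff)
  have "(\<Sum>r\<in>?R. exp_sum_bound H P r * sqrt (exp_sum_bound H P r) * 1) \<le> 12 * sqrt 2 ^ J * (2 * real (\<Prod>T))"
  proof (rule dyadic_sum_le)
    show "finite ?R" by (rule finite_subset[OF _ finite_res]) auto
    fix j
    let ?A = "{r\<in>?R. 2 ^ j * \<bar>r\<bar> \<le> int P}"
    have fin: "finite ?A" by (rule finite_subset[OF _ finite_res]) auto
    have bd: "real_of_int \<bar>r\<bar> \<le> real P / 2 ^ j" if "r \<in> ?A" for r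
    proof -
      have "real_of_int (2 ^ j * \<bar>r\<bar>) \<le> real_of_int (int P)" using that by (simp only: of_int_le_iff) simp
      then show ?thesis by (simp add: field_simps)
    qed
    have dv: "int p dvd r" if "r \<in> insert 0 ?A" "p \<in> S - T" for r p
      using that by (auto simp: supp_def)
    \<comment> \<open>Adding 0 keeps the set spaced, and its removal afterwards cancels the additive
      1 of \<open>card_spaced_le\<close>.\<close>
    have "real (card (insert 0 ?A)) \<le> 1 + 2 * (real P / 2 ^ j) / (real P / real (\<Prod>T))"
    proof (rule card_spaced_le)
      show "0 < real P / real (\<Prod>T)" using P_pos Tp by (simp del: of_nat_prod P_pos)
      fix a b assume ab: "a \<in> insert 0 ?A" "b \<in> insert 0 ?A" "a \<noteq> b"
      have "real P \<le> real_of_int \<bar>a - b\<bar> * real (\<Prod>T)"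
        using ab dv by (intro P_le_of_dvd_real[OF assms(1)] dvd_diff) auto
      then show "real P / real (\<Prod>T) \<le> \<bar>real_of_int (a - b)\<bar>" using Tp by (simp add: pos_divide_le_eq del: of_nat_prod)
    qed (use bd in auto)
    also have "\<dots> = 1 + 2 * real (\<Prod>T) / 2 ^ j" by simp
    finally have "real (card ?A) \<le> 2 * real (\<Prod>T) / 2 ^ j" using fin by (subst (asm) card_insert_disjoint) (auto simp del: of_nat_prod)
    then show "(\<Sum>r\<in>?A. 1) \<le> 2 * real (\<Prod>T) / 2 ^ j" by (simp del: of_nat_prod)
  qed (use assms Tp in \<open>auto simp: res_def simp del: of_nat_prod\<close>)
  then show ?thesis by (simp add: frac_weight32_def del: of_nat_prod)
qed

section \<open>Completing a fixed first fraction to a triple\<close>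

definition partners :: "int \<Rightarrow> (int \<times> int) set" where
  "partners r1 = {(r2, r3). r2 \<in> res - {0} \<and> r3 \<in> res - {0} \<and> int P dvd r1 + r2 + r3 \<and> den r1 \<le> den r2}"

lemma res_unique: "r \<in> res \<Longrightarrow> r' \<in> res \<Longrightarrow> int P dvd r - r' \<Longrightarrow> r = r'"
  using dvd_imp_le_int[of "r - r'" "int P"] by (fastforce simp: res_def)

lemma finite_partners [simp]: "finite (partners r1)"
  by (rule finite_subset[of _ "res \<times> res"]) (auto simp: partners_def)

text \<open>\<open>r1\<close> and \<open>r3\<close> determine \<open>r2\<close> modulo
  \<open>P\<close>, hence in \<open>res\<close>; sums over partners can be taken over
  \<open>r3\<close> alone.\<close>

lemma inj_on_snd_partners: "inj_on snd (partners r1)"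
proof (rule inj_onI)
  fix a b assume ab: "a \<in> partners r1" "b \<in> partners r1" "snd a = snd b"
  then have "int P dvd (r1 + fst a + snd a) - (r1 + fst b + snd b)" by (intro dvd_diff) (auto simp: partners_def)
  then have "fst a = fst b" using ab by (intro res_unique) (auto simp: partners_def)
  then show "a = b" using ab by (simp add: prod_eq_iff)
qed

lemma phi_Un: "A \<subseteq> S \<Longrightarrow> B \<subseteq> S \<Longrightarrow> A \<inter> B = {} \<Longrightarrow> phi (A \<union> B) = phi A * phi B"
  unfolding phi_def using finite_S finite_subset by (intro prod.union_disjoint) blast+

lemma Prod_Un: "A \<subseteq> S \<Longrightarrow> B \<subseteq> S \<Longrightarrow> A \<inter> B = {} \<Longrightarrow> \<Prod>(A \<union> B) = \<Prod>A * \<Prod>B"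
  using finite_S finite_subset by (intro prod.union_disjoint) blast+

text \<open>Because \<open>P\<close> divides the sum, no prime occurs in exactly one of the three
  denominators. In the notation of the sketch \<open>g\<close>, \<open>y\<close>, \<open>z\<close>,
  \<open>x\<close> are the products over \<open>G\<close>, \<open>Y\<close>,
  \<open>supp r1 - G - Y\<close> and \<open>supp r3 - supp r1\<close>. The two divisibilities say
  that \<open>r1\<close> fixes \<open>r3\<close> modulo the primes of \<open>y\<close> and
  \<open>z\<close>.\<close>

lemma partners_supp:
  assumes "(r2, r3) \<in> partners r1"
    and G: "G = supp r1 \<inter> supp r2 \<inter> supp r3" and Y: "Y = supp r1 - supp r2"
  shows "supp r3 = G \<union> Y \<union> (supp r3 - supp r1)"
    and "supp r2 = G \<union> (supp r1 - G - Y) \<union> (supp r3 - supp r1)"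
    and "\<And>p. p \<in> Y \<Longrightarrow> int p dvd r1 + r3"
    and "\<And>p. p \<in> supp r1 - G - Y \<Longrightarrow> int p dvd r3"
proof -
  have dv: "int p dvd r1 + r2 + r3" if "p \<in> S" for p
    using assms(1) prime_dvd_P[OF that] by (auto simp: partners_def intro: dvd_trans)
  have one: "int p dvd r3" if "p \<in> S" "int p dvd r1" "int p dvd r2" for p
    using dv[OF that(1)] that by (simp add: dvd_add_right_iff)
  have two: "int p dvd r2" if "p \<in> S" "int p dvd r1" "int p dvd r3" for p
    using dv[OF that(1)] that by (simp add: dvd_add_left_iff dvd_add_right_iff)
  have three: "int p dvd r1" if "p \<in> S" "int p dvd r2" "int p dvd r3" for p
    using dv[OF that(1)] that by (simp add: dvd_add_left_iff)
  show "supp r3 = G \<union> Y \<union> (supp r3 - supp r1)"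
    unfolding G Y supp_def using one two three by blast
  show "supp r2 = G \<union> (supp r1 - G - Y) \<union> (supp r3 - supp r1)"
    unfolding G Y supp_def using one two three by blast
  show "int p dvd r1 + r3" if "p \<in> Y" for p
  proof -
    have "p \<in> S" "int p dvd r2" using that by (auto simp: Y supp_def)
    then have "int p dvd (r1 + r2 + r3) - r2" using dv by (intro dvd_diff) auto
    then show ?thesis by simp
  qed
  show "int p dvd r3" if "p \<in> supp r1 - G - Y" for p
    using that by (auto simp: G Y supp_def)
qed

definition quot_prod :: real where
  "quot_prod = (\<Prod>p\<in>S. 1 + real p / (real p - 1)\<^sup>2)"

text \<open>With \<open>r1\<close>, \<open>G\<close>, \<open>Y\<close> fixed, only \<open>x\<close>
  and \<open>r3\<close> vary. \<open>dyadic_sum_le\<close> is applied over \<open>r3\<close>, its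
  density hypothesis being supplied by \<open>spaced_sum_le\<close> with
  \<open>\<delta> = 1 / 2 ^ j\<close> and \<open>n = J\<close>.\<close>

lemma partners_class_le:
  fixes C :: real
  assumes r1: "r1 \<in> res - {0}" and GY: "G \<subseteq> supp r1" "Y \<subseteq> supp r1" "G \<inter> Y = {}" and H: "H \<le> 2 ^ J"
    and C: "C \<ge> 0" "\<And>T. T \<subseteq> S \<Longrightarrow> real (\<Prod>T) \<le> 2 ^ J \<Longrightarrow> real (\<Prod>T) \<le> C * phi T"
  shows "(\<Sum>(r2, r3)\<in>{(r2, r3)\<in>partners r1. (supp r1 \<inter> supp r2 \<inter> supp r3, supp r1 - supp r2) = (G, Y)}.
            1 / phi (supp r2) * (1 / phi (supp r3)) * frac_weight32 H r3)
     \<le> 12 * sqrt 2 ^ J * (12 * real J * C\<^sup>2 + 3 * quot_prod)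
        * (real (\<Prod>G) / ((phi G)\<^sup>2 * phi Y * phi (supp r1 - G - Y)))"
proof -
  let ?C = "{(r2, r3)\<in>partners r1. (supp r1 \<inter> supp r2 \<inter> supp r3, supp r1 - supp r2) = (G, Y)}"
  let ?Z = "supp r1 - G - Y" and ?V = "\<lambda>r. supp r - supp r1"
  let ?R = "snd ` ?C"
  let ?L = "12 * real J * C\<^sup>2 + 3 * quot_prod"
  have subS: "G \<subseteq> S" "Y \<subseteq> S" "?Z \<subseteq> S" "\<And>r. ?V r \<subseteq> S" using GY supp_subset by blast+
  have gpos: "\<Prod>G > 0" "\<Prod>Y > 0" "\<Prod>?Z > 0" "\<And>r. \<Prod>(?V r) > 0" 
    by (rule prod_pos_nat[OF subS(1)] prod_pos_nat[OF subS(2)] prod_pos_nat[OF subS(3)] prod_pos_nat[OF subS(4)])+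
  have "quot_prod \<ge> 0" unfolding quot_prod_def by (intro prod_nonneg) auto
  then have Lnn: "?L \<ge> 0" by simp
  have ph: "phi G > 0" "phi Y > 0" "phi ?Z > 0"
    by (rule phi_pos[OF subS(1)] phi_pos[OF subS(2)] phi_pos[OF subS(3)])+
  have inC: "(r2, r3) \<in> partners r1" "G = supp r1 \<inter> supp r2 \<inter> supp r3" "Y = supp r1 - supp r2" if "(r2, r3) \<in> ?C" for r2 r3
    using that by auto
  have finC: "finite ?C" by (rule finite_subset[OF _ finite_partners[of r1]]) auto
  have inj: "inj_on snd ?C" by (rule inj_on_subset[OF inj_on_snd_partners[of r1]]) auto
  have supps: "supp r3 = G \<union> Y \<union> ?V r3" "supp r2 = G \<union> ?Z \<union> ?V r3"
    and divs: "\<And>p. p \<in> Y \<Longrightarrow> int p dvd r1 + r3" "\<And>p. p \<in> ?Z \<Longrightarrow> int p dvd r3"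
    if "(r2, r3) \<in> ?C" for r2 r3
    using partners_supp[OF inC[OF that]] by blast+
  \<comment> \<open>By multiplicativity the totients of \<open>g x z\<close> and
    \<open>g x y\<close> have a product in which \<open>x\<close> enters only through the square of
    \<open>phi (?V r3)\<close>; everything else is constant on the class.\<close>
  have "(\<Sum>(r2, r3)\<in>?C. 1 / phi (supp r2) * (1 / phi (supp r3)) * frac_weight32 H r3)
      = (\<Sum>b\<in>?C. 1 / ((phi G)\<^sup>2 * phi Y * phi ?Z) * (exp_sum_bound H P (snd b) * sqrt (exp_sum_bound H P (snd b)) * (1 / (phi (?V (snd b)))\<^sup>2)))"
  proof (rule sum.cong[OF refl], clarify)
    fix r2 r3 assume b: "(r2, r3) \<in> partners r1" "G = supp r1 \<inter> supp r2 \<inter> supp r3" "Y = supp r1 - supp r2"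
    then have b': "(r2, r3) \<in> ?C" by auto
    have "phi (supp r3) = phi (G \<union> Y) * phi (?V r3)"
      by (subst supps(1)[OF b'], rule phi_Un) (use subS GY in auto)
    also have "phi (G \<union> Y) = phi G * phi Y" by (rule phi_Un) (use subS GY in auto)
    finally have 3: "phi (supp r3) = phi G * phi Y * phi (?V r3)" .
    have "phi (supp r2) = phi (G \<union> ?Z) * phi (?V r3)"
      by (subst supps(2)[OF b'], rule phi_Un) (use subS GY in auto)
    also have "phi (G \<union> ?Z) = phi G * phi ?Z" by (rule phi_Un) (use subS GY in auto)
    finally have 2: "phi (supp r2) = phi G * phi ?Z * phi (?V r3)" .
    show "1 / phi (supp r2) * (1 / phi (supp r3)) * frac_weight32 H r3
       = 1 / ((phi (supp r1 \<inter> supp r2 \<inter> supp r3))\<^sup>2 * phi (supp r1 - supp r2) * phi (supp r1 - supp r1 \<inter> supp r2 \<inter> supp r3 - (supp r1 - supp r2)))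
          * (exp_sum_bound H P (snd (r2, r3)) * sqrt (exp_sum_bound H P (snd (r2, r3))) * (1 / (phi (?V (snd (r2, r3))))\<^sup>2))"
      unfolding 2 3 frac_weight32_def b(2,3)[symmetric] snd_conv
      by (simp add: power2_eq_square mult_ac)
  qed
  also have "\<dots> = 1 / ((phi G)\<^sup>2 * phi Y * phi ?Z) * (\<Sum>r\<in>?R. exp_sum_bound H P r * sqrt (exp_sum_bound H P r) * (1 / (phi (?V r))\<^sup>2))"
    by (subst sum.reindex[OF inj]) (simp add: sum_distrib_left)
  also have "\<dots> \<le> 1 / ((phi G)\<^sup>2 * phi Y * phi ?Z) * (12 * sqrt 2 ^ J * (real (\<Prod>G) * ?L))"
  proof (intro mult_left_mono dyadic_sum_le)
    show "finite ?R" using finC by simp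
    show "r \<noteq> 0 \<and> \<bar>r\<bar> \<le> int P" if "r \<in> ?R" for r
      using that by (auto simp: partners_def res_def)
    show "0 \<le> real (\<Prod>G) * ?L" using Lnn by (simp del: of_nat_prod)
    fix j assume j: "j \<le> J"
    let ?A = "{r\<in>?R. 2 ^ j * \<bar>r\<bar> \<le> int P}"
    have "(\<Sum>r\<in>?A. 1 / (phi (?V r))\<^sup>2) \<le> (1 / 2 ^ j) * real (\<Prod>G) * (12 * real J * C\<^sup>2 + 3 * (\<Prod>p\<in>S. 1 + real p / (real p - 1)\<^sup>2))"
    proof (rule spaced_sum_le)
      show "finite ?A" using finC by simp
      show "?V r \<subseteq> S" for r by (rule subS)
      show "\<Prod>G \<ge> 1" using gpos(1) by simp
      show "1 \<le> 1 / 2 ^ j * (2::real) ^ J" using j power_increasing[of j J "2::real"] by simp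
      show "real_of_int \<bar>r\<bar> \<le> 1 / 2 ^ j * real P" if "r \<in> ?A" for r
      proof -
        have "real_of_int (2 ^ j * \<bar>r\<bar>) \<le> real_of_int (int P)" using that by (simp only: of_int_le_iff) simp
        then show ?thesis by (simp add: field_simps)
      qed
    next
      fix r assume "r \<in> ?A"
      then obtain r2 where b: "(r2, r) \<in> ?C" by auto
      have "r \<noteq> 0" using inC(1)[OF b] by (auto simp: partners_def)
      then have "real P \<le> real_of_int \<bar>r\<bar> * real (\<Prod>(supp r))"
        by (intro P_le_of_dvd_real supp_subset) (auto simp: supp_def)
      also have "\<Prod>(supp r) = \<Prod>G * \<Prod>Y * \<Prod>(?V r)"
      proof -
        have "\<Prod>(supp r) = \<Prod>(G \<union> Y) * \<Prod>(?V r)"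
          by (subst supps(1)[OF b], rule Prod_Un) (use subS GY in auto)
        also have "\<Prod>(G \<union> Y) = \<Prod>G * \<Prod>Y" by (rule Prod_Un) (use subS GY in auto)
        finally show ?thesis .
      qed
      \<comment> \<open>The condition \<open>den r1 \<le> den r2\<close> reads
        \<open>g y z \<le> g x z\<close>, so \<open>y \<le> x\<close>; the lower bound
        \<open>1 / (g x y)\<close> for the third fraction becomes
        \<open>1 / (g x^2)\<close>.\<close>
      also have "real_of_int \<bar>r\<bar> * real (\<Prod>G * \<Prod>Y * \<Prod>(?V r)) \<le> real_of_int \<bar>r\<bar> * real (\<Prod>G * (\<Prod>(?V r))\<^sup>2)"
      proof (intro mult_left_mono)
        have "den r1 \<le> den r2" using inC(1)[OF b] by (auto simp: partners_def)
        moreover have "den r1 = \<Prod>G * \<Prod>?Z * \<Prod>Y"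
        proof -
          have "supp r1 = G \<union> ?Z \<union> Y" using GY by auto
          then have "den r1 = \<Prod>(G \<union> ?Z) * \<Prod>Y" unfolding den_def
            using Prod_Un[of "G \<union> ?Z" Y] subS GY by (metis Diff_disjoint Int_Un_distrib2 Int_commute Un_empty Un_least)
          also have "\<Prod>(G \<union> ?Z) = \<Prod>G * \<Prod>?Z" by (rule Prod_Un) (use subS GY in auto)
          finally show ?thesis .
        qed
        moreover have "den r2 = \<Prod>G * \<Prod>?Z * \<Prod>(?V r)"
        proof -
          have "den r2 = \<Prod>(G \<union> ?Z) * \<Prod>(?V r)" unfolding den_def
            by (subst supps(2)[OF b], rule Prod_Un) (use subS GY in auto)
          also have "\<Prod>(G \<union> ?Z) = \<Prod>G * \<Prod>?Z" by (rule Prod_Un) (use subS GY in auto)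
          finally show ?thesis .
        qed
        ultimately have "\<Prod>Y \<le> \<Prod>(?V r)" using gpos by simp
        then have "\<Prod>G * \<Prod>Y * \<Prod>(?V r) \<le> \<Prod>G * (\<Prod>(?V r))\<^sup>2" unfolding power2_eq_square mult.assoc by simp
        then show "real (\<Prod>G * \<Prod>Y * \<Prod>(?V r)) \<le> real (\<Prod>G * (\<Prod>(?V r))\<^sup>2)" by (simp only: of_nat_le_iff)
      qed simp
      finally show "real P \<le> real_of_int \<bar>r\<bar> * real (\<Prod>G) * (real (\<Prod>(?V r)))\<^sup>2"
        by (simp only: of_nat_mult of_nat_power mult.assoc)
    next
      fix r r' assume rr: "r \<in> ?A" "r' \<in> ?A" "r \<noteq> r'"
      then obtain r2 r2' where b: "(r2, r) \<in> ?C" "(r2', r') \<in> ?C" by auto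
      let ?U = "?V r \<union> ?V r'"
      \<comment> \<open>The primes of \<open>Y\<close> and \<open>?Z\<close> divide the difference
        because \<open>r1\<close> prescribes both residues, so its denominator is free of
        \<open>y\<close>.\<close>
      have "real P \<le> real_of_int \<bar>r - r'\<bar> * real (\<Prod>(G \<union> ?U))"
      proof (rule P_le_of_dvd_real)
        show "G \<union> ?U \<subseteq> S" using subS by blast
        show "r - r' \<noteq> 0" using rr by simp
        fix p assume p: "p \<in> S - (G \<union> ?U)"
        consider "p \<in> Y" | "p \<in> ?Z" | "p \<notin> supp r1" using p by blast
        then show "int p dvd r - r'"
        proof cases
          case 1
          then have "int p dvd (r1 + r) - (r1 + r')" using divs(1)[OF b(1)] divs(1)[OF b(2)] by (intro dvd_diff)
          then show ?thesis by simp
        next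
          case 2
          then show ?thesis using divs(2)[OF b(1)] divs(2)[OF b(2)] by (intro dvd_diff)
        next
          case 3
          then have "p \<notin> supp r" "p \<notin> supp r'" using p by auto
          then show ?thesis using p by (intro dvd_diff) (auto simp: supp_def)
        qed
      qed
      also have "\<Prod>(G \<union> ?U) = \<Prod>G * \<Prod>?U" by (rule Prod_Un) (use subS GY in auto)
      finally show "real P \<le> real_of_int \<bar>r - r'\<bar> * real (\<Prod>G) * real (\<Prod>?U)"
        by (simp only: of_nat_mult mult.assoc)
    qed (use C in auto)
    then show "(\<Sum>r\<in>?A. 1 / (phi (?V r))\<^sup>2) \<le> real (\<Prod>G) * ?L / 2 ^ j"
      by (simp add: quot_prod_def del: of_nat_prod)
  qed (use ph H in auto)
  finally show ?thesis by (simp add: mult_ac del: of_nat_prod)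
qed

end

section \<open>Summation over all triples and the moment bounds\<close>

context prime_set
begin

definition cube_prod :: real where
  "cube_prod = (\<Prod>p\<in>S. 1 + (real p)\<^sup>2 / (real p - 1) ^ 3)"

definition split_pairs :: "nat set \<Rightarrow> (nat set \<times> nat set) set" where
  "split_pairs T = {(G, Y). G \<subseteq> T \<and> Y \<subseteq> T \<and> G \<inter> Y = {}}"

lemma finite_split_pairs: "finite T \<Longrightarrow> finite (split_pairs T)"
  by (rule finite_subset[of _ "Pow T \<times> Pow T"]) (auto simp: split_pairs_def)

lemma quot_prod_nonneg: "quot_prod \<ge> 0"
  unfolding quot_prod_def by (intro prod_nonneg) auto

lemma sum_partners_le:
  fixes C :: real
  assumes r1: "r1 \<in> res - {0}" and H: "H \<le> 2 ^ J"
    and C: "C \<ge> 0" "\<And>T. T \<subseteq> S \<Longrightarrow> real (\<Prod>T) \<le> 2 ^ J \<Longrightarrow> real (\<Prod>T) \<le> C * phi T"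
  shows "(\<Sum>(r2, r3)\<in>partners r1. 1 / phi (supp r2) * (1 / phi (supp r3)) * frac_weight32 H r3)
     \<le> 12 * sqrt 2 ^ J * (12 * real J * C\<^sup>2 + 3 * quot_prod)
        * (\<Sum>(G, Y)\<in>split_pairs (supp r1). real (\<Prod>G) / ((phi G)\<^sup>2 * phi Y * phi (supp r1 - G - Y)))"
proof -
  let ?l = "\<lambda>(r2, r3). (supp r1 \<inter> supp r2 \<inter> supp r3, supp r1 - supp r2)"
  let ?f = "\<lambda>(r2, r3). 1 / phi (supp r2) * (1 / phi (supp r3)) * frac_weight32 H r3"
  have "(\<Sum>b\<in>partners r1. ?f b) = (\<Sum>c\<in>split_pairs (supp r1). \<Sum>b\<in>{b\<in>partners r1. ?l b = c}. ?f b)"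
    by (intro sum_by_label finite_split_pairs finite_partners finite_supp) (auto simp: split_pairs_def)
  also have "\<dots> \<le> (\<Sum>c\<in>split_pairs (supp r1). 12 * sqrt 2 ^ J * (12 * real J * C\<^sup>2 + 3 * quot_prod)
        * (\<lambda>(G, Y). real (\<Prod>G) / ((phi G)\<^sup>2 * phi Y * phi (supp r1 - G - Y))) c)"
  proof (rule sum_mono)
    fix c assume "c \<in> split_pairs (supp r1)"
    then obtain G Y where c: "c = (G, Y)" and GY: "G \<subseteq> supp r1" "Y \<subseteq> supp r1" "G \<inter> Y = {}"
      by (auto simp: split_pairs_def)
    have "{b\<in>partners r1. ?l b = c}
       = {(r2, r3)\<in>partners r1. (supp r1 \<inter> supp r2 \<inter> supp r3, supp r1 - supp r2) = (G, Y)}"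
      unfolding c by auto
    then show "(\<Sum>b\<in>{b\<in>partners r1. ?l b = c}. ?f b) \<le> 12 * sqrt 2 ^ J * (12 * real J * C\<^sup>2 + 3 * quot_prod)
        * (\<lambda>(G, Y). real (\<Prod>G) / ((phi G)\<^sup>2 * phi Y * phi (supp r1 - G - Y))) c"
      unfolding c prod.case using partners_class_le[OF r1 GY H C] by (simp only:)
  qed
  finally show ?thesis by (simp only: sum_distrib_left)
qed

text \<open>The sets \<open>G\<close>, \<open>Y\<close>, \<open>Z = T - G - Y\<close> partition
  \<open>T\<close>, so each term factors into \<open>g^2 / phi G ^ 3\<close>,
  \<open>y / phi Y ^ 2\<close> and \<open>z / phi Z ^ 2\<close>. Forgetting that the three sets are
  disjoint bounds the sum by a product of three sums over all subsets of \<open>S\<close>, which are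
  Euler products.\<close>

lemma sum_split_pairs_le:
  "(\<Sum>T\<in>Pow S. real (\<Prod>T) / phi T * (\<Sum>(G, Y)\<in>split_pairs T. real (\<Prod>G) / ((phi G)\<^sup>2 * phi Y * phi (T - G - Y))))
     \<le> cube_prod * quot_prod\<^sup>2"
proof -
  let ?a = "\<lambda>T. (real (\<Prod>T))\<^sup>2 / phi T ^ 3" and ?b = "\<lambda>T. real (\<Prod>T) / (phi T)\<^sup>2"
  let ?h = "\<lambda>(T, G, Y). (G, Y, T - G - Y)"
  let ?g = "\<lambda>(G, Y, Z). ?a G * ?b Y * ?b Z"
  have nn: "?a T \<ge> 0" "?b T \<ge> 0" if "T \<subseteq> S" for T
    using phi_pos[OF that] by (auto simp del: of_nat_prod)
  have fin: "finite T" if "T \<in> Pow S" for T using that finite_S finite_subset by blast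
  have "(\<Sum>T\<in>Pow S. real (\<Prod>T) / phi T * (\<Sum>(G, Y)\<in>split_pairs T. real (\<Prod>G) / ((phi G)\<^sup>2 * phi Y * phi (T - G - Y))))
     = (\<Sum>(T, G, Y)\<in>Sigma (Pow S) split_pairs. real (\<Prod>T) / phi T * (real (\<Prod>G) / ((phi G)\<^sup>2 * phi Y * phi (T - G - Y))))"
    unfolding sum_distrib_left
    by (subst sum.Sigma[symmetric]) (auto simp: case_prod_unfold intro: finite_split_pairs fin simp del: of_nat_prod)
  also have "\<dots> = (\<Sum>t\<in>Sigma (Pow S) split_pairs. ?g (?h t))"
  proof (rule sum.cong[OF refl])
    fix t assume "t \<in> Sigma (Pow S) split_pairs"
    then obtain T G Y where t: "t = (T, G, Y)" "T \<subseteq> S" "G \<subseteq> T" "Y \<subseteq> T" "G \<inter> Y = {}"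
      by (auto simp: split_pairs_def)
    let ?Z = "T - G - Y"
    have T: "T = (G \<union> Y) \<union> ?Z" using t by auto
    have sub: "G \<subseteq> S" "Y \<subseteq> S" "?Z \<subseteq> S" "G \<union> Y \<subseteq> S" and disj: "(G \<union> Y) \<inter> ?Z = {}" using t by auto
    have "\<Prod>T = \<Prod>(G \<union> Y) * \<Prod>?Z" by (subst T, rule Prod_Un[OF sub(4,3) disj])
    also have "\<Prod>(G \<union> Y) = \<Prod>G * \<Prod>Y" by (rule Prod_Un[OF sub(1,2) t(5)])
    finally have P: "real (\<Prod>T) = real (\<Prod>G) * real (\<Prod>Y) * real (\<Prod>?Z)" by (simp only: of_nat_mult)
    have "phi T = phi (G \<union> Y) * phi ?Z" by (subst T, rule phi_Un[OF sub(4,3) disj])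
    also have "phi (G \<union> Y) = phi G * phi Y" by (rule phi_Un[OF sub(1,2) t(5)])
    finally have ph: "phi T = phi G * phi Y * phi ?Z" .
    show "(case t of (T, G, Y) \<Rightarrow> real (\<Prod>T) / phi T * (real (\<Prod>G) / ((phi G)\<^sup>2 * phi Y * phi (T - G - Y)))) = ?g (?h t)"
      unfolding t(1) prod.case P ph by (simp add: power2_eq_square power3_eq_cube mult_ac del: of_nat_prod)
  qed
  also have "\<dots> = (\<Sum>t\<in>?h ` Sigma (Pow S) split_pairs. ?g t)"
  proof (subst sum.reindex)
    show "inj_on ?h (Sigma (Pow S) split_pairs)"
    proof (rule inj_onI)
      fix s t assume st: "s \<in> Sigma (Pow S) split_pairs" "t \<in> Sigma (Pow S) split_pairs" "?h s = ?h t"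
      obtain T G Y where s: "s = (T, G, Y)" by (cases s)
      obtain T' G' Y' where t: "t = (T', G', Y')" by (cases t)
      have "T = G \<union> Y \<union> (T - G - Y)" "T' = G' \<union> Y' \<union> (T' - G' - Y')"
        using st(1,2) by (auto simp: s t split_pairs_def)
      then show "s = t" using st(3) unfolding s t prod.case prod.inject by metis
    qed
  qed simp
  also have "\<dots> \<le> (\<Sum>t\<in>Pow S \<times> Pow S \<times> Pow S. ?g t)"
  proof (rule sum_mono2)
    show "?h ` Sigma (Pow S) split_pairs \<subseteq> Pow S \<times> Pow S \<times> Pow S"
      unfolding split_pairs_def by (clarsimp; blast)
    show "0 \<le> ?g t" if ts: "t \<in> Pow S \<times> Pow S \<times> Pow S - ?h ` Sigma (Pow S) split_pairs" for t
    proof -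
      obtain G Y Z where t: "t = (G, Y, Z)" "G \<subseteq> S" "Y \<subseteq> S" "Z \<subseteq> S" using ts by blast
      show ?thesis unfolding t(1) prod.case by (intro mult_nonneg_nonneg nn t(2-4))
    qed
  qed simp
  also have "\<dots> = (\<Sum>G\<in>Pow S. ?a G) * ((\<Sum>Y\<in>Pow S. ?b Y) * (\<Sum>Z\<in>Pow S. ?b Z))"
    unfolding sum_product sum.cartesian_product by (simp add: case_prod_unfold sum_distrib_left mult.assoc sum.cartesian_product del: of_nat_prod)
  also have "\<dots> = cube_prod * quot_prod\<^sup>2"
    unfolding sum_Pow_quotient[OF finite_S] sum_Pow_quotient_cube[OF finite_S] cube_prod_def quot_prod_def
    by (simp add: power2_eq_square)
  finally show ?thesis .
qed

lemma sqrt2_power_sq: "sqrt 2 ^ J * sqrt 2 ^ J = 2 ^ J"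
  by (simp flip: power_mult_distrib)

text \<open>The bound of \<open>sum_partners_le\<close> depends on \<open>r1\<close> only through
  \<open>supp r1\<close>, so the first fractions are grouped by denominator and summed by
  \<open>sum_same_denominator_le\<close>. The two factors \<open>sqrt 2 ^ J\<close> combine to
  \<open>2 ^ J\<close>, and 288 is 12 * 24.\<close>

lemma sum_ordered_term_le:
  fixes C :: real
  assumes H: "H \<le> 2 ^ J"
    and C: "C \<ge> 0" "\<And>T. T \<subseteq> S \<Longrightarrow> real (\<Prod>T) \<le> 2 ^ J \<Longrightarrow> real (\<Prod>T) \<le> C * phi T"
  shows "(\<Sum>t\<in>triples. ordered_term H t) \<le> 288 * 2 ^ J * (12 * real J * C\<^sup>2 + 3 * quot_prod) * (cube_prod * quot_prod\<^sup>2)"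
proof -
  let ?W = "sqrt 2 ^ J" and ?L = "12 * real J * C\<^sup>2 + 3 * quot_prod"
  let ?Q = "\<lambda>T. \<Sum>(G, Y)\<in>split_pairs T. real (\<Prod>G) / ((phi G)\<^sup>2 * phi Y * phi (T - G - Y))"
  have L: "?L \<ge> 0" using quot_prod_nonneg by simp
  have Q: "?Q T \<ge> 0" if TS: "T \<subseteq> S" for T
  proof (rule sum_nonneg)
    fix c assume "c \<in> split_pairs T"
    then obtain G Y where c: "c = (G, Y)" "G \<subseteq> T" "Y \<subseteq> T" by (auto simp: split_pairs_def)
    have sub: "Y \<subseteq> S" "T - G - Y \<subseteq> S" using c TS by blast+
    show "0 \<le> (case c of (G, Y) \<Rightarrow> real (\<Prod>G) / ((phi G)\<^sup>2 * phi Y * phi (T - G - Y)))"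
      unfolding c(1) prod.case using phi_pos[OF sub(1)] phi_pos[OF sub(2)]
      by (intro divide_nonneg_nonneg mult_nonneg_nonneg) (auto simp del: of_nat_prod)
  qed
  let ?K = "frac_weight32 H"
  have K: "?K r \<ge> 0" for r by (simp add: frac_weight32_def)
  \<comment> \<open>The triples left out have \<open>den r1 > den r2\<close>, where
    \<open>ordered_term\<close> is 0 by definition.\<close>
  have "(\<Sum>t\<in>triples. ordered_term H t) = (\<Sum>t\<in>Sigma (res - {0}) partners. ordered_term H t)"
    by (rule sum.mono_neutral_right[OF finite_triples]) (auto simp: triples_def partners_def ordered_term_def split: if_split_asm)
  also have "\<dots> = (\<Sum>r1\<in>res - {0}. \<Sum>b\<in>partners r1. ordered_term H (r1, b))"
    by (subst sum.Sigma) auto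
  also have "\<dots> = (\<Sum>r1\<in>res - {0}. 1 / phi (supp r1) * ?K r1 *
      (\<Sum>(r2, r3)\<in>partners r1. 1 / phi (supp r2) * (1 / phi (supp r3)) * ?K r3))"
    unfolding sum_distrib_left
    by (intro sum.cong refl) (auto simp: ordered_term_def partners_def)
  also have "\<dots> \<le> (\<Sum>r1\<in>res - {0}. 1 / phi (supp r1) * ?K r1 * (12 * ?W * ?L * ?Q (supp r1)))"
    using phi_supp_pos K by (intro sum_mono mult_left_mono sum_partners_le H C) (auto simp: less_imp_le)
  also have "\<dots> = (\<Sum>T\<in>Pow S. \<Sum>r1\<in>{r\<in>res - {0}. supp r = T}. 1 / phi (supp r1) * ?K r1 * (12 * ?W * ?L * ?Q (supp r1)))"
    using supp_subset by (intro sum_by_label) auto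
  also have "\<dots> = (\<Sum>T\<in>Pow S. 1 / phi T * (12 * ?W * ?L * ?Q T) * (\<Sum>r1\<in>{r\<in>res - {0}. supp r = T}. ?K r1))"
  proof (rule sum.cong[OF refl])
    fix T
    have "(\<Sum>r1\<in>{r\<in>res - {0}. supp r = T}. 1 / phi (supp r1) * ?K r1 * (12 * ?W * ?L * ?Q (supp r1)))
       = (\<Sum>r1\<in>{r\<in>res - {0}. supp r = T}. 1 / phi T * (12 * ?W * ?L * ?Q T) * ?K r1)"
    proof (rule sum.cong[OF refl])
      fix r1 assume "r1 \<in> {r\<in>res - {0}. supp r = T}"
      then have r1: "supp r1 = T" by simp
      show "1 / phi (supp r1) * ?K r1 * (12 * ?W * ?L * ?Q (supp r1)) = 1 / phi T * (12 * ?W * ?L * ?Q T) * ?K r1"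
        unfolding r1 by (simp only: mult_ac)
    qed
    then show "(\<Sum>r1\<in>{r\<in>res - {0}. supp r = T}. 1 / phi (supp r1) * ?K r1 * (12 * ?W * ?L * ?Q (supp r1)))
       = 1 / phi T * (12 * ?W * ?L * ?Q T) * (\<Sum>r1\<in>{r\<in>res - {0}. supp r = T}. ?K r1)"
      by (simp only: sum_distrib_left)
  qed
  also have "\<dots> \<le> (\<Sum>T\<in>Pow S. 1 / phi T * (12 * ?W * ?L * ?Q T) * (24 * ?W * real (\<Prod>T)))"
  proof (rule sum_mono)
    fix T assume "T \<in> Pow S"
    then have T: "T \<subseteq> S" by simp
    show "1 / phi T * (12 * ?W * ?L * ?Q T) * (\<Sum>r1\<in>{r\<in>res - {0}. supp r = T}. ?K r1)
      \<le> 1 / phi T * (12 * ?W * ?L * ?Q T) * (24 * ?W * real (\<Prod>T))"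
      using L Q[OF T] phi_pos[OF T]
      by (intro mult_left_mono sum_same_denominator_le[OF T H] mult_nonneg_nonneg) auto
  qed
  also have "\<dots> = (\<Sum>T\<in>Pow S. 288 * (?W * ?W) * ?L * (real (\<Prod>T) / phi T * ?Q T))"
    by (intro sum.cong refl) (simp add: mult_ac del: of_nat_prod)
  also have "\<dots> = 288 * 2 ^ J * ?L * (\<Sum>T\<in>Pow S. real (\<Prod>T) / phi T * ?Q T)"
    unfolding sqrt2_power_sq sum_distrib_left ..
  also have "\<dots> \<le> 288 * 2 ^ J * ?L * (cube_prod * quot_prod\<^sup>2)"
    using L by (intro mult_left_mono sum_split_pairs_le) auto
  finally show ?thesis .
qed

lemma norm_s_hat_le_frac_weight:
  assumes "r \<in> res" "r \<noteq> 0"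
  shows "norm (s_hat {1..int H} r) \<le> frac_weight H r"
  using norm_s_hat_le[OF assms, of H] by (simp add: frac_weight_def exp_sum_bound_def)

lemma mean_cube_bound:
  fixes C :: real
  assumes H: "H \<le> 2 ^ J"
    and C: "C \<ge> 0" "\<And>T. T \<subseteq> S \<Longrightarrow> real (\<Prod>T) \<le> 2 ^ J \<Longrightarrow> real (\<Prod>T) \<le> C * phi T"
  shows "\<bar>mean (\<lambda>n. short_sum {1..int H} n ^ 3)\<bar>
     \<le> 3456 * 2 ^ J * (12 * real J * C\<^sup>2 + 3 * quot_prod) * (cube_prod * quot_prod\<^sup>2)"
proof -
  let ?u = "\<lambda>r. norm (s_hat {1..int H} r)"
  have "\<bar>mean (\<lambda>n. short_sum {1..int H} n ^ 3)\<bar>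
     \<le> (\<Sum>(r1, r2, r3)\<in>{(r1, r2, r3)\<in>res \<times> res \<times> res. int P dvd r1 + r2 + r3}. ?u r1 * ?u r2 * ?u r3)"
    by (rule abs_mean_cube_le)
  \<comment> \<open>Triples with a zero frequency contribute nothing, because \<open>X\<close> has
    mean 0 (\<open>s_hat_0\<close>).\<close>
  also have "\<dots> = (\<Sum>(r1, r2, r3)\<in>triples. ?u r1 * ?u r2 * ?u r3)"
    by (rule sum.mono_neutral_right) (auto simp: triples_def intro: finite_subset[of _ "res \<times> res \<times> res"])
  also have "\<dots> \<le> (\<Sum>(r1, r2, r3)\<in>triples. frac_weight H r1 * frac_weight H r2 * frac_weight H r3)"
  proof (rule sum_mono)
    fix t assume "t \<in> triples"
    then obtain r1 r2 r3 where t: "t = (r1, r2, r3)" and r: "r1 \<in> res" "r1 \<noteq> 0" "r2 \<in> res" "r2 \<noteq> 0" "r3 \<in> res" "r3 \<noteq> 0"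
      by (auto simp: triples_def)
    note le = norm_s_hat_le_frac_weight[OF r(1,2), of H] norm_s_hat_le_frac_weight[OF r(3,4), of H]
      norm_s_hat_le_frac_weight[OF r(5,6), of H]
    have nn: "frac_weight H r \<ge> 0" for r using phi_supp_pos[of r] by (simp add: frac_weight_def)
    show "(case t of (r1, r2, r3) \<Rightarrow> ?u r1 * ?u r2 * ?u r3)
       \<le> (case t of (r1, r2, r3) \<Rightarrow> frac_weight H r1 * frac_weight H r2 * frac_weight H r3)"
      unfolding t prod.case by (intro mult_mono le mult_nonneg_nonneg nn) auto
  qed
  also have "\<dots> \<le> 12 * (\<Sum>t\<in>triples. ordered_term H t)" by (rule sum_triples_le)
  also have "\<dots> \<le> 12 * (288 * 2 ^ J * (12 * real J * C\<^sup>2 + 3 * quot_prod) * (cube_prod * quot_prod\<^sup>2))"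
    by (intro mult_left_mono sum_ordered_term_le[OF H C]) auto
  finally show ?thesis by simp
qed

text \<open>The congruence makes each frequency determine the other, so the inequality of arithmetic
  and geometric means reduces the sum to squares of single coefficients. There
  \<open>F^2 \<le> sqrt 2 ^ J * F^(3/2)\<close> brings in \<open>frac_weight32\<close>, and
  \<open>sum_same_denominator_le\<close> is reused.\<close>

lemma mean_square_bound:
  assumes H: "H \<le> 2 ^ J"
  shows "\<bar>mean (\<lambda>n. (short_sum {1..int H} n)\<^sup>2)\<bar> \<le> 24 * 2 ^ J * quot_prod"
proof -
  let ?u = "\<lambda>r. norm (s_hat {1..int H} r)"
  let ?A = "{(r1, r2)\<in>res \<times> res. int P dvd r1 + r2}"
  let ?W = "sqrt 2 ^ J"
  have fin: "finite ?A" by (rule finite_subset[of _ "res \<times> res"]) auto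
  have inj: "inj_on fst ?A" "inj_on snd ?A"
  proof -
    have "a = b" if "a \<in> ?A" "b \<in> ?A" "fst a = fst b \<or> snd a = snd b" for a b
    proof -
      have "int P dvd (fst a + snd a) - (fst b + snd b)" using that by (intro dvd_diff) auto
      then have "int P dvd fst a - fst b" if "snd a = snd b" using that by (simp add: algebra_simps)
      moreover have "int P dvd snd a - snd b" if "fst a = fst b"
        using that \<open>int P dvd (fst a + snd a) - (fst b + snd b)\<close> by (simp add: algebra_simps)
      ultimately show ?thesis using that res_unique[of "fst a" "fst b"] res_unique[of "snd a" "snd b"]
        by (auto simp: prod_eq_iff)
    qed
    then show "inj_on fst ?A" "inj_on snd ?A" by (auto intro!: inj_onI)
  qed
  have "\<bar>mean (\<lambda>n. (short_sum {1..int H} n)\<^sup>2)\<bar> \<le> (\<Sum>(r1, r2)\<in>?A. ?u r1 * ?u r2)"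
    by (rule abs_mean_square_le)
  also have "\<dots> \<le> (\<Sum>b\<in>?A. ((?u (fst b))\<^sup>2 + (?u (snd b))\<^sup>2) / 2)"
  proof (rule sum_mono)
    fix b assume "b \<in> ?A"
    show "(case b of (r1, r2) \<Rightarrow> ?u r1 * ?u r2) \<le> ((?u (fst b))\<^sup>2 + (?u (snd b))\<^sup>2) / 2"
      using sum_squares_bound[of "?u (fst b)" "?u (snd b)"] by (simp add: case_prod_unfold)
  qed
  also have "\<dots> = ((\<Sum>b\<in>?A. (?u (fst b))\<^sup>2) + (\<Sum>b\<in>?A. (?u (snd b))\<^sup>2)) / 2"
    by (simp only: sum_divide_distrib[symmetric] sum.distrib)
  also have "(\<Sum>b\<in>?A. (?u (fst b))\<^sup>2) = (\<Sum>r\<in>fst ` ?A. (?u r)\<^sup>2)" by (simp only: sum.reindex[OF inj(1)] o_def)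
  also have "(\<Sum>b\<in>?A. (?u (snd b))\<^sup>2) = (\<Sum>r\<in>snd ` ?A. (?u r)\<^sup>2)" by (simp only: sum.reindex[OF inj(2)] o_def)
  also have "((\<Sum>r\<in>fst ` ?A. (?u r)\<^sup>2) + (\<Sum>r\<in>snd ` ?A. (?u r)\<^sup>2)) / 2 \<le> ((\<Sum>r\<in>res. (?u r)\<^sup>2) + (\<Sum>r\<in>res. (?u r)\<^sup>2)) / 2"
    by (intro divide_right_mono add_mono sum_mono2) auto
  also have "\<dots> = (\<Sum>r\<in>res. (?u r)\<^sup>2)" by simp
  also have "\<dots> = (\<Sum>r\<in>res - {0}. (?u r)\<^sup>2)" by (rule sum.mono_neutral_right) auto
  also have "\<dots> \<le> (\<Sum>r\<in>res - {0}. ?W * (1 / (phi (supp r))\<^sup>2 * frac_weight32 H r))"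
  proof (rule sum_mono)
    fix r assume r: "r \<in> res - {0}"
    let ?F = "exp_sum_bound H P r"
    have Fle: "sqrt ?F \<le> ?W"
    proof -
      have "real H \<le> 2 ^ J" using H by (metis of_nat_le_iff of_nat_numeral of_nat_power)
      moreover have "?F \<le> real H" by (simp add: exp_sum_bound_def)
      ultimately have "?F \<le> 2 ^ J" by linarith
      then have "sqrt ?F \<le> sqrt (2 ^ J)" by simp
      then show ?thesis by (simp add: real_sqrt_power)
    qed
    have "(?u r)\<^sup>2 \<le> (frac_weight H r)\<^sup>2"
      using norm_s_hat_le_frac_weight[of r H] r by (intro power_mono) auto
    also have "\<dots> = 1 / (phi (supp r))\<^sup>2 * (?F * ?F)"
      by (simp add: frac_weight_def power2_eq_square)
    also have "?F * ?F = ?F * sqrt ?F * sqrt ?F" by simp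
    also have "1 / (phi (supp r))\<^sup>2 * (?F * sqrt ?F * sqrt ?F) \<le> 1 / (phi (supp r))\<^sup>2 * (?F * sqrt ?F * ?W)"
      using Fle by (intro mult_left_mono) auto
    finally show "(?u r)\<^sup>2 \<le> ?W * (1 / (phi (supp r))\<^sup>2 * frac_weight32 H r)"
      by (simp add: frac_weight32_def mult_ac)
  qed
  also have "\<dots> = ?W * (\<Sum>r\<in>res - {0}. 1 / (phi (supp r))\<^sup>2 * frac_weight32 H r)"
    by (simp only: sum_distrib_left)
  also have "(\<Sum>r\<in>res - {0}. 1 / (phi (supp r))\<^sup>2 * frac_weight32 H r)
     = (\<Sum>T\<in>Pow S. \<Sum>r\<in>{r\<in>res - {0}. supp r = T}. 1 / (phi (supp r))\<^sup>2 * frac_weight32 H r)"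
    using supp_subset by (intro sum_by_label) auto
  also have "\<dots> = (\<Sum>T\<in>Pow S. 1 / (phi T)\<^sup>2 * (\<Sum>r\<in>{r\<in>res - {0}. supp r = T}. frac_weight32 H r))"
    unfolding sum_distrib_left by (intro sum.cong refl) simp
  also have "\<dots> \<le> (\<Sum>T\<in>Pow S. 1 / (phi T)\<^sup>2 * (24 * ?W * real (\<Prod>T)))"
    by (intro sum_mono mult_left_mono sum_same_denominator_le H) auto
  also have "\<dots> = 24 * ?W * (\<Sum>T\<in>Pow S. real (\<Prod>T) / (phi T)\<^sup>2)"
    unfolding sum_distrib_left by (intro sum.cong refl) (simp add: mult_ac del: of_nat_prod)
  also have "\<dots> = 24 * ?W * quot_prod" by (simp only: sum_Pow_quotient[OF finite_S] quot_prod_def)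
  also have "?W * (24 * ?W * quot_prod) = 24 * 2 ^ J * quot_prod"
    using sqrt2_power_sq[of J] by (simp add: mult_ac)
  finally show ?thesis by (simp add: mult_left_mono)
qed

end

section \<open>Bounds for the arithmetic factors\<close>

lemma ln_2_ge_half: "ln 2 \<ge> (1 / 2 :: real)"
  using ln_le_minus_one[of "1 / 2 :: real"] by (simp add: ln_div)

lemma ln_nat_ge: "N \<ge> 2 \<Longrightarrow> ln (real N) \<ge> 1 / 2"
proof -
  assume "N \<ge> 2"
  then have "ln 2 \<le> ln (real N)" by simp
  then show ?thesis using ln_2_ge_half by linarith
qed

text \<open>The exponent is 2 + 24: 2 from \<open>prod_primes_upto_le\<close>, 24 from the sum of
  \<open>24 / p^2\<close>. The 3 comes from \<open>1 + ln N \<le> 3 * ln N\<close>, valid for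
  \<open>N \<ge> 2\<close>.\<close>

definition mertens_const :: real where
  "mertens_const = 3 * exp 26"

text \<open>The hypothesis compares \<open>f\<close> with \<open>1 + 1 / p\<close> up to a factor
  whose product over all primes converges. One shape serves the three Euler products of
  \<open>euler_factor_estimates\<close>.\<close>

lemma prod_primes_upto_le_ln:
  assumes N: "N \<ge> 2"
    and f: "\<And>p. p \<in> primes_upto N \<Longrightarrow> 0 \<le> f p \<and> f p \<le> (1 + 1 / real p) * (1 + 24 / (real p)\<^sup>2)"
  shows "(\<Prod>p\<in>primes_upto N. f p) \<le> mertens_const * ln (real N)"
proof -
  have "(\<Prod>p\<in>primes_upto N. f p) \<le> (\<Prod>p\<in>primes_upto N. (1 + 1 / real p) * exp (24 * (1 / (real p)\<^sup>2)))"
  proof (rule prod_mono, safe)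
    fix p assume p: "p \<in> primes_upto N"
    show "0 \<le> f p" using f[OF p] by simp
    have "f p \<le> (1 + 1 / real p) * (1 + 24 / (real p)\<^sup>2)" using f[OF p] by simp
    also have "\<dots> \<le> (1 + 1 / real p) * exp (24 * (1 / (real p)\<^sup>2))"
      using exp_ge_add_one_self[of "24 * (1 / (real p)\<^sup>2)"] by (intro mult_left_mono) auto
    finally show "f p \<le> (1 + 1 / real p) * exp (24 * (1 / (real p)\<^sup>2))" .
  qed
  also have "\<dots> = (\<Prod>p\<in>primes_upto N. 1 + 1 / real p) * exp (24 * (\<Sum>p\<in>primes_upto N. 1 / (real p)\<^sup>2))"
    by (simp add: prod.distrib exp_sum sum_distrib_left)
  also have "\<dots> \<le> (exp 2 * (3 * ln (real N))) * exp 24"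
  proof (intro mult_mono)
    have "1 + ln (real N) \<le> 3 * ln (real N)" using ln_nat_ge[OF N] by linarith
    then have "exp 2 * (1 + ln (real N)) \<le> exp 2 * (3 * ln (real N))" by (intro mult_left_mono) auto
    then show "(\<Prod>p\<in>primes_upto N. 1 + 1 / real p) \<le> exp 2 * (3 * ln (real N))"
      using prod_primes_upto_le[OF N] by linarith
    have "(\<Sum>p\<in>primes_upto N. 1 / (real p)\<^sup>2) \<le> (\<Sum>n\<in>{1<..N}. 1 / (real n)\<^sup>2)"
      by (rule sum_mono2) (auto simp: primes_upto_def dest: prime_gt_1_nat)
    also have "\<dots> \<le> 1 / real 1" by (rule sum_inverse_squares_tail) simp
    finally show "exp (24 * (\<Sum>p\<in>primes_upto N. 1 / (real p)\<^sup>2)) \<le> exp 24" by simp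
    show "0 \<le> exp 2 * (3 * ln (real N))" using ln_nat_ge[OF N] by simp
  qed simp
  also have "\<dots> = 3 * (exp 2 * exp 24) * ln (real N)" by simp
  also have "exp 2 * exp 24 = exp (26::real)" by (simp flip: exp_add)
  finally show ?thesis by (simp add: mertens_const_def)
qed

text \<open>With \<open>t = 1 / x \<le> 1 / 2\<close> the left sides are \<open>1 / (1 - t)\<close>,
  \<open>1 + t / (1 - t)^2\<close> and \<open>1 + t / (1 - t)^3\<close>. Inserting
  \<open>1 / (1 - t) \<le> 1 + 2 * t\<close> bounds each by \<open>1 + t + 24 * t^2\<close>.\<close>

lemma euler_factor_estimates:
  fixes x :: real
  assumes "x \<ge> 2"
  shows "x / (x - 1) \<le> (1 + 1 / x) * (1 + 24 / x\<^sup>2)"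
    and "1 + x / (x - 1)\<^sup>2 \<le> (1 + 1 / x) * (1 + 24 / x\<^sup>2)"
    and "1 + x\<^sup>2 / (x - 1) ^ 3 \<le> (1 + 1 / x) * (1 + 24 / x\<^sup>2)"
proof -
  define t where "t = 1 / x"
  have t: "0 < t" "t \<le> 1 / 2" using assms by (auto simp: t_def divide_simps)
  have u: "1 - t \<ge> 1 / 2" "1 - t > 0" using t by auto
  have x: "x = 1 / t" "x - 1 = (1 - t) / t" using assms by (auto simp: t_def divide_simps)
  have rhs: "1 + t + 24 * t\<^sup>2 \<le> (1 + 1 / x) * (1 + 24 / x\<^sup>2)"
    using t unfolding x by (simp add: field_simps power2_eq_square)
  have q: "1 / (1 - t) \<le> 1 + 2 * t"
    using t by (simp add: divide_simps) (simp add: algebra_simps power2_eq_square)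
  have q0: "0 \<le> 1 / (1 - t)" using u by simp
  have t2: "t * t \<le> t * (1 / 2)" using t by (intro mult_left_mono) auto
  have t2': "0 \<le> t * t" by simp
  have s2: "(1 / (1 - t)) ^ 2 \<le> (1 + 2 * t) ^ 2" using q q0 by (rule power_mono)
  have s3: "(1 / (1 - t)) ^ 3 \<le> (1 + 2 * t) ^ 3" using q q0 by (rule power_mono)
  have "x / (x - 1) = 1 / (1 - t)" using t unfolding x by (simp add: divide_simps)
  also have "\<dots> = 1 + t * (1 / (1 - t))" using u by (simp add: field_simps)
  also have "\<dots> \<le> 1 + t * (1 + 2 * t)" using q t by (intro add_left_mono mult_left_mono) auto
  also have "\<dots> \<le> 1 + t + 24 * t\<^sup>2" by (simp add: algebra_simps power2_eq_square)
  finally show "x / (x - 1) \<le> (1 + 1 / x) * (1 + 24 / x\<^sup>2)" using rhs by linarith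
  have "1 + x / (x - 1)\<^sup>2 = 1 + t * (1 / (1 - t)) ^ 2" using t u unfolding x by (simp add: field_simps power2_eq_square)
  also have "\<dots> \<le> 1 + t * (1 + 2 * t) ^ 2" using s2 t by (intro add_left_mono mult_left_mono) auto
  also have "(1 + 2 * t) ^ 2 = 1 + 4 * t + 4 * (t * t)" by (simp add: power2_eq_square algebra_simps)
  also have "1 + t * (1 + 4 * t + 4 * (t * t)) \<le> 1 + t * (1 + 6 * t)"
    using t t2 by (intro add_left_mono mult_left_mono) auto
  also have "\<dots> \<le> 1 + t + 24 * t\<^sup>2" by (simp add: algebra_simps power2_eq_square)
  finally show "1 + x / (x - 1)\<^sup>2 \<le> (1 + 1 / x) * (1 + 24 / x\<^sup>2)" using rhs by linarith
  have "1 + x\<^sup>2 / (x - 1) ^ 3 = 1 + t * (1 / (1 - t)) ^ 3" using t u unfolding x by (simp add: field_simps power2_eq_square power3_eq_cube)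
  also have "\<dots> \<le> 1 + t * (1 + 2 * t) ^ 3" using s3 t by (intro add_left_mono mult_left_mono) auto
  also have "(1 + 2 * t) ^ 3 = 1 + 6 * t + 12 * (t * t) + 8 * (t * t) * t" by (simp add: power3_eq_cube algebra_simps)
  also have "1 + t * (1 + 6 * t + 12 * (t * t) + 8 * (t * t) * t) \<le> 1 + t * (1 + 16 * t)"
  proof (intro add_left_mono mult_left_mono)
    have "8 * (t * t) * t \<le> 8 * (t * t) * (1 / 2)" using t by (intro mult_left_mono) auto
    then show "1 + 6 * t + 12 * (t * t) + 8 * (t * t) * t \<le> 1 + 16 * t" using t t2 by linarith
  qed (use t in auto)
  also have "\<dots> \<le> 1 + t + 24 * t\<^sup>2" by (simp add: algebra_simps power2_eq_square)
  finally show "1 + x\<^sup>2 / (x - 1) ^ 3 \<le> (1 + 1 / x) * (1 + 24 / x\<^sup>2)" using rhs by linarith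
qed

lemma ln_ln_3_pos: "ln (ln (3::real)) > 0"
  using ln3_gt_1 by simp

text \<open>\<open>mertens_const\<close> accounts for the small primes in
  \<open>prod_le_phi\<close>, \<open>exp 3\<close> for the large ones. The last factor turns
  \<open>ln 3 + ln (ln H)\<close> into a multiple of \<open>ln (ln H)\<close>, using
  \<open>ln (ln H) \<ge> ln (ln 3) > 0\<close>.\<close>

definition totient_const :: real where
  "totient_const = exp 3 * mertens_const * (ln 3 / ln (ln 3) + 1)"

text \<open>The classical bound for \<open>n / \<phi>(n)\<close>: primes up to about
  \<open>ln H\<close> give a Mertens product of order \<open>ln (ln H)\<close>; there are at most
  \<open>3 * ln H\<close> larger ones, each contributing at most
  \<open>exp (1 / ln H)\<close>.\<close>

lemma prod_le_phi:
  assumes H: "H \<ge> 3" and V: "finite V" "\<And>p. p \<in> V \<Longrightarrow> prime p" and le: "real (\<Prod>V) \<le> 2 * real H"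
  shows "real (\<Prod>V) \<le> totient_const * ln (ln (real H)) * phi V"
proof -
  let ?l = "ln (real H)"
  \<comment> \<open>The extra 1 ensures \<open>p - 1 \<ge> ?l\<close> for every prime
    \<open>p > ?m\<close>.\<close>
  let ?m = "nat \<lceil>?l\<rceil> + 1"
  let ?f = "\<lambda>p. real p / (real p - 1)"
  have l1: "?l > 1" using H ln3_gt_1 by (metis less_le_trans ln_le_cancel_iff numeral_le_real_of_nat_iff of_nat_0_less_iff order_less_le_trans zero_less_numeral not_less_zero gr_zeroI not_numeral_le_zero)
  have ll: "ln (ln 3) \<le> ln ?l" using H ln3_gt_1 by (intro ln_mono) auto
  have pr: "real p \<ge> 2" if "p \<in> V" for p using V(2)[OF that] prime_ge_2_nat by fastforce
  have m: "?m \<ge> 2" "real ?m \<le> 3 * ?l" "?l \<le> real ?m - 1" using l1 by linarith+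
  have f1: "?f p \<ge> 1" if "prime p" for p
  proof -
    have "real p \<ge> 2" using that prime_ge_2_nat by fastforce
    then show ?thesis by (simp add: divide_simps)
  qed
  have "real (\<Prod>V) = phi V * (\<Prod>p\<in>V. ?f p)"
  proof -
    have "(\<Prod>p\<in>V. real p - 1) \<noteq> 0" using pr V(1) by fastforce
    then show ?thesis by (simp add: phi_def prod_dividef)
  qed
  moreover have "(\<Prod>p\<in>V. ?f p) \<le> totient_const * ln ?l"
  proof -
    have "(\<Prod>p\<in>V. ?f p) = (\<Prod>p\<in>{p\<in>V. p \<le> ?m}. ?f p) * (\<Prod>p\<in>{p\<in>V. \<not> p \<le> ?m}. ?f p)"
      using V(1) by (subst prod.union_disjoint[symmetric]) (auto intro!: prod.cong)
    also have "\<dots> \<le> (mertens_const * ln (real ?m)) * exp 3"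
    proof (intro mult_mono)
      have "(\<Prod>p\<in>{p\<in>V. p \<le> ?m}. ?f p) \<le> (\<Prod>p\<in>primes_upto ?m. ?f p)"
      proof (rule prod_mono2)
        show "{p\<in>V. p \<le> ?m} \<subseteq> primes_upto ?m" using V(2) by (auto simp: primes_upto_def)
        show "1 \<le> ?f b" if "b \<in> primes_upto ?m - {p\<in>V. p \<le> ?m}" for b
          using that by (intro f1) (auto simp: primes_upto_def)
        show "0 \<le> ?f a" if "a \<in> {p\<in>V. p \<le> ?m}" for a using f1[of a] V(2)[of a] that by fastforce
      qed simp
      also have "\<dots> \<le> mertens_const * ln (real ?m)"
      proof (rule prod_primes_upto_le_ln[OF m(1)])
        fix p assume "p \<in> primes_upto ?m"
        then have p: "prime p" by (simp add: primes_upto_def)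
        then have "real p \<ge> 2" using prime_ge_2_nat by fastforce
        then show "0 \<le> ?f p \<and> ?f p \<le> (1 + 1 / real p) * (1 + 24 / (real p)\<^sup>2)"
          using euler_factor_estimates(1) by auto
      qed
      finally show "(\<Prod>p\<in>{p\<in>V. p \<le> ?m}. ?f p) \<le> mertens_const * ln (real ?m)" .
      show "0 \<le> mertens_const * ln (real ?m)" using m(1) by (simp add: mertens_const_def)
      show "0 \<le> (\<Prod>p\<in>{p\<in>V. \<not> p \<le> ?m}. ?f p)" using pr by (intro prod_nonneg) fastforce
      let ?B = "{p\<in>V. \<not> p \<le> ?m}"
      have "(\<Prod>p\<in>?B. ?f p) \<le> (\<Prod>p\<in>?B. exp (1 / ?l))"
      proof (rule prod_mono, safe)
        fix p assume p: "p \<in> V" "\<not> p \<le> ?m"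
        show "0 \<le> ?f p" using pr[OF p(1)] by simp
        have "?f p = 1 + 1 / (real p - 1)" using pr[OF p(1)] by (simp add: divide_simps)
        also have "1 / (real p - 1) \<le> 1 / ?l"
        proof (rule divide_left_mono)
          have "real ?m < real p" using p(2) by simp
          then show "?l \<le> real p - 1" using m(3) by linarith
          show "0 < (real p - 1) * ?l" using pr[OF p(1)] l1 by simp
        qed simp
        finally show "?f p \<le> exp (1 / ?l)" using exp_ge_add_one_self[of "1 / ?l"] by linarith
      qed
      also have "\<dots> = exp (real (card ?B) / ?l)" by (simp flip: exp_of_nat_mult)
      also have "\<dots> \<le> exp 3"
      proof -
        \<comment> \<open>Each prime is at least 2, so \<open>2 ^ card ?B \<le> 2 * H\<close>; as
          \<open>?l > 1\<close>, taking logarithms gives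
          \<open>card ?B \<le> 3 * ?l\<close>.\<close>
        have "2 ^ card ?B = (\<Prod>p\<in>?B. (2::real))" by simp
        also have "\<dots> \<le> (\<Prod>p\<in>?B. real p)" using pr by (intro prod_mono) auto
        also have "\<dots> \<le> (\<Prod>p\<in>V. real p)"
          using pr V(1) by (intro prod_mono2) fastforce+
        also have "\<dots> \<le> 2 * real H" using le by simp
        finally have "ln ((2::real) ^ card ?B) \<le> ln (2 * real H)" using H by (subst ln_le_cancel_iff) auto
        then have a: "real (card ?B) * ln 2 \<le> ln 2 + ?l" using H by (simp add: ln_realpow ln_mult)
        have "real (card ?B) \<le> 1 + ?l / ln 2" using a by (simp add: field_simps)
        also have "?l / ln 2 \<le> ?l / (1 / 2)" using l1 ln_2_ge_half by (intro divide_left_mono) auto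
        finally have "real (card ?B) \<le> 3 * ?l" using l1 by simp
        then show ?thesis using l1 by (simp add: divide_simps)
      qed
      finally show "(\<Prod>p\<in>?B. ?f p) \<le> exp 3" .
    qed
    also have "\<dots> \<le> (mertens_const * ((ln 3 / ln (ln 3) + 1) * ln ?l)) * exp 3"
    proof (intro mult_right_mono mult_left_mono)
      have "ln (real ?m) \<le> ln (3 * ?l)" 
      proof (rule ln_mono)
        show "real ?m \<le> 3 * ?l" by (rule m(2))
        show "0 < real ?m" using m(3) l1 by linarith
      qed
      also have "\<dots> = ln 3 + ln ?l" using l1 by (simp add: ln_mult)
      also have "\<dots> \<le> ln 3 / ln (ln 3) * ln ?l + ln ?l"
      proof -
        have "ln 3 / ln (ln 3) * ln (ln 3) \<le> ln 3 / ln (ln (3::real)) * ln ?l"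
          using ll ln_ln_3_pos by (intro mult_left_mono) auto
        then show ?thesis using ln_ln_3_pos by simp
      qed
      finally show "ln (real ?m) \<le> (ln 3 / ln (ln 3) + 1) * ln ?l" by (simp add: distrib_right)
    qed (auto simp: mertens_const_def)
    finally show ?thesis by (simp add: totient_const_def mult_ac)
  qed
  moreover have "phi V > 0" unfolding phi_def using pr by (intro prod_pos) fastforce
  ultimately show ?thesis by (simp add: mult.commute)
qed

section \<open>The third moment of the singular series\<close>

definition distinct_triples :: "int set \<Rightarrow> (int \<times> int \<times> int) set" where
  "distinct_triples A = {(a, b, c). a \<in> A \<and> b \<in> A \<and> c \<in> A \<and> a \<noteq> b \<and> a \<noteq> c \<and> b \<noteq> c}"

definition truncated_series0 :: "nat \<Rightarrow> int set \<Rightarrow> real" where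
  "truncated_series0 N D = (\<Sum>J\<in>Pow D. (-1) ^ card (D - J) * truncated_series N J)"

lemma R3_eq:
  assumes "h \<ge> 0"
  shows "R3 h = (\<Sum>(a, b, c)\<in>distinct_triples {1..int (nat \<lfloor>h\<rfloor>)}. singular_series0 {a, b, c})"
proof -
  have "real_of_int d \<le> h \<longleftrightarrow> d \<le> int (nat \<lfloor>h\<rfloor>)" for d
    using assms by (simp add: le_floor_iff)
  then show ?thesis unfolding R3_def distinct_triples_def by (intro sum.cong) auto
qed

lemma card_distinct_triples_le:
  assumes "finite A"
  shows "card (distinct_triples A) \<le> card A ^ 3"
proof -
  have "card (distinct_triples A) \<le> card (A \<times> A \<times> A)"
    using assms by (intro card_mono) (auto simp: distinct_triples_def)
  then show ?thesis by (simp add: card_cartesian_product power3_eq_cube)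
qed

text \<open>At most \<open>2 ^ 3\<close> subsets occur, each with error at most
  \<open>24 / N\<close> times the cube of the prime product; 192 is 8 * 24.\<close>

lemma singular_series0_truncation:
  assumes D: "D \<subseteq> {1..int N}" "card D \<le> 3" and N: "N \<ge> 3"
  shows "\<bar>singular_series0 D - truncated_series0 N D\<bar>
     \<le> 192 / real N * (\<Prod>p\<in>primes_upto N. real p / (real p - 1)) ^ 3"
proof -
  let ?Z = "(\<Prod>p\<in>primes_upto N. real p / (real p - 1)) ^ 3"
  have finD: "finite D" using D(1) finite_subset by blast
  have Z0: "?Z \<ge> 0"
    by (intro zero_le_power prod_nonneg) (auto simp: primes_upto_def dest: prime_gt_1_nat)
  have "\<bar>singular_series0 D - truncated_series0 N D\<bar>
     = \<bar>\<Sum>J\<in>Pow D. (-1) ^ card (D - J) * (singular_series J - truncated_series N J)\<bar>"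
    by (simp add: singular_series0_def truncated_series0_def right_diff_distrib sum_subtractf)
  also have "\<dots> \<le> (\<Sum>J\<in>Pow D. \<bar>(-1) ^ card (D - J) * (singular_series J - truncated_series N J)\<bar>)"
    by (rule sum_abs)
  also have "\<dots> \<le> (\<Sum>J\<in>Pow D. 24 / real N * ?Z)"
  proof (rule sum_mono)
    fix J assume J: "J \<in> Pow D"
    then have J': "J \<subseteq> {1..int N}" "card J \<le> 3"
      using D card_mono[OF finD, of J] by auto
    have "\<bar>(-1) ^ card (D - J) * (singular_series J - truncated_series N J)\<bar> = \<bar>singular_series J - truncated_series N J\<bar>"
      by (simp add: abs_mult power_abs)
    also have "\<dots> \<le> 24 / real N * truncated_series N J" by (rule singular_series_truncation[OF J' N])
    also have "\<dots> \<le> 24 / real N * ?Z" using truncated_series_le[OF J'(2)] by (intro mult_left_mono) auto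
    finally show "\<bar>(-1) ^ card (D - J) * (singular_series J - truncated_series N J)\<bar> \<le> 24 / real N * ?Z" .
  qed
  also have "\<dots> = real (2 ^ card D) * (24 / real N * ?Z)" using finD by (simp add: card_Pow)
  also have "\<dots> \<le> 8 * (24 / real N * ?Z)"
  proof (rule mult_right_mono)
    have "(2::real) ^ card D \<le> 2 ^ 3" using D(2) by (intro power_increasing) auto
    then show "real (2 ^ card D) \<le> 8" by simp
    show "0 \<le> 24 / real N * ?Z" using Z0 by simp
  qed
  finally show ?thesis by simp
qed

text \<open>There are at most \<open>H ^ 3\<close> triples, so with \<open>N = H ^ 3\<close> the
  errors \<open>192 / N\<close> per triple add up to at most 192 times the cube of the prime
  product. As \<open>ln N = 3 * ln H\<close>, this cutoff changes later bounds only by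
  constants.\<close>

lemma R3_truncation:
  assumes "H \<ge> 3" "N = H ^ 3" "h \<ge> 0" "H = nat \<lfloor>h\<rfloor>"
  shows "\<bar>R3 h - (\<Sum>(a, b, c)\<in>distinct_triples {1..int H}. truncated_series0 N {a, b, c})\<bar>
     \<le> 192 * (\<Prod>p\<in>primes_upto N. real p / (real p - 1)) ^ 3"
proof -
  let ?Z = "(\<Prod>p\<in>primes_upto N. real p / (real p - 1)) ^ 3"
  let ?D = "distinct_triples {1..int H}"
  have Z0: "?Z \<ge> 0"
    by (intro zero_le_power prod_nonneg) (auto simp: primes_upto_def dest: prime_gt_1_nat)
  have HN: "H \<le> N" unfolding assms(2) using assms(1) by (intro self_le_power) auto
  have Npos: "real N > 0" using assms(1,2) by simp
  have "\<bar>R3 h - (\<Sum>(a, b, c)\<in>?D. truncated_series0 N {a, b, c})\<bar>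
     = \<bar>\<Sum>(a, b, c)\<in>?D. singular_series0 {a, b, c} - truncated_series0 N {a, b, c}\<bar>"
    using R3_eq[OF assms(3)] assms(4) by (simp add: case_prod_unfold sum_subtractf)
  also have "\<dots> \<le> (\<Sum>t\<in>?D. \<bar>case t of (a, b, c) \<Rightarrow> singular_series0 {a, b, c} - truncated_series0 N {a, b, c}\<bar>)"
    by (rule sum_abs)
  also have "\<dots> \<le> (\<Sum>t\<in>?D. 192 / real N * ?Z)"
  proof (rule sum_mono)
    fix t assume "t \<in> ?D"
    then obtain a b c where t: "t = (a, b, c)" "a \<in> {1..int H}" "b \<in> {1..int H}" "c \<in> {1..int H}"
      unfolding distinct_triples_def by blast
    have "\<bar>singular_series0 {a, b, c} - truncated_series0 N {a, b, c}\<bar> \<le> 192 / real N * ?Z"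
    proof (rule singular_series0_truncation)
      show "{a, b, c} \<subseteq> {1..int N}" using t HN by auto
      show "card {a, b, c} \<le> 3" by (intro card_insert_le_m1) (auto intro: card_insert_le_m1)
      show "N \<ge> 3" using HN assms(1) by simp
    qed
    then show "\<bar>case t of (a, b, c) \<Rightarrow> singular_series0 {a, b, c} - truncated_series0 N {a, b, c}\<bar> \<le> 192 / real N * ?Z"
      by (simp only: t(1) prod.case)
  qed
  also have "\<dots> = real (card ?D) * (192 / real N * ?Z)" by simp
  also have "\<dots> \<le> real N * (192 / real N * ?Z)"
  proof (rule mult_right_mono)
    have "card ?D \<le> N" using card_distinct_triples_le[of "{1..int H}"] assms(2) by simp
    then show "real (card ?D) \<le> real N" by simp
    show "0 \<le> 192 / real N * ?Z" using Z0 by simp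
  qed
  also have "\<dots> = 192 * ?Z" using Npos by simp
  finally show ?thesis .
qed

lemma ln_bounds_H:
  assumes "H \<ge> 3"
  shows "ln (real H) > 1" "ln (ln (real H)) \<ge> ln (ln 3)" "ln (ln (real H)) > 0"
proof -
  have "ln 3 \<le> ln (real H)" using assms by simp
  then show 1: "ln (real H) > 1" using ln3_gt_1 by linarith
  have "ln 3 > (0::real)" using ln3_gt_1 by linarith
  then show 2: "ln (ln (real H)) \<ge> ln (ln 3)" using \<open>ln 3 \<le> ln (real H)\<close> by (rule ln_mono[rotated])
  then show "ln (ln (real H)) > 0" using ln_ln_3_pos by linarith
qed

lemma exists_power_between:
  assumes "H \<ge> 3"
  obtains J where "H \<le> 2 ^ J" "2 ^ J \<le> 2 * H" "real J \<le> 3 * ln (real H)"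
proof -
  obtain n where n: "2 ^ n < H" "H \<le> 2 ^ (n + 1)"
    using ex_power_ivl2[of 2 H] assms by auto
  have "real (2 ^ n) \<le> real H" using n by (simp only: of_nat_le_iff)
  then have "ln ((2::real) ^ n) \<le> ln (real H)" using assms by (intro ln_mono) auto
  then have "real n * ln 2 \<le> ln (real H)" by (simp add: ln_realpow)
  moreover have "real n * (1 / 2) \<le> real n * ln 2" using ln_2_ge_half by (intro mult_left_mono) auto
  ultimately have "real (n + 1) \<le> 3 * ln (real H)" using ln_bounds_H(1)[OF assms] by simp
  then show ?thesis using n by (intro that[of "n + 1"]) auto
qed

text \<open>192 comes from the truncation, 146 = 144 + 2 from the second moment and the constant
  term. 20736 and 248832 are \<open>3456 * 2\<close> times 3 and 36, the two summands of
  \<open>mean_cube_bound\<close> with \<open>J \<le> 3 * ln H\<close>. Contributions lacking the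
  square of \<open>ln (ln H)\<close> are divided by that of \<open>ln (ln 3)\<close>.\<close>

definition final_const :: real where
  "final_const = (let K = 3 * mertens_const + 1 in
     (192 * K ^ 3 + 20736 * K ^ 4 + 146 * K\<^sup>2) / (ln (ln 3))\<^sup>2 + 248832 * K ^ 3 * totient_const\<^sup>2)"

lemma R3_bound:
  assumes H: "H \<ge> 3" and h: "h \<ge> 0" "H = nat \<lfloor>h\<rfloor>"
  shows "\<bar>R3 h\<bar> \<le> final_const * (real H * ln (real H) ^ 4 * (ln (ln (real H)))\<^sup>2)"
proof -
  define N where "N = H ^ 3"
  define l where "l = ln (real H)"
  define m where "m = ln l"
  \<comment> \<open>The 3 reflects \<open>ln N = 3 * l\<close>; each of \<open>Z\<close>,
    \<open>quot_prod\<close> and \<open>cube_prod\<close> will be at most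
    \<open>K * l\<close>.\<close>
  define K where "K = 3 * mertens_const + 1"
  define T where "T = totient_const"
  interpret prime_set "primes_upto N"
    by unfold_locales (auto simp: primes_upto_def[of N])
  have l: "l > 1" and m: "m \<ge> ln (ln 3)" "m > 0" using ln_bounds_H[OF H] by (auto simp: l_def m_def)
  have K: "K \<ge> 1" by (simp add: K_def mertens_const_def)
  have T: "T \<ge> 0" using ln_ln_3_pos by (simp add: T_def totient_const_def mertens_const_def)
  obtain J where J: "H \<le> 2 ^ J" "2 ^ J \<le> 2 * H" "real J \<le> 3 * l"
    using exists_power_between[OF H] unfolding l_def by blast
  have "real (2 ^ J) \<le> real (2 * H)" using J(2) by (simp only: of_nat_le_iff)
  then have J2: "2 ^ J \<le> 2 * real H" by simp
  have N2: "N \<ge> 2" using H power_mono[of 3 H 3] by (simp add: N_def)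
  have lnN: "ln (real N) = 3 * l" using H by (simp add: N_def l_def ln_realpow)
  have upto: "real p \<ge> 2" if "p \<in> primes_upto N" for p
    using that by (auto simp: primes_upto_def dest: prime_ge_2_nat)
  have mK: "mertens_const * (3 * l) \<le> K * l" using l by (simp add: K_def distrib_right)
  have nn: "0 \<le> real p / (real p - 1)" "0 \<le> 1 + real p / (real p - 1)\<^sup>2" "0 \<le> 1 + (real p)\<^sup>2 / (real p - 1) ^ 3"
    if "p \<in> primes_upto N" for p using upto[OF that] by (auto intro!: add_nonneg_nonneg divide_nonneg_nonneg)
  have Z: "Z \<le> K * l"
    using prod_primes_upto_le_ln[OF N2, of "\<lambda>p. real p / (real p - 1)"] euler_factor_estimates(1)[OF upto] nn(1) mK
    unfolding Z_def lnN by fastforce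
  have Q: "quot_prod \<le> K * l"
    using prod_primes_upto_le_ln[OF N2, of "\<lambda>p. 1 + real p / (real p - 1)\<^sup>2"] euler_factor_estimates(2)[OF upto] nn(2) mK
    unfolding quot_prod_def lnN by fastforce
  have cube: "cube_prod \<le> K * l"
    using prod_primes_upto_le_ln[OF N2, of "\<lambda>p. 1 + (real p)\<^sup>2 / (real p - 1) ^ 3"] euler_factor_estimates(3)[OF upto] nn(3) mK
    unfolding cube_prod_def lnN by fastforce
  have cube0: "cube_prod \<ge> 0" unfolding cube_prod_def using nn(3) by (intro prod_nonneg) auto
  have Kl: "K * l \<ge> 0" using K l by simp
  have "(\<Sum>(a, b, c)\<in>distinct_triples {1..int H}. truncated_series0 N {a, b, c})
    = mean (\<lambda>n. \<Sum>(a, b, c)\<in>distinct_triples {1..int H}. X (a - n) * X (b - n) * X (c - n))"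
    unfolding case_prod_unfold mean_sum
  proof (rule sum.cong[OF refl])
    fix t assume "t \<in> distinct_triples {1..int H}"
    then obtain a b c where t: "t = (a, b, c)" "a \<noteq> b" "a \<noteq> c" "b \<noteq> c" by (auto simp: distinct_triples_def)
    have "truncated_series0 N {a, b, c} = mean (\<lambda>n. \<Prod>d\<in>{a, b, c}. X (d - n))"
      unfolding truncated_series0_def truncated_series_def by (rule mean_prod_X[symmetric]) simp
    also have "\<dots> = mean (\<lambda>n. X (a - n) * X (b - n) * X (c - n))"
      using t by (simp add: mult.assoc)
    finally show "truncated_series0 N {fst t, fst (snd t), snd (snd t)}
        = mean (\<lambda>n. X (fst t - n) * X (fst (snd t) - n) * X (snd (snd t) - n))"
      by (simp only: t(1) fst_conv snd_conv)
  qed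
  also have "\<dots> = mean (\<lambda>n. short_sum {1..int H} n ^ 3) - 3 * (Z - 2) * mean (\<lambda>n. (short_sum {1..int H} n)\<^sup>2)
          + 2 * (Z - 2) * (Z - 1) * real H"
    unfolding distinct_triples_def by (subst mean_sum_distinct_triples) auto
  finally have main: "(\<Sum>(a, b, c)\<in>distinct_triples {1..int H}. truncated_series0 N {a, b, c}) = \<dots>" .
  have trunc: "\<bar>R3 h - (\<Sum>(a, b, c)\<in>distinct_triples {1..int H}. truncated_series0 N {a, b, c})\<bar> \<le> 192 * Z ^ 3"
    unfolding Z_def by (rule R3_truncation[OF H N_def h])
  \<comment> \<open>\<open>T * m\<close> serves as the constant \<open>C\<close> of
    \<open>mean_cube_bound\<close>, where it is squared; this is the source of the squared iterated
    logarithm.\<close>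
  have phi_bound: "real (\<Prod>V) \<le> T * m * phi V" if "V \<subseteq> primes_upto N" "real (\<Prod>V) \<le> 2 ^ J" for V
    unfolding T_def m_def l_def
  proof (rule prod_le_phi[OF H])
    show "finite V" using that(1) finite_S finite_subset by blast
    show "prime p" if "p \<in> V" for p using that \<open>V \<subseteq> primes_upto N\<close> by (auto simp: primes_upto_def)
    show "real (\<Prod>V) \<le> 2 * real H" using that(2) J2 by linarith
  qed
  have Z1: "Z \<ge> 1" by (rule Z_ge_1)
  have cube_term: "\<bar>mean (\<lambda>n. short_sum {1..int H} n ^ 3)\<bar>
     \<le> real H * l ^ 4 * (20736 * K ^ 4 + 248832 * K ^ 3 * T\<^sup>2 * m\<^sup>2)"
  proof -
    have Tm: "T * m \<ge> 0" using T m by simp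
    have "\<bar>mean (\<lambda>n. short_sum {1..int H} n ^ 3)\<bar>
       \<le> 3456 * 2 ^ J * (12 * real J * (T * m)\<^sup>2 + 3 * quot_prod) * (cube_prod * quot_prod\<^sup>2)"
      by (rule mean_cube_bound[OF J(1) Tm phi_bound])
    also have "\<dots> \<le> 3456 * (2 * real H) * (12 * (3 * l) * (T * m)\<^sup>2 + 3 * (K * l)) * ((K * l) * (K * l)\<^sup>2)"
      using J J2 Q cube cube0 Kl quot_prod_nonneg l T K less_imp_le[OF m(2)]
      by (intro mult_mono add_mono power_mono mult_nonneg_nonneg add_nonneg_nonneg order_refl) auto
    also have "\<dots> = real H * l ^ 4 * (20736 * K ^ 4 + 248832 * K ^ 3 * T\<^sup>2 * m\<^sup>2)"
      by (simp add: power2_eq_square eval_nat_numeral algebra_simps)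
    finally show ?thesis .
  qed
  have square_term: "\<bar>3 * (Z - 2) * mean (\<lambda>n. (short_sum {1..int H} n)\<^sup>2)\<bar> \<le> real H * (144 * (K * l)\<^sup>2)"
  proof -
    have "\<bar>3 * (Z - 2) * mean (\<lambda>n. (short_sum {1..int H} n)\<^sup>2)\<bar> = 3 * \<bar>Z - 2\<bar> * \<bar>mean (\<lambda>n. (short_sum {1..int H} n)\<^sup>2)\<bar>"
      by (simp only: abs_mult abs_numeral)
    also have "\<dots> \<le> 3 * (K * l) * (24 * (2 * real H) * (K * l))"
    proof (intro mult_mono)
      show "\<bar>Z - 2\<bar> \<le> K * l" using Z Z1 by linarith
      have "\<bar>mean (\<lambda>n. (short_sum {1..int H} n)\<^sup>2)\<bar> \<le> 24 * 2 ^ J * quot_prod" by (rule mean_square_bound[OF J(1)])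
      also have "\<dots> \<le> 24 * (2 * real H) * (K * l)"
        using J2 Q quot_prod_nonneg by (intro mult_mono) auto
      finally show "\<bar>mean (\<lambda>n. (short_sum {1..int H} n)\<^sup>2)\<bar> \<le> 24 * (2 * real H) * (K * l)" .
    qed (use Kl in auto)
    also have "\<dots> = real H * (144 * (K * l)\<^sup>2)" by (simp add: power2_eq_square algebra_simps)
    finally show ?thesis .
  qed
  have diag_term: "\<bar>2 * (Z - 2) * (Z - 1) * real H\<bar> \<le> real H * (2 * (K * l)\<^sup>2)"
  proof -
    have "\<bar>2 * (Z - 2) * (Z - 1) * real H\<bar> = 2 * \<bar>Z - 2\<bar> * \<bar>Z - 1\<bar> * real H"
      by (simp only: abs_mult abs_numeral abs_of_nat)
    also have "\<dots> \<le> 2 * (K * l) * (K * l) * real H"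
      using Z Z1 Kl by (intro mult_mono order_refl) auto
    finally show ?thesis by (simp add: power2_eq_square algebra_simps)
  qed
  have Z3: "192 * Z ^ 3 \<le> real H * (192 * (K * l) ^ 3)"
  proof -
    have "Z ^ 3 \<le> (K * l) ^ 3" using Z Z1 by (intro power_mono) auto
    then have "192 * Z ^ 3 \<le> 1 * (192 * (K * l) ^ 3)" by simp
    also have "\<dots> \<le> real H * (192 * (K * l) ^ 3)" using H Kl by (intro mult_right_mono) auto
    finally show ?thesis .
  qed
  have l23: "l\<^sup>2 \<le> l ^ 4" "l ^ 3 \<le> l ^ 4" using l by (auto intro!: power_increasing)
  have "\<bar>R3 h\<bar> \<le> 192 * Z ^ 3 + \<bar>mean (\<lambda>n. short_sum {1..int H} n ^ 3)\<bar>
      + \<bar>3 * (Z - 2) * mean (\<lambda>n. (short_sum {1..int H} n)\<^sup>2)\<bar> + \<bar>2 * (Z - 2) * (Z - 1) * real H\<bar>"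
    using trunc main by linarith
  also have "\<dots> \<le> real H * (192 * (K * l) ^ 3) + real H * l ^ 4 * (20736 * K ^ 4 + 248832 * K ^ 3 * T\<^sup>2 * m\<^sup>2)
      + real H * (144 * (K * l)\<^sup>2) + real H * (2 * (K * l)\<^sup>2)"
    using Z3 cube_term square_term diag_term by linarith
  also have "\<dots> = real H * (192 * K ^ 3 * l ^ 3 + 146 * K\<^sup>2 * l\<^sup>2)
      + real H * l ^ 4 * (20736 * K ^ 4 + 248832 * K ^ 3 * T\<^sup>2 * m\<^sup>2)"
    by (simp add: power_mult_distrib algebra_simps)
  also have "\<dots> \<le> real H * (192 * K ^ 3 * l ^ 4 + 146 * K\<^sup>2 * l ^ 4)
      + real H * l ^ 4 * (20736 * K ^ 4 + 248832 * K ^ 3 * T\<^sup>2 * m\<^sup>2)"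
    using l23 K by (intro add_mono mult_left_mono order_refl) auto
  also have "\<dots> = real H * l ^ 4 * ((192 * K ^ 3 + 20736 * K ^ 4 + 146 * K\<^sup>2) * 1 + 248832 * K ^ 3 * T\<^sup>2 * m\<^sup>2)"
    by (simp add: algebra_simps)
  \<comment> \<open>The terms without \<open>m\<close> are enlarged by
    \<open>m^2 / (ln (ln 3))^2\<close>, which is at least 1 because
    \<open>H \<ge> 3\<close>.\<close>
  also have "\<dots> \<le> real H * l ^ 4 * ((192 * K ^ 3 + 20736 * K ^ 4 + 146 * K\<^sup>2) * (m\<^sup>2 / (ln (ln 3))\<^sup>2) + 248832 * K ^ 3 * T\<^sup>2 * m\<^sup>2)"
  proof (intro mult_left_mono add_right_mono)
    have "(ln (ln 3))\<^sup>2 \<le> m\<^sup>2" using m ln_ln_3_pos by (intro power_mono) auto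
    then show "1 \<le> m\<^sup>2 / (ln (ln 3))\<^sup>2" using ln_ln_3_pos by (simp add: divide_simps)
  qed (use K l in auto)
  also have "\<dots> = final_const * (real H * l ^ 4 * m\<^sup>2)"
    unfolding final_const_def Let_def K_def[symmetric] T_def[symmetric]
    by (simp add: algebra_simps add_divide_distrib)
  finally show ?thesis by (simp add: l_def m_def)
qed

theorem theorem1p2:
  "\<exists>C::real. C > 0 \<and>
     (\<forall>h::real. h \<ge> 2 \<longrightarrow> \<bar>R3 h\<bar> \<le> C * (h * (ln h) ^ 4 * (ln (ln h)) ^ 2))"
proof (intro exI conjI allI impI)
  have "final_const \<ge> 0" unfolding final_const_def Let_def
    by (intro add_nonneg_nonneg mult_nonneg_nonneg divide_nonneg_nonneg) (auto simp: mertens_const_def)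
  then show C: "final_const + 1 > 0" by simp
  fix h :: real assume h: "h \<ge> 2"
  define H where "H = nat \<lfloor>h\<rfloor>"
  show "\<bar>R3 h\<bar> \<le> (final_const + 1) * (h * (ln h) ^ 4 * (ln (ln h)) ^ 2)"
  proof (cases "h < 3")
    \<comment> \<open>The right-hand side vanishes at \<open>h = exp 1\<close>, which lies in this
      range. The claim holds because \<open>{1, 2}\<close> contains no three distinct integers, so
      that \<open>R3 h = 0\<close>.\<close>
    case True
    then have "{1..int (nat \<lfloor>h\<rfloor>)} \<subseteq> {1, 2}" using h by auto linarith+
    then have "distinct_triples {1..int (nat \<lfloor>h\<rfloor>)} = {}" unfolding distinct_triples_def by blast
    then have "R3 h = 0" using R3_eq[of h] h by simp
    then show ?thesis using C h by simp
  next
    case False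
    then have H: "H \<ge> 3" "real H \<le> h" by (simp_all add: H_def le_nat_floor) 
    note lb = ln_bounds_H[OF H(1)]
    have a: "ln (real H) \<le> ln h" using H by (intro ln_mono) auto
    have b: "ln (ln (real H)) \<le> ln (ln h)" by (rule ln_mono[OF a]) (use lb in simp)
    have nn: "0 \<le> ln (real H)" "0 \<le> ln (ln (real H))" "0 \<le> h" "0 \<le> ln h" using lb a h by linarith+
    \<comment> \<open>Squaring the iterated logarithm preserves the order because its value at
      \<open>H \<ge> 3\<close> is already positive.\<close>
    have "real H * ln (real H) ^ 4 * (ln (ln (real H)))\<^sup>2 \<le> h * ln h ^ 4 * (ln (ln h))\<^sup>2"
      by (rule mult_mono[OF mult_mono[OF H(2) power_mono[OF a nn(1)]] power_mono[OF b nn(2)]]) (use nn in auto)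
    moreover have "\<bar>R3 h\<bar> \<le> final_const * (real H * ln (real H) ^ 4 * (ln (ln (real H)))\<^sup>2)"
      by (rule R3_bound[OF H(1) _ H_def]) (use h in simp)
    moreover have "0 \<le> real H * ln (real H) ^ 4 * (ln (ln (real H)))\<^sup>2" using lb by simp
    ultimately have "\<bar>R3 h\<bar> \<le> final_const * (h * ln h ^ 4 * (ln (ln h))\<^sup>2)" "0 \<le> h * ln h ^ 4 * (ln (ln h))\<^sup>2"
      using mult_left_mono[of _ _ final_const] \<open>final_const \<ge> 0\<close> by (meson order_trans)+
    then show ?thesis by (simp add: distrib_right)
  qed
qed

end
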